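(* Let $X:M\to TM$ be a vector field on a smooth manifold $M$. For each multivector field $\lambda\in\Phi(\tau_M)$, $$\mathcal L_X\lambda=X^*d_T\lambda\qquad\text{and}\qquad\lambda=X^*v_T\lambda.$$
   Context: Everything is smooth. $\tau_M:TM\to M$ is the projection, $\Phi(\tau_M)=\bigoplus_r\Phi^r(\tau_M)$ the exterior algebra of multivector fields on $M$; $\mathcal L_X$ is the Lie derivative. Coordinates $(x^i)$ on $M$ induce $(x^i,\dot x^j)$ on $TM$. Lifts: for a function $f$ on $M$ put $v_Tf=f\circ\tau_M$ and $d_Tf(v)=\langle df,v\rangle$. For a vector field $Y=Y^i\partial_{x^i}$ on $M$, the vertical lift is $Y^v=Y^i\partial_{\dot x^i}$ (generator of $v\mapsto v+tY(\tau_Mv)$) and the complete lift is $Y^c=Y^i\partial_{x^i}+\frac{\partial Y^i}{\partial x^k}\dot x^k\partial_{\dot x^i}$ (generator of $T\varphi^t$, $\varphi^t$ the flow of $Y$). $v_T:\Phi(\tau_M)\to\Phi(\tau_{TM})$ is the unique graded algebra homomorphism extending $v_T$ on functions and $Y\mapsto Y^v$. $d_T:\Phi(\tau_M)\to\Phi(\tau_{TM})$ is the unique linear map with the given value on functions, $d_TY=Y^c$ for vector fields, and $d_T(X\wedge Z)=d_TX\wedge v_TZ+v_TX\wedge d_TZ$. The map $X^*$: along the image $X(M)\subset TM$ there is a decomposition $T_{X(M)}TM=H_X TM\oplus V_XTM$, where $H_XTM$ consists of vectors tangent to $X(M)$ and $V_XTM$ of vertical vectors (kernel of $T\tau_M$).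 Let $P_X$ be the projection onto $V_XTM$ along $H_XTM$. For a vector field $Y$ on $TM$, $X^*Y$ is the unique vector field on $M$ such that $v_T(X^*Y)|_{X(M)}=P_XY|_{X(M)}$; for a function $F$ on $TM$, $X^*F=F\circ X$. These extend uniquely to a homomorphism of graded algebras $X^*:\Phi(\tau_{TM})\to\Phi(\tau_M)$. *)

theory Defs
  imports "HOL-Analysis.Analysis"
begin

section \<open>Smooth maps and smooth manifolds\<close>

text \<open>
  Manifolds are modelled on a Euclidean space \<open>'e :: {real_inner, heine_borel}\<close>. The class
  \<^class>\<open>heine_borel\<close> forces a normed space to be finite-dimensional; unlike
  \<^class>\<open>euclidean_space\<close>, this sort also allows dimension zero.
\<close>

text \<open>
  \<open>Ck_on k S f\<close> is meant for open \<open>S\<close>; in finite dimension, asking for total differentiability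
  on \<open>S\<close> and for every directional derivative to be of class \<open>C\<^sup>k\<close> is being of class \<open>C\<^sup>k\<^sup>+\<^sup>1\<close>.
\<close>

primrec Ck_on :: "nat \<Rightarrow> 'e::real_normed_vector set \<Rightarrow> ('e \<Rightarrow> 'f::real_normed_vector) \<Rightarrow> bool" where
  "Ck_on 0 S f \<longleftrightarrow> continuous_on S f"
| "Ck_on (Suc k) S f \<longleftrightarrow>
     (\<forall>x\<in>S. f differentiable (at x)) \<and> (\<forall>v. Ck_on k S (\<lambda>x. frechet_derivative f (at x) v))"

definition smooth_on :: "'e::real_normed_vector set \<Rightarrow> ('e \<Rightarrow> 'f::real_normed_vector) \<Rightarrow> bool" where
  "smooth_on S f \<longleftrightarrow> (\<forall>k. Ck_on k S f)"

text \<open>A chart is its domain together with its coordinate map.\<close>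

type_synonym ('a, 'e) chart = "'a set \<times> ('a \<Rightarrow> 'e)"

definition chart_inv :: "('a, 'e) chart \<Rightarrow> 'e \<Rightarrow> 'a" where
  "chart_inv c = inv_into (fst c) (snd c)"

definition trans_map :: "('a, 'e) chart \<Rightarrow> ('a, 'e) chart \<Rightarrow> 'e \<Rightarrow> 'e" where
  "trans_map c d = snd d \<circ> chart_inv c"

text \<open>
  A manifold is given by a smooth atlas (not necessarily a maximal one), which determines the
  underlying set and the topology.
\<close>

definition carrier_of :: "('a, 'e) chart set \<Rightarrow> 'a set" where
  "carrier_of A = (\<Union>c\<in>A. fst c)"

definition manifold_topology :: "('a, 'e::topological_space) chart set \<Rightarrow> 'a topology" where
  "manifold_topology A =
     topology (\<lambda>U. U \<subseteq> carrier_of A \<and> (\<forall>c\<in>A. open (snd c ` (U \<inter> fst c))))"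

definition smooth_manifold :: "('a, 'e::{real_inner, heine_borel}) chart set \<Rightarrow> bool" where
  "smooth_manifold A \<longleftrightarrow>
     (\<forall>c\<in>A. inj_on (snd c) (fst c) \<and> open (snd c ` fst c)) \<and>
     (\<forall>c\<in>A. \<forall>d\<in>A. open (snd c ` (fst c \<inter> fst d)) \<and>
        smooth_on (snd c ` (fst c \<inter> fst d)) (trans_map c d)) \<and>
     Hausdorff_space (manifold_topology A) \<and>
     second_countable (manifold_topology A)"

definition charts_at :: "('a, 'e) chart set \<Rightarrow> 'a \<Rightarrow> ('a, 'e) chart set" where
  "charts_at A p = {c \<in> A. p \<in> fst c}"

text \<open>Used in definitions that do not depend on the choice of the chart.\<close>

definition some_chart :: "('a, 'e) chart set \<Rightarrow> 'a \<Rightarrow> ('a, 'e) chart" where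
  "some_chart A p = (SOME c. c \<in> charts_at A p)"

definition smooth_functions :: "('a, 'e::{real_inner, heine_borel}) chart set \<Rightarrow> ('a \<Rightarrow> real) set" where
  "smooth_functions A = {f. \<forall>c\<in>A. smooth_on (snd c ` fst c) (f \<circ> chart_inv c)}"

section \<open>Tangent vectors and the tangent bundle\<close>

text \<open>
  A tangent vector at \<open>p\<close> is the family of its component vectors in all charts at \<open>p\<close>, related by
  the derivatives of the transition maps. Components in charts not containing \<open>p\<close> are set to \<open>0\<close>,
  so that equality of tangent vectors is equality of functions and the vector space operations
  are pointwise.
\<close>

type_synonym ('a, 'e) tvec = "('a, 'e) chart \<Rightarrow> 'e"

definition tangent_space :: "('a, 'e::{real_inner, heine_borel}) chart set \<Rightarrow> 'a \<Rightarrow> ('a, 'e) tvec set" where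
  "tangent_space A p = {v.
     (\<forall>c\<in>charts_at A p. \<forall>d\<in>charts_at A p.
        v d = frechet_derivative (trans_map c d) (at (snd c p)) (v c)) \<and>
     (\<forall>c. c \<notin> charts_at A p \<longrightarrow> v c = 0)}"

definition tangent_map ::
  "('a, 'e::{real_inner, heine_borel}) chart set \<Rightarrow> ('b, 'f::{real_inner, heine_borel}) chart set \<Rightarrow>
   ('a \<Rightarrow> 'b) \<Rightarrow> 'a \<Rightarrow> ('a, 'e) tvec \<Rightarrow> ('b, 'f) tvec" where
  "tangent_map A B f p v = (\<lambda>d.
     if d \<in> charts_at B (f p)
     then let c = some_chart A p in
       frechet_derivative (snd d \<circ> f \<circ> chart_inv c) (at (snd c p)) (v c)
     else 0)"

text \<open>The pairing \<open>\<langle>df, v\<rangle>\<close> for \<open>v\<close> tangent at \<open>p\<close>.\<close>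

definition differential ::
  "('a, 'e::{real_inner, heine_borel}) chart set \<Rightarrow> ('a \<Rightarrow> real) \<Rightarrow> 'a \<Rightarrow> ('a, 'e) tvec \<Rightarrow> real" where
  "differential A f p v =
     (let c = some_chart A p in frechet_derivative (f \<circ> chart_inv c) (at (snd c p)) (v c))"

text \<open>
  A point of \<open>TM\<close> is a pair \<open>(p, v)\<close> with \<open>v\<close> tangent at \<open>p\<close>, so that the projection
  \<open>\<tau>\<^sub>M\<close> is \<^const>\<open>fst\<close> and a vector field \<open>X\<close> is the section \<open>p \<mapsto> (p, X p)\<close>.
\<close>

definition tangent_chart ::
  "('a, 'e::{real_inner, heine_borel}) chart set \<Rightarrow> ('a, 'e) chart \<Rightarrow>
   ('a \<times> ('a, 'e) tvec, 'e \<times> 'e) chart" where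
  "tangent_chart A c =
     ({(p, v). p \<in> fst c \<and> v \<in> tangent_space A p}, \<lambda>(p, v). (snd c p, v c))"

definition tangent_bundle ::
  "('a, 'e::{real_inner, heine_borel}) chart set \<Rightarrow> ('a \<times> ('a, 'e) tvec, 'e \<times> 'e) chart set" where
  "tangent_bundle A = tangent_chart A ` A"

text \<open>The chart of \<open>M\<close> inducing a given chart of \<open>TM\<close>; \<^const>\<open>tangent_chart\<close> is injective.\<close>

definition base_chart ::
  "('a, 'e::{real_inner, heine_borel}) chart set \<Rightarrow> ('a \<times> ('a, 'e) tvec, 'e \<times> 'e) chart \<Rightarrow>
   ('a, 'e) chart" where
  "base_chart A = inv_into A (tangent_chart A)"

section \<open>Vector fields\<close>

definition vector_rep :: "('a, 'e) chart \<Rightarrow> ('a \<Rightarrow> ('a, 'e) tvec) \<Rightarrow> 'e \<Rightarrow> 'e" where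
  "vector_rep c Y = (\<lambda>x. Y (chart_inv c x) c)"

definition vector_fields ::
  "('a, 'e::{real_inner, heine_borel}) chart set \<Rightarrow> ('a \<Rightarrow> ('a, 'e) tvec) set" where
  "vector_fields A = {Y.
     (\<forall>p. Y p \<in> tangent_space A p) \<and> (\<forall>c\<in>A. smooth_on (snd c ` fst c) (vector_rep c Y))}"

text \<open>In coordinates: \<open>[X, Y]\<^sup>i = X\<^sup>j \<partial>\<^sub>j Y\<^sup>i - Y\<^sup>j \<partial>\<^sub>j X\<^sup>i\<close>.\<close>

definition lie_bracket ::
  "('a, 'e::{real_inner, heine_borel}) chart set \<Rightarrow> ('a \<Rightarrow> ('a, 'e) tvec) \<Rightarrow>
   ('a \<Rightarrow> ('a, 'e) tvec) \<Rightarrow> 'a \<Rightarrow> ('a, 'e) tvec" where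
  "lie_bracket A X Y p = (\<lambda>c.
     if c \<in> charts_at A p
     then frechet_derivative (vector_rep c Y) (at (snd c p)) (X p c)
        - frechet_derivative (vector_rep c X) (at (snd c p)) (Y p c)
     else 0)"

definition vertical_lift ::
  "('a, 'e::{real_inner, heine_borel}) chart set \<Rightarrow> ('a \<Rightarrow> ('a, 'e) tvec) \<Rightarrow>
   'a \<times> ('a, 'e) tvec \<Rightarrow> ('a \<times> ('a, 'e) tvec, 'e \<times> 'e) tvec" where
  "vertical_lift A Y q = (\<lambda>C.
     if C \<in> charts_at (tangent_bundle A) q then (0, Y (fst q) (base_chart A C)) else 0)"

text \<open>
  In coordinates, \<open>Y\<^sup>c = Y\<^sup>i \<partial>/\<partial>x\<^sup>i + (\<partial>Y\<^sup>i/\<partial>x\<^sup>k) u\<^sup>k \<partial>/\<partial>u\<^sup>i\<close> at the point with base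
  coordinates \<open>x\<close> and fibre coordinates \<open>u\<close>.
\<close>

definition complete_lift ::
  "('a, 'e::{real_inner, heine_borel}) chart set \<Rightarrow> ('a \<Rightarrow> ('a, 'e) tvec) \<Rightarrow>
   'a \<times> ('a, 'e) tvec \<Rightarrow> ('a \<times> ('a, 'e) tvec, 'e \<times> 'e) tvec" where
  "complete_lift A Y q = (\<lambda>C.
     if C \<in> charts_at (tangent_bundle A) q
     then let c = base_chart A C in
       (Y (fst q) c, frechet_derivative (vector_rep c Y) (at (snd c (fst q))) (snd q c))
     else 0)"

section \<open>Multivector fields\<close>

text \<open>
  The exterior algebra of a finite-dimensional space \<open>'e\<close> is realised by identifying its degree-\<open>r\<close>
  part with the alternating \<open>r\<close>-linear forms on the dual space, where
  \<open>v\<^sub>1 \<and> \<dots> \<and> v\<^sub>r\<close> corresponds to \<open>(\<xi>\<^sub>1, \<dots>, \<xi>\<^sub>r) \<mapsto> det (\<xi>\<^sub>i v\<^sub>j)\<close>. An element of the whole algebra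
  is a function on lists of covectors, its component of degree \<open>r\<close> being the restriction to lists of
  length \<open>r\<close>; this vanishes for \<open>r\<close> above the dimension, so the sum of degrees is direct and finite.
\<close>

type_synonym 'e mvec = "('e \<Rightarrow>\<^sub>L real) list \<Rightarrow> real"

definition exterior_algebra :: "'e::real_normed_vector mvec set" where
  "exterior_algebra = {w.
     (\<forall>xs i. i < length xs \<longrightarrow> linear (\<lambda>x. w (xs[i := x]))) \<and>
     (\<forall>xs. \<not> distinct xs \<longrightarrow> w xs = 0)}"

text \<open>The sign of the shuffle of \<open>{..<n}\<close> which moves the elements of \<open>S\<close> to the front.\<close>

definition shuffle_sign :: "nat set \<Rightarrow> real" where
  "shuffle_sign S = (- 1) ^ card {(i, j). i \<in> S \<and> j \<notin> S \<and> j < i}"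

definition wedge :: "'e::real_normed_vector mvec \<Rightarrow> 'e mvec \<Rightarrow> 'e mvec" where
  "wedge v w = (\<lambda>xs.
     \<Sum>S\<in>Pow {..<length xs}. shuffle_sign S * v (nths xs S) * w (nths xs (- S)))"

text \<open>
  Multivectors at a point are, like tangent vectors, families of components in the charts,
  transformed by the exterior powers of the derivatives of the transition maps.
\<close>

type_synonym ('a, 'e) mvfield = "'a \<Rightarrow> ('a, 'e) chart \<Rightarrow> 'e mvec"

definition multivectors_at ::
  "('a, 'e::{real_inner, heine_borel}) chart set \<Rightarrow> 'a \<Rightarrow> (('a, 'e) chart \<Rightarrow> 'e mvec) set" where
  "multivectors_at A p = {w.
     (\<forall>c. w c \<in> exterior_algebra) \<and>
     (\<forall>c\<in>charts_at A p. \<forall>d\<in>charts_at A p. \<forall>xs. w d xs =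
        w c (map (\<lambda>x. x o\<^sub>L Blinfun (frechet_derivative (trans_map c d) (at (snd c p)))) xs)) \<and>
     (\<forall>c. c \<notin> charts_at A p \<longrightarrow> w c = (\<lambda>_. 0))}"

definition multivector_fields ::
  "('a, 'e::{real_inner, heine_borel}) chart set \<Rightarrow> ('a, 'e) mvfield set" where
  "multivector_fields A = {w.
     (\<forall>p. w p \<in> multivectors_at A p) \<and>
     (\<forall>c\<in>A. \<forall>xs. smooth_on (snd c ` fst c) (\<lambda>x. w (chart_inv c x) c xs))}"

definition multivector_fields_deg ::
  "nat \<Rightarrow> ('a, 'e::{real_inner, heine_borel}) chart set \<Rightarrow> ('a, 'e) mvfield set" where
  "multivector_fields_deg r A =
     {w \<in> multivector_fields A. \<forall>p c xs. length xs \<noteq> r \<longrightarrow> w p c xs = 0}"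

definition mv_lincomb ::
  "real \<Rightarrow> ('a, 'e::real_normed_vector) mvfield \<Rightarrow> real \<Rightarrow> ('a, 'e) mvfield \<Rightarrow> ('a, 'e) mvfield" where
  "mv_lincomb a v b w = (\<lambda>p c xs. a * v p c xs + b * w p c xs)"

definition mv_wedge ::
  "('a, 'e::real_normed_vector) mvfield \<Rightarrow> ('a, 'e) mvfield \<Rightarrow> ('a, 'e) mvfield" where
  "mv_wedge v w = (\<lambda>p c. wedge (v p c) (w p c))"

text \<open>Functions and vector fields as multivector fields of degree \<open>0\<close> and \<open>1\<close>.\<close>

definition of_function ::
  "('a, 'e::{real_inner, heine_borel}) chart set \<Rightarrow> ('a \<Rightarrow> real) \<Rightarrow> ('a, 'e) mvfield" where
  "of_function A f = (\<lambda>p c xs. if c \<in> charts_at A p \<and> xs = [] then f p else 0)"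

definition of_vector_field ::
  "('a \<Rightarrow> ('a, 'e::real_normed_vector) tvec) \<Rightarrow> ('a, 'e) mvfield" where
  "of_vector_field Y = (\<lambda>p c xs. case xs of [x] \<Rightarrow> blinfun_apply x (Y p c) | _ \<Rightarrow> 0)"

text \<open>
  Maps between spaces of multivector fields are extensional functions (\<^const>\<open>undefined\<close> outside
  the domain), so that descriptions unique on multivector fields are unique as functions.
\<close>

definition mv_linear ::
  "('a, 'e::{real_inner, heine_borel}) chart set \<Rightarrow> ('b, 'f::{real_inner, heine_borel}) chart set \<Rightarrow>
   (('a, 'e) mvfield \<Rightarrow> ('b, 'f) mvfield) \<Rightarrow> bool" where
  "mv_linear A B F \<longleftrightarrow>
     F \<in> multivector_fields A \<rightarrow>\<^sub>E multivector_fields B \<and>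
     (\<forall>v\<in>multivector_fields A. \<forall>w\<in>multivector_fields A. \<forall>a b.
        F (mv_lincomb a v b w) = mv_lincomb a (F v) b (F w))"

definition graded_algebra_hom ::
  "('a, 'e::{real_inner, heine_borel}) chart set \<Rightarrow> ('b, 'f::{real_inner, heine_borel}) chart set \<Rightarrow>
   (('a, 'e) mvfield \<Rightarrow> ('b, 'f) mvfield) \<Rightarrow> bool" where
  "graded_algebra_hom A B F \<longleftrightarrow>
     mv_linear A B F \<and>
     (\<forall>r. F ` multivector_fields_deg r A \<subseteq> multivector_fields_deg r B) \<and>
     F (of_function A (\<lambda>_. 1)) = of_function B (\<lambda>_. 1) \<and>
     (\<forall>v\<in>multivector_fields A. \<forall>w\<in>multivector_fields A.
        F (mv_wedge v w) = mv_wedge (F v) (F w))"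

section \<open>The lifts, the Lie derivative and the pullback by a vector field\<close>

definition vT ::
  "('a, 'e::{real_inner, heine_borel}) chart set \<Rightarrow>
   ('a, 'e) mvfield \<Rightarrow> ('a \<times> ('a, 'e) tvec, 'e \<times> 'e) mvfield" where
  "vT A = (THE F. graded_algebra_hom A (tangent_bundle A) F \<and>
     (\<forall>f\<in>smooth_functions A. F (of_function A f) = of_function (tangent_bundle A) (f \<circ> fst)) \<and>
     (\<forall>Y\<in>vector_fields A. F (of_vector_field Y) = of_vector_field (vertical_lift A Y)))"

definition dT ::
  "('a, 'e::{real_inner, heine_borel}) chart set \<Rightarrow>
   ('a, 'e) mvfield \<Rightarrow> ('a \<times> ('a, 'e) tvec, 'e \<times> 'e) mvfield" where
  "dT A = (THE F. mv_linear A (tangent_bundle A) F \<and>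
     (\<forall>f\<in>smooth_functions A. F (of_function A f) =
        of_function (tangent_bundle A) (\<lambda>(p, v). differential A f p v)) \<and>
     (\<forall>Y\<in>vector_fields A. F (of_vector_field Y) = of_vector_field (complete_lift A Y)) \<and>
     (\<forall>v\<in>multivector_fields A. \<forall>w\<in>multivector_fields A. F (mv_wedge v w) =
        mv_lincomb 1 (mv_wedge (F v) (vT A w)) 1 (mv_wedge (vT A v) (F w))))"

text \<open>
  The Lie derivative is the derivation (of degree \<open>0\<close>) of the exterior algebra which is
  \<open>f \<mapsto> X f\<close> on functions and \<open>Y \<mapsto> [X, Y]\<close> on vector fields.
\<close>

definition lie_derivative ::
  "('a, 'e::{real_inner, heine_borel}) chart set \<Rightarrow> ('a \<Rightarrow> ('a, 'e) tvec) \<Rightarrow>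
   ('a, 'e) mvfield \<Rightarrow> ('a, 'e) mvfield" where
  "lie_derivative A X = (THE F. mv_linear A A F \<and>
     (\<forall>f\<in>smooth_functions A. F (of_function A f) =
        of_function A (\<lambda>p. differential A f p (X p))) \<and>
     (\<forall>Y\<in>vector_fields A. F (of_vector_field Y) = of_vector_field (lie_bracket A X Y)) \<and>
     (\<forall>v\<in>multivector_fields A. \<forall>w\<in>multivector_fields A. F (mv_wedge v w) =
        mv_lincomb 1 (mv_wedge (F v) w) 1 (mv_wedge v (F w))))"

text \<open>
  At the point \<open>X(p)\<close> of \<open>X(M)\<close>, the vectors tangent to \<open>X(M)\<close> are the images under the tangent
  map of \<open>X : M \<rightarrow> TM\<close>.
\<close>

definition horizontal_space ::
  "('a, 'e::{real_inner, heine_borel}) chart set \<Rightarrow> ('a \<Rightarrow> ('a, 'e) tvec) \<Rightarrow> 'a \<Rightarrow>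
   ('a \<times> ('a, 'e) tvec, 'e \<times> 'e) tvec set" where
  "horizontal_space A X p =
     tangent_map A (tangent_bundle A) (\<lambda>p'. (p', X p')) p ` tangent_space A p"

definition vertical_space ::
  "('a, 'e::{real_inner, heine_borel}) chart set \<Rightarrow> 'a \<times> ('a, 'e) tvec \<Rightarrow>
   ('a \<times> ('a, 'e) tvec, 'e \<times> 'e) tvec set" where
  "vertical_space A q =
     {w \<in> tangent_space (tangent_bundle A) q. tangent_map (tangent_bundle A) A fst q w = (\<lambda>_. 0)}"

definition vertical_projection ::
  "('a, 'e::{real_inner, heine_borel}) chart set \<Rightarrow> ('a \<Rightarrow> ('a, 'e) tvec) \<Rightarrow> 'a \<Rightarrow>
   ('a \<times> ('a, 'e) tvec, 'e \<times> 'e) tvec \<Rightarrow> ('a \<times> ('a, 'e) tvec, 'e \<times> 'e) tvec" where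
  "vertical_projection A X p w =
     (THE u. u \<in> vertical_space A (p, X p) \<and> (\<lambda>C. w C - u C) \<in> horizontal_space A X p)"

definition pullback_vector_field ::
  "('a, 'e::{real_inner, heine_borel}) chart set \<Rightarrow> ('a \<Rightarrow> ('a, 'e) tvec) \<Rightarrow>
   ('a \<times> ('a, 'e) tvec \<Rightarrow> ('a \<times> ('a, 'e) tvec, 'e \<times> 'e) tvec) \<Rightarrow> 'a \<Rightarrow> ('a, 'e) tvec" where
  "pullback_vector_field A X Y = (THE Z. Z \<in> vector_fields A \<and>
     (\<forall>p\<in>carrier_of A. vertical_lift A Z (p, X p) = vertical_projection A X p (Y (p, X p))))"

definition pullback ::
  "('a, 'e::{real_inner, heine_borel}) chart set \<Rightarrow> ('a \<Rightarrow> ('a, 'e) tvec) \<Rightarrow>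
   ('a \<times> ('a, 'e) tvec, 'e \<times> 'e) mvfield \<Rightarrow> ('a, 'e) mvfield" where
  "pullback A X = (THE F. graded_algebra_hom (tangent_bundle A) A F \<and>
     (\<forall>f\<in>smooth_functions (tangent_bundle A).
        F (of_function (tangent_bundle A) f) = of_function A (\<lambda>p. f (p, X p))) \<and>
     (\<forall>Y\<in>vector_fields (tangent_bundle A).
        F (of_vector_field Y) = of_vector_field (pullback_vector_field A X Y)))"

end

theory Submission
  imports Defs
begin

text \<open>
  All four operations have explicit coordinate formulas. Write \<open>T\<^sub>t\<close> for the push-forward of
  multivectors along \<open>u \<mapsto> (t u, u)\<close>. At the point \<open>(x, v)\<close> the vertical lift of \<open>\<lambda>\<close> is
  \<open>T\<^sub>0 (\<lambda> x)\<close>, the complete lift is the derivative of \<open>t \<mapsto> T\<^sub>t (\<lambda> (x + t v))\<close> at \<open>t = 0\<close>, and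
  \<open>X\<^sup>*\<close> is the push-forward along \<open>(y, z) \<mapsto> z - DX y\<close> at the point \<open>(x, X x)\<close>. A derivative of
  algebra homomorphisms is a derivation, so \<open>X\<^sup>* d\<^sub>T\<close> is a derivation over \<open>X\<^sup>* v\<^sub>T = id\<close>; it sends
  \<open>f\<close> to \<open>X f\<close> and \<open>Y\<close> to \<open>DY X - DX Y\<close>. These values determine it: multiplied by the square of a
  bump function \<open>h\<close>, a multivector field of degree \<open>r + 1\<close> becomes \<open>1/(r + 1)\<close> times the sum of the
  global products \<open>(h e) \<and> (h \<iota> \<lambda>)\<close>, where \<open>e\<close> runs through a basis and \<open>\<iota>\<close> is the contraction with
  the dual covector; so induction on the degree applies.
\<close>

section \<open>Calculus in finite-dimensional inner product spaces\<close>

text \<open>All operations are given by definite descriptions, so existence and uniqueness must be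
  established for each of \<open>vT\<close>, \<open>dT\<close>, \<open>lie_derivative\<close> and
  \<open>pullback\<close>. The explicit formulas supply existence; the difficulty there is
  independence of the chart. A transition map of \<open>TM\<close> is a tangent map, so its
  derivative contains the Hessian of a transition map of \<open>M\<close>. The curve formula for the
  complete lift produces the same Hessian with its two arguments exchanged, hence the symmetry of
  second derivatives. In \<open>z - DX y\<close> a Hessian coming from \<open>z\<close> cancels one
  coming from \<open>DX\<close>. Uniqueness concerns maps defined on global fields only, so local
  data are made global by bump functions. Each factor of a product takes one \<open>h\<close>, hence
  the square; as \<open>h\<close> is 1 at its centre, the value at that point is recovered. The
  pullback has fields on \<open>TM\<close> as arguments, so bump functions are required there as
  well. The map \<open>u \<mapsto> (t u, u)\<close> is suggested by vector fields:
  \<open>(t Y(x + t v), Y(x + t v))\<close> is vertical at \<open>t = 0\<close> and has the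
  derivative \<open>(Y, DY v)\<close> there, the complete lift.\<close>

text \<open>Distinct orthonormal vectors have distance sqrt 2, so each ball of radius 1/2 contains
  at most one of them. Total boundedness of the unit ball therefore bounds the size of orthonormal
  sets, and one of maximal size spans: a nonzero residual of an expansion could be normalised and
  adjoined.\<close>

lemma finite_orthonormal_spanning_exists:
  "\<exists>B::'e::{real_inner,heine_borel} set. finite B \<and>
     (\<forall>a\<in>B. \<forall>b\<in>B. a \<bullet> b = (if a = b then 1 else 0)) \<and> (\<forall>x. (\<Sum>b\<in>B. (x \<bullet> b) *\<^sub>R b) = x)"
proof -
  define ON where "ON B \<longleftrightarrow> finite B \<and> (\<forall>a\<in>B. \<forall>b\<in>B. a \<bullet> b = (if a = b then 1 else 0))"
    for B :: "'e set"
  have "compact (cball (0::'e) 1)" by (simp add: compact_eq_bounded_closed)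
  then obtain k where k: "finite k" "cball (0::'e) 1 \<subseteq> (\<Union>x\<in>k. ball x (1/2))"
    using compact_eq_totally_bounded[of "cball (0::'e) 1"]
    by (metis zero_less_divide_1_iff zero_less_numeral)
  have bd: "card B \<le> card k" if B: "ON B" for B
  proof -
    have "\<forall>b\<in>B. \<exists>x\<in>k. b \<in> ball x (1/2)"
    proof
      fix b assume "b \<in> B"
      then have "b \<bullet> b = 1" using B by (auto simp: ON_def)
      then have "b \<in> cball 0 1" by (simp add: norm_eq_sqrt_inner)
      then show "\<exists>x\<in>k. b \<in> ball x (1/2)" using k(2) by blast
    qed
    then obtain f where f: "\<And>b. b \<in> B \<Longrightarrow> f b \<in> k \<and> b \<in> ball (f b) (1/2)" by metis
    have "inj_on f B"
    proof (rule inj_onI, rule ccontr)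
      fix a b assume ab: "a \<in> B" "b \<in> B" "f a = f b" "a \<noteq> b"
      have "dist a b < 1"
        using f[OF ab(1)] f[OF ab(2)] ab(3) dist_triangle_half_r[of "f a" a 1 b] by auto
      moreover have "(dist a b)\<^sup>2 = 2"
        using B ab by (simp add: ON_def dist_norm power2_norm_eq_inner inner_diff_left inner_diff_right)
      ultimately show False
        by (smt (verit) power_le_one zero_le_dist)
    qed
    moreover have "f ` B \<subseteq> k" using f by blast
    ultimately show ?thesis using k(1) card_inj_on_le by blast
  qed
  have "ON {}" by (simp add: ON_def)
  then obtain B where B: "ON B" "\<And>C. ON C \<Longrightarrow> card C \<le> card B"
    using ex_has_greatest_nat[of ON "{}" card "Suc (card k)"] bd by (metis le_imp_less_Suc)
  have fB: "finite B" using B by (simp add: ON_def)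
  have "(\<Sum>b\<in>B. (x \<bullet> b) *\<^sub>R b) = x" for x
  proof (rule ccontr)
    define y where "y = x - (\<Sum>b\<in>B. (x \<bullet> b) *\<^sub>R b)"
    assume "(\<Sum>b\<in>B. (x \<bullet> b) *\<^sub>R b) \<noteq> x"
    then have y0: "y \<noteq> 0" by (simp add: y_def)
    have yB: "y \<bullet> a = 0" if "a \<in> B" for a
    proof -
      have "(\<Sum>b\<in>B. (x \<bullet> b) * (b \<bullet> a)) = (\<Sum>b\<in>B. if b = a then x \<bullet> a else 0)"
        using B that by (intro sum.cong) (auto simp: ON_def)
      then show ?thesis using fB that by (simp add: y_def inner_diff_left inner_sum_left)
    qed
    define z where "z = y /\<^sub>R norm y"
    have zz: "z \<bullet> z = 1"
      using y0 by (simp add: z_def dot_square_norm power2_eq_square divide_simps)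
    have zB: "z \<bullet> a = 0" if "a \<in> B" for a using yB[OF that] by (simp add: z_def)
    have "z \<notin> B" using zz zB by force
    moreover have "ON (insert z B)"
      using B(1) zz zB by (auto simp: ON_def inner_commute)
    ultimately show False using B(2)[of "insert z B"] fB by simp
  qed
  then show ?thesis using B(1) unfolding ON_def by blast
qed

text \<open>In dimension zero this basis is empty, and expansions become empty sums.\<close>

definition onb :: "'e::real_inner set" where
  "onb = (SOME B. finite B \<and> (\<forall>a\<in>B. \<forall>b\<in>B. a \<bullet> b = (if a = b then 1 else 0)) \<and>
     (\<forall>x. (\<Sum>b\<in>B. (x \<bullet> b) *\<^sub>R b) = x))"

lemma
  shows finite_onb [simp]: "finite (onb :: 'e::{real_inner,heine_borel} set)"
    and onb_expand: "(\<Sum>b\<in>onb. ((x::'e) \<bullet> b) *\<^sub>R b) = x"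
  using someI_ex[OF finite_orthonormal_spanning_exists[where 'e='e]] unfolding onb_def[symmetric]
  by auto

lemma linear_onb_expand:
  fixes f :: "'e::{real_inner,heine_borel} \<Rightarrow> 'f::real_normed_vector"
  assumes "linear f"
  shows "f x = (\<Sum>b\<in>onb. (x \<bullet> b) *\<^sub>R f b)"
  by (subst onb_expand[of x, symmetric]) (simp add: linear_sum[OF assms] linear_scale[OF assms])

text \<open>The functionals \<open>blinfun_inner_right b\<close> form the dual basis; multilinear
  forms on covectors are later reduced to their values on it.\<close>

lemma blinfun_onb_expand:
  fixes \<xi> :: "'e::{real_inner,heine_borel} \<Rightarrow>\<^sub>L real"
  shows "(\<Sum>b\<in>onb. \<xi> b *\<^sub>R blinfun_inner_right b) = \<xi>"
proof (rule blinfun_eqI)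
  fix x
  show "blinfun_apply (\<Sum>b\<in>onb. \<xi> b *\<^sub>R blinfun_inner_right b) x = \<xi> x"
    using linear_onb_expand[of "blinfun_apply \<xi>" x]
    by (simp add: blinfun.sum_left blinfun.scaleR_left blinfun.bilinear_simps
      bounded_linear.linear[OF blinfun.bounded_linear_right] inner_commute mult.commute)
qed

section \<open>Functions of class C^k\<close>

lemma frechet_derivative_eqI:
  "(f has_derivative f') (at x) \<Longrightarrow> frechet_derivative f (at x) = f'"
  by (rule frechet_derivative_at[symmetric])

lemma differentiable_frechetD:
  "f differentiable (at x) \<Longrightarrow> (f has_derivative frechet_derivative f (at x)) (at x)"
  by (simp add: frechet_derivative_works)

lemma differentiable_transform_open:
  "\<lbrakk>f differentiable (at x); open S; x \<in> S; \<And>y. y \<in> S \<Longrightarrow> f y = g y\<rbrakk> \<Longrightarrow> g differentiable (at x)"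
  unfolding differentiable_def using has_derivative_transform_within_open by metis

lemma Ck_on_cong:
  assumes "open S" "Ck_on k S f" "\<And>x. x \<in> S \<Longrightarrow> f x = g x"
  shows "Ck_on k S g"
  using assms(2,3)
proof (induction k arbitrary: f g)
  case 0
  then show ?case by (simp cong: continuous_on_cong)
next
  case (Suc k)
  have "\<forall>x\<in>S. g differentiable (at x)"
    using Suc.prems differentiable_transform_open[OF _ assms(1)] by (metis Ck_on.simps(2))
  moreover have "Ck_on k S (\<lambda>x. frechet_derivative g (at x) v)" for v
  proof (rule Suc.IH)
    show "Ck_on k S (\<lambda>x. frechet_derivative f (at x) v)" using Suc.prems by simp
    show "frechet_derivative f (at x) v = frechet_derivative g (at x) v" if "x \<in> S" for x
      using Suc.prems assms(1) that frechet_derivative_transform_within_open[of f x S g] by simp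
  qed
  ultimately show ?case by simp
qed

lemma Ck_on_subset: "Ck_on k S f \<Longrightarrow> T \<subseteq> S \<Longrightarrow> Ck_on k T f"
  by (induction k arbitrary: f) (auto intro: continuous_on_subset)

lemma Ck_on_SucD: "Ck_on (Suc k) S f \<Longrightarrow> Ck_on k S f"
proof (induction k arbitrary: f)
  case 0
  then show ?case
    by (auto intro!: continuous_at_imp_continuous_on differentiable_imp_continuous_within)
next
  case (Suc k)
  then have "Ck_on k S (\<lambda>x. frechet_derivative f (at x) v)" for v
    using Ck_on.simps(2) by blast
  moreover have "\<forall>x\<in>S. f differentiable (at x)" using Suc.prems by simp
  ultimately show ?case by simp
qed

lemma Ck_on_local:
  assumes "\<And>x. x \<in> S \<Longrightarrow> \<exists>T. open T \<and> x \<in> T \<and> Ck_on k T f"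
  shows "Ck_on k S f"
  using assms
proof (induction k arbitrary: f)
  case 0
  have "isCont f x" if "x \<in> S" for x
    using 0[OF that] continuous_on_eq_continuous_at by auto
  then show ?case by (simp add: continuous_at_imp_continuous_on)
next
  case (Suc k)
  have "\<forall>x\<in>S. f differentiable (at x)" using Suc.prems by fastforce
  moreover have "Ck_on k S (\<lambda>x. frechet_derivative f (at x) v)" for v
    by (rule Suc.IH) (use Suc.prems in fastforce)
  ultimately show ?case by simp
qed

lemma Ck_on_SucI:
  assumes "open S" "\<And>x. x \<in> S \<Longrightarrow> (f has_derivative f' x) (at x)"
    "\<And>v. Ck_on k S (\<lambda>x. f' x v)"
  shows "Ck_on (Suc k) S f"
proof -
  have "Ck_on k S (\<lambda>x. frechet_derivative f (at x) v)" for v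
    by (rule Ck_on_cong[OF assms(1) assms(3)[of v]]) (simp add: frechet_derivative_eqI[OF assms(2)])
  then show ?thesis using assms(2) by (auto simp: differentiable_def)
qed

lemma Ck_on_const: "open S \<Longrightarrow> Ck_on k S (\<lambda>x. c)"
  by (induction k arbitrary: c) auto

lemma Ck_on_add:
  assumes "open S" "Ck_on k S f" "Ck_on k S g"
  shows "Ck_on k S (\<lambda>x. f x + g x)"
  using assms(2,3)
proof (induction k arbitrary: f g)
  case 0
  then show ?case by (simp add: continuous_on_add)
next
  case (Suc k)
  show ?case
    by (rule Ck_on_SucI[OF assms(1),
        where f'="\<lambda>x v. frechet_derivative f (at x) v + frechet_derivative g (at x) v"])
      (use Suc in \<open>auto intro!: has_derivative_add differentiable_frechetD\<close>)
qed

lemma Ck_on_bounded_linear: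
  assumes L: "bounded_linear L" and "open S" "Ck_on k S f"
  shows "Ck_on k S (\<lambda>x. L (f x))"
  using assms(3)
proof (induction k arbitrary: f)
  case 0
  then show ?case by (simp add: bounded_linear.continuous_on[OF L])
next
  case (Suc k)
  show ?case
    by (rule Ck_on_SucI[OF assms(2), where f'="\<lambda>x v. L (frechet_derivative f (at x) v)"])
      (use Suc in \<open>auto intro!: bounded_linear.has_derivative[OF L] differentiable_frechetD\<close>)
qed

lemma Ck_on_bilinear:
  assumes b: "bounded_bilinear bl" and S: "open S" and "Ck_on k S f" "Ck_on k S g"
  shows "Ck_on k S (\<lambda>x. bl (f x) (g x))"
  using assms(3,4)
proof (induction k arbitrary: f g)
  case 0
  then show ?case by (simp add: bounded_bilinear.continuous_on[OF b])
next
  case (Suc k)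
  \<comment> \<open>The product rule also contains the undifferentiated factors, which the induction
    hypothesis needs at order \<open>k\<close>.\<close>
  have "Ck_on k S f" "Ck_on k S g" using Suc.prems Ck_on_SucD by blast+
  with Suc S show ?case
    by (intro Ck_on_SucI[OF S,
        where f'="\<lambda>x v. bl (f x) (frechet_derivative g (at x) v) + bl (frechet_derivative f (at x) v) (g x)"])
      (auto intro!: bounded_bilinear.FDERIV[OF b] differentiable_frechetD Ck_on_add)
qed

lemma Ck_on_sum:
  assumes "open S" "\<And>i. i \<in> I \<Longrightarrow> Ck_on k S (f i)"
  shows "Ck_on k S (\<lambda>x. \<Sum>i\<in>I. f i x)"
  using assms by (induction I rule: infinite_finite_induct) (auto intro: Ck_on_const Ck_on_add)

lemma Ck_on_ident: "open S \<Longrightarrow> Ck_on k S (\<lambda>x. x)"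
proof (cases k)
  case (Suc m)
  assume "open S"
  then show ?thesis unfolding Suc
    by (intro Ck_on_SucI[where f'="\<lambda>x v. v"]) (auto intro: Ck_on_const)
qed simp

text \<open>In the chain rule a varying linear map is applied to a varying vector, whereas
  \<open>Ck_on\<close> only controls derivatives in fixed directions. Expanding the vector in
  \<open>onb\<close> leaves products of scalar functions with derivatives in the directions
  \<open>b\<close>, to which the induction hypothesis applies.\<close>

lemma Ck_on_compose:
  fixes g :: "'d::real_normed_vector \<Rightarrow> 'e::{real_inner,heine_borel}"
  assumes S: "open S" and T: "open T" and gS: "\<And>x. x \<in> S \<Longrightarrow> g x \<in> T"
    and "Ck_on k T f" "Ck_on k S g"
  shows "Ck_on k S (\<lambda>x. f (g x))"
  using assms(4,5)
proof (induction k arbitrary: f)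
  case 0
  then show ?case using gS by (auto intro: continuous_on_compose2)
next
  case (Suc k)
  let ?f' = "\<lambda>x v. \<Sum>b\<in>onb. (frechet_derivative g (at x) v \<bullet> b) *\<^sub>R frechet_derivative f (at (g x)) b"
  have Ckg: "Ck_on k S g" using Suc.prems Ck_on_SucD by blast
  show ?case
  proof (rule Ck_on_SucI[OF S, where f' = ?f'])
    fix x assume x: "x \<in> S"
    have f: "(f has_derivative frechet_derivative f (at (g x))) (at (g x))"
      using Suc.prems gS[OF x] by (auto intro: differentiable_frechetD)
    have "((\<lambda>x. f (g x)) has_derivative (\<lambda>v. frechet_derivative f (at (g x)) (frechet_derivative g (at x) v))) (at x)"
      by (rule has_derivative_compose[where g=f and f=g and x=x, OF _ f]) (use Suc.prems(2) x in \<open>auto intro: differentiable_frechetD\<close>)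
    then show "((\<lambda>x. f (g x)) has_derivative ?f' x) (at x)"
      by (subst linear_onb_expand[OF has_derivative_linear[OF f], symmetric])
  next
    fix v
    show "Ck_on k S (\<lambda>x. ?f' x v)"
      using Suc Ckg
      by (intro Ck_on_sum S Ck_on_bilinear[OF bounded_bilinear_scaleR]
          Ck_on_bounded_linear[OF bounded_linear_inner_left]) auto
  qed
qed

lemma Ck_on_Pair:
  assumes S: "open S" and "Ck_on k S f" "Ck_on k S g"
  shows "Ck_on k S (\<lambda>x. (f x, g x))"
proof -
  have "Ck_on k S (\<lambda>x. (f x, 0) + (0, g x))"
    using assms bounded_linear_Pair[OF bounded_linear_ident bounded_linear_zero]
      bounded_linear_Pair[OF bounded_linear_zero bounded_linear_ident]
    by (intro Ck_on_add) (auto intro: Ck_on_bounded_linear)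
  then show ?thesis by simp
qed

section \<open>Smooth functions\<close>

lemma smooth_on_cong:
  "\<lbrakk>open S; smooth_on S f; \<And>x. x \<in> S \<Longrightarrow> f x = g x\<rbrakk> \<Longrightarrow> smooth_on S g"
  unfolding smooth_on_def using Ck_on_cong by blast

lemma smooth_on_subset: "smooth_on S f \<Longrightarrow> T \<subseteq> S \<Longrightarrow> smooth_on T f"
  unfolding smooth_on_def using Ck_on_subset by blast

lemma smooth_on_local:
  assumes "\<And>x. x \<in> S \<Longrightarrow> \<exists>T. open T \<and> x \<in> T \<and> smooth_on T f"
  shows "smooth_on S f"
  unfolding smooth_on_def using assms by (metis Ck_on_local smooth_on_def)

lemma smooth_on_const: "open S \<Longrightarrow> smooth_on S (\<lambda>x. c)"
  by (simp add: smooth_on_def Ck_on_const)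

lemma smooth_on_ident: "open S \<Longrightarrow> smooth_on S (\<lambda>x. x)"
  by (simp add: smooth_on_def Ck_on_ident)

lemma smooth_on_add: "open S \<Longrightarrow> smooth_on S f \<Longrightarrow> smooth_on S g \<Longrightarrow> smooth_on S (\<lambda>x. f x + g x)"
  by (simp add: smooth_on_def Ck_on_add)

lemma smooth_on_bounded_linear:
  "bounded_linear L \<Longrightarrow> open S \<Longrightarrow> smooth_on S f \<Longrightarrow> smooth_on S (\<lambda>x. L (f x))"
  by (simp add: smooth_on_def Ck_on_bounded_linear)

lemma smooth_on_diff:
  "open S \<Longrightarrow> smooth_on S f \<Longrightarrow> smooth_on S g \<Longrightarrow> smooth_on S (\<lambda>x. f x - g x)"
  using smooth_on_add[of S f "\<lambda>x. - g x"]
    smooth_on_bounded_linear[OF bounded_linear_minus[OF bounded_linear_ident], of S g] by simp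

lemma smooth_on_scaleR:
  "open S \<Longrightarrow> smooth_on S f \<Longrightarrow> smooth_on S g \<Longrightarrow> smooth_on S (\<lambda>x. f x *\<^sub>R g x)"
  by (simp add: smooth_on_def Ck_on_bilinear[OF bounded_bilinear_scaleR])

lemma smooth_on_mult:
  fixes f g :: "'e::real_normed_vector \<Rightarrow> real"
  shows "open S \<Longrightarrow> smooth_on S f \<Longrightarrow> smooth_on S g \<Longrightarrow> smooth_on S (\<lambda>x. f x * g x)"
  by (simp add: smooth_on_def Ck_on_bilinear[OF bounded_bilinear_mult])

lemma smooth_on_inner:
  "open S \<Longrightarrow> smooth_on S f \<Longrightarrow> smooth_on S g \<Longrightarrow> smooth_on S (\<lambda>x. f x \<bullet> g x)"
  by (simp add: smooth_on_def Ck_on_bilinear[OF bounded_bilinear_inner])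

lemma smooth_on_sum:
  "open S \<Longrightarrow> (\<And>i. i \<in> I \<Longrightarrow> smooth_on S (f i)) \<Longrightarrow> smooth_on S (\<lambda>x. \<Sum>i\<in>I. f i x)"
  by (simp add: smooth_on_def Ck_on_sum)

lemma smooth_on_compose:
  fixes g :: "'d::real_normed_vector \<Rightarrow> 'e::{real_inner,heine_borel}"
  assumes "smooth_on T f" "smooth_on S g" "open S" "open T" "\<And>x. x \<in> S \<Longrightarrow> g x \<in> T"
  shows "smooth_on S (\<lambda>x. f (g x))"
  using assms unfolding smooth_on_def by (blast intro: Ck_on_compose)

lemma smooth_on_Pair:
  "open S \<Longrightarrow> smooth_on S f \<Longrightarrow> smooth_on S g \<Longrightarrow> smooth_on S (\<lambda>x. (f x, g x))"
  by (simp add: smooth_on_def Ck_on_Pair)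

lemma smooth_on_fst: "open S \<Longrightarrow> smooth_on S f \<Longrightarrow> smooth_on S (\<lambda>x. fst (f x))"
  by (rule smooth_on_bounded_linear[OF bounded_linear_fst])

lemma smooth_on_snd: "open S \<Longrightarrow> smooth_on S f \<Longrightarrow> smooth_on S (\<lambda>x. snd (f x))"
  by (rule smooth_on_bounded_linear[OF bounded_linear_snd])

lemma smooth_on_differentiable: "smooth_on S f \<Longrightarrow> x \<in> S \<Longrightarrow> f differentiable (at x)"
  unfolding smooth_on_def by (metis Ck_on.simps(2))

lemma smooth_on_has_derivative:
  "smooth_on S f \<Longrightarrow> x \<in> S \<Longrightarrow> (f has_derivative frechet_derivative f (at x)) (at x)"
  using smooth_on_differentiable differentiable_frechetD by blast

lemma smooth_on_linear_derivative:
  "smooth_on S f \<Longrightarrow> x \<in> S \<Longrightarrow> bounded_linear (frechet_derivative f (at x))"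
  using smooth_on_has_derivative has_derivative_bounded_linear by blast

lemma smooth_on_derivative_dir: "smooth_on S f \<Longrightarrow> smooth_on S (\<lambda>x. frechet_derivative f (at x) v)"
  unfolding smooth_on_def by (metis Ck_on.simps(2))

text \<open>The same expansion in \<open>onb\<close> as in the chain rule turns the varying
  direction \<open>v x\<close> into scalar coefficients.\<close>

lemma smooth_on_derivative:
  fixes g :: "'d::{real_inner,heine_borel} \<Rightarrow> 'e::{real_inner,heine_borel}"
  assumes f: "smooth_on T f" and g: "smooth_on S g" and v: "smooth_on S v"
    and S: "open S" and T: "open T" and gS: "\<And>x. x \<in> S \<Longrightarrow> g x \<in> T"
  shows "smooth_on S (\<lambda>x. frechet_derivative f (at (g x)) (v x))"
proof (rule smooth_on_cong[OF S])
  show "smooth_on S (\<lambda>x. \<Sum>b\<in>onb. (v x \<bullet> b) *\<^sub>R frechet_derivative f (at (g x)) b)"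
    by (intro smooth_on_sum smooth_on_scaleR smooth_on_inner smooth_on_const S v
        smooth_on_compose[OF smooth_on_derivative_dir[OF f] g S T gS])
  show "(\<Sum>b\<in>onb. (v x \<bullet> b) *\<^sub>R frechet_derivative f (at (g x)) b) = frechet_derivative f (at (g x)) (v x)"
    if "x \<in> S" for x
    by (rule linear_onb_expand[symmetric], rule has_derivative_linear)
      (rule smooth_on_has_derivative[OF f gS[OF that]])
qed

subsection \<open>Symmetry of second derivatives\<close>

lemma has_derivative_line:
  assumes "(f has_derivative f') (at (x + s *\<^sub>R u))"
  shows "((\<lambda>s. f (x + s *\<^sub>R u)) has_vector_derivative f' u) (at s)"
proof -
  have "((\<lambda>s. x + s *\<^sub>R u) has_derivative (\<lambda>h. h *\<^sub>R u)) (at s)"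
    by (auto intro!: derivative_eq_intros)
  from has_derivative_compose[OF this assms]
  have "((\<lambda>s. f (x + s *\<^sub>R u)) has_derivative (\<lambda>h. f' (h *\<^sub>R u))) (at s)" .
  then show ?thesis
    by (simp add: has_vector_derivative_def linear_scale[OF has_derivative_linear[OF assms]])
qed

text \<open>The mean value theorem in the direction \<open>u\<close> turns the second difference
  over a parallelogram into a first difference of the derivative along \<open>u\<close>; a second
  application, in the direction \<open>v\<close>, produces the mixed derivative at an intermediate
  point.\<close>

lemma second_difference_mean_value:
  fixes f :: "'e::{real_inner,heine_borel} \<Rightarrow> real"
  assumes f: "smooth_on S f" and h: "0 < h"
    and S: "\<And>s t. \<lbrakk>0 \<le> s; s \<le> h; 0 \<le> t; t \<le> h\<rbrakk> \<Longrightarrow> x + s *\<^sub>R u + t *\<^sub>R v \<in> S"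
  shows "\<exists>s t. 0 \<le> s \<and> s \<le> h \<and> 0 \<le> t \<and> t \<le> h \<and>
     f (x + h *\<^sub>R u + h *\<^sub>R v) - f (x + h *\<^sub>R u) - f (x + h *\<^sub>R v) + f x =
     h * (h * frechet_derivative (\<lambda>y. frechet_derivative f (at y) u) (at (x + s *\<^sub>R u + t *\<^sub>R v)) v)"
proof -
  define D where "D y = frechet_derivative f (at y) u" for y
  have D: "smooth_on S D" unfolding D_def by (rule smooth_on_derivative_dir[OF f])
  have "\<exists>s>0. s < h \<and> (\<lambda>s. f (x + h *\<^sub>R v + s *\<^sub>R u) - f (x + s *\<^sub>R u)) h -
     (\<lambda>s. f (x + h *\<^sub>R v + s *\<^sub>R u) - f (x + s *\<^sub>R u)) 0 =
     (h - 0) * (D (x + h *\<^sub>R v + s *\<^sub>R u) - D (x + s *\<^sub>R u))"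
  proof (rule MVT2[OF h])
    fix s assume s: "0 \<le> s" "s \<le> h"
    have *: "x + h *\<^sub>R v + s *\<^sub>R u \<in> S" "x + s *\<^sub>R u \<in> S"
      using S[OF s, of h] S[OF s, of 0] h by (simp_all add: algebra_simps)
    show "((\<lambda>s. f (x + h *\<^sub>R v + s *\<^sub>R u) - f (x + s *\<^sub>R u)) has_real_derivative
        D (x + h *\<^sub>R v + s *\<^sub>R u) - D (x + s *\<^sub>R u)) (at s)"
      using has_derivative_line[OF smooth_on_has_derivative[OF f *(1)]]
        has_derivative_line[OF smooth_on_has_derivative[OF f *(2)]]
      unfolding D_def has_real_derivative_iff_has_vector_derivative
      by (rule has_vector_derivative_diff)
  qed
  then obtain s where s: "0 < s" "s < h"
    "f (x + h *\<^sub>R v + h *\<^sub>R u) - f (x + h *\<^sub>R u) - (f (x + h *\<^sub>R v) - f x) =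
     h * (D (x + h *\<^sub>R v + s *\<^sub>R u) - D (x + s *\<^sub>R u))"
    by auto
  have "\<exists>t>0. t < h \<and> (\<lambda>t. D (x + s *\<^sub>R u + t *\<^sub>R v)) h - (\<lambda>t. D (x + s *\<^sub>R u + t *\<^sub>R v)) 0 =
     (h - 0) * frechet_derivative D (at (x + s *\<^sub>R u + t *\<^sub>R v)) v"
  proof (rule MVT2[OF h])
    fix t assume t: "0 \<le> t" "t \<le> h"
    show "((\<lambda>t. D (x + s *\<^sub>R u + t *\<^sub>R v)) has_real_derivative
       frechet_derivative D (at (x + s *\<^sub>R u + t *\<^sub>R v)) v) (at t)"
      unfolding has_real_derivative_iff_has_vector_derivative
      using s t by (intro has_derivative_line smooth_on_has_derivative[OF D] S) auto
  qed
  then obtain t where t: "0 < t" "t < h" "D (x + s *\<^sub>R u + h *\<^sub>R v) - D (x + s *\<^sub>R u) =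
     h * frechet_derivative D (at (x + s *\<^sub>R u + t *\<^sub>R v)) v" by auto
  have "f (x + h *\<^sub>R u + h *\<^sub>R v) - f (x + h *\<^sub>R u) - f (x + h *\<^sub>R v) + f x =
     h * (h * frechet_derivative D (at (x + s *\<^sub>R u + t *\<^sub>R v)) v)"
    using s(3) t(3) by (simp add: algebra_simps)
  then show ?thesis unfolding D_def using s t
    by (intro exI[of _ s] exI[of _ t]) auto
qed

text \<open>The second difference is symmetric in \<open>u\<close> and \<open>v\<close>. Evaluating
  it in both orders equates the two mixed derivatives at two points close to \<open>x\<close>, and
  their continuity at \<open>x\<close> excludes a gap between the values there.\<close>

lemma second_derivative_symmetric_real:
  fixes f :: "'e::{real_inner,heine_borel} \<Rightarrow> real"
  assumes f: "smooth_on S f" and S: "open S" and x: "x \<in> S"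
  shows "frechet_derivative (\<lambda>y. frechet_derivative f (at y) u) (at x) v =
         frechet_derivative (\<lambda>y. frechet_derivative f (at y) v) (at x) u"
proof (rule ccontr)
  define P where "P y = frechet_derivative (\<lambda>y. frechet_derivative f (at y) u) (at y) v" for y
  define Q where "Q y = frechet_derivative (\<lambda>y. frechet_derivative f (at y) v) (at y) u" for y
  assume "\<not> ?thesis"
  then have ne: "P x \<noteq> Q x" by (simp add: P_def Q_def)
  define e where "e = dist (P x) (Q x) / 2"
  have e: "e > 0" using ne by (simp add: e_def)
  have "smooth_on S P" "smooth_on S Q" unfolding P_def Q_def
    by (intro smooth_on_derivative_dir f)+
  then have "isCont P x" "isCont Q x"
    using x S smooth_on_differentiable differentiable_imp_continuous_within by blast+
  then have "\<exists>d>0. \<forall>y. dist y x < d \<longrightarrow> dist (P y) (P x) < e"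
    "\<exists>d>0. \<forall>y. dist y x < d \<longrightarrow> dist (Q y) (Q x) < e"
    using e unfolding continuous_at_eps_delta by blast+
  then obtain d1 d2 where d: "d1 > 0" "\<And>y. dist y x < d1 \<Longrightarrow> dist (P y) (P x) < e"
    "d2 > 0" "\<And>y. dist y x < d2 \<Longrightarrow> dist (Q y) (Q x) < e"
    by blast
  obtain d3 where d3: "d3 > 0" "ball x d3 \<subseteq> S" using S x open_contains_ball by blast
  define d where "d = min d1 (min d2 d3)"
  have d0: "d > 0" using d d3 by (simp add: d_def)
  \<comment> \<open>The summand 1 keeps the denominator positive for \<open>u = v = 0\<close> and
    makes the estimate of the distance strict.\<close>
  define h where "h = d / (norm u + norm v + 1)"
  have h: "h > 0" using d0 by (simp add: h_def add_nonneg_pos)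
  have hd: "dist (x + s *\<^sub>R u + t *\<^sub>R v) x < d" if "0 \<le> s" "s \<le> h" "0 \<le> t" "t \<le> h" for s t
  proof -
    have "dist (x + s *\<^sub>R u + t *\<^sub>R v) x \<le> s * norm u + t * norm v"
      using that norm_triangle_ineq[of "s *\<^sub>R u" "t *\<^sub>R v"] by (simp add: dist_norm add.assoc)
    also have "\<dots> \<le> h * norm u + h * norm v"
      using that by (intro add_mono mult_right_mono) auto
    also have "\<dots> < h * (norm u + norm v + 1)" using h by (simp add: algebra_simps)
    also have "\<dots> = d"
      unfolding h_def using add_nonneg_pos[OF add_nonneg_nonneg[OF norm_ge_zero[of u] norm_ge_zero[of v]] zero_less_one]
      by (intro nonzero_eq_divide_eq[THEN iffD1]) (auto simp: nonzero_eq_divide_eq)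
    finally show ?thesis .
  qed
  have hS: "x + s *\<^sub>R u + t *\<^sub>R v \<in> S" if "0 \<le> s" "s \<le> h" "0 \<le> t" "t \<le> h" for s t
    using hd[OF that] d3 by (auto simp: d_def dist_commute subset_iff)
  obtain s t where st: "0 \<le> s" "s \<le> h" "0 \<le> t" "t \<le> h"
     "f (x + h *\<^sub>R u + h *\<^sub>R v) - f (x + h *\<^sub>R u) - f (x + h *\<^sub>R v) + f x =
     h * (h * P (x + s *\<^sub>R u + t *\<^sub>R v))"
    using second_difference_mean_value[OF f h hS] unfolding P_def by blast
  have hS': "x + s *\<^sub>R v + t *\<^sub>R u \<in> S" if "0 \<le> s" "s \<le> h" "0 \<le> t" "t \<le> h" for s t
    using hS[OF that(3,4) that(1,2)] by (simp add: algebra_simps)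
  obtain s' t' where st': "0 \<le> s'" "s' \<le> h" "0 \<le> t'" "t' \<le> h"
     "f (x + h *\<^sub>R v + h *\<^sub>R u) - f (x + h *\<^sub>R v) - f (x + h *\<^sub>R u) + f x =
     h * (h * Q (x + s' *\<^sub>R v + t' *\<^sub>R u))"
    using second_difference_mean_value[OF f h hS'] unfolding Q_def by blast
  have "h * (h * P (x + s *\<^sub>R u + t *\<^sub>R v)) = h * (h * Q (x + s' *\<^sub>R v + t' *\<^sub>R u))"
    using st(5) st'(5) by (simp add: algebra_simps)
  then have eq: "P (x + s *\<^sub>R u + t *\<^sub>R v) = Q (x + t' *\<^sub>R u + s' *\<^sub>R v)"
    using h by (simp add: algebra_simps)
  have "dist (P (x + s *\<^sub>R u + t *\<^sub>R v)) (P x) < e"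
    using hd[OF st(1-4)] by (intro d(2)) (simp add: d_def)
  moreover have "dist (Q (x + t' *\<^sub>R u + s' *\<^sub>R v)) (Q x) < e"
    using hd[OF st'(3,4,1,2)] by (intro d(4)) (simp add: d_def)
  ultimately have "dist (P x) (Q x) < 2 * e"
    using eq by (simp add: dist_real_def)
  then show False by (simp add: e_def)
qed

lemma second_derivative_symmetric:
  fixes f :: "'e::{real_inner,heine_borel} \<Rightarrow> 'f::{real_inner,heine_borel}"
  assumes f: "smooth_on S f" and S: "open S" and x: "x \<in> S"
  shows "frechet_derivative (\<lambda>y. frechet_derivative f (at y) u) (at x) v =
         frechet_derivative (\<lambda>y. frechet_derivative f (at y) v) (at x) u"
proof -
  \<comment> \<open>Taking the inner product with \<open>b\<close> commutes with both
    differentiations, which reduces the claim to real-valued functions.\<close>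
  have *: "frechet_derivative (\<lambda>y. frechet_derivative f (at y) u) (at x) v \<bullet> b =
     frechet_derivative (\<lambda>y. frechet_derivative (\<lambda>y. f y \<bullet> b) (at y) u) (at x) v" for b u v
  proof -
    have "frechet_derivative (\<lambda>y. frechet_derivative f (at y) u \<bullet> b) (at x) v =
      frechet_derivative (\<lambda>y. frechet_derivative (\<lambda>y. f y \<bullet> b) (at y) u) (at x) v"
    proof (rule fun_cong[OF frechet_derivative_transform_within_open[OF _ S x]])
      show "(\<lambda>y. frechet_derivative f (at y) u \<bullet> b) differentiable at x"
        by (intro smooth_on_differentiable[OF _ x] smooth_on_inner smooth_on_const S
            smooth_on_derivative_dir f)
      fix y assume "y \<in> S"
      from has_derivative_inner_left[OF smooth_on_has_derivative[OF f this], of b]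
      show "frechet_derivative f (at y) u \<bullet> b = frechet_derivative (\<lambda>y. f y \<bullet> b) (at y) u"
        by (metis frechet_derivative_eqI)
    qed
    then show ?thesis
      using frechet_derivative_eqI[OF has_derivative_inner_left[OF
            smooth_on_has_derivative[OF smooth_on_derivative_dir[OF f] x]]] by metis
  qed
  have "smooth_on S (\<lambda>y. f y \<bullet> b)" for b
    by (intro smooth_on_inner smooth_on_const S f)
  then have "frechet_derivative (\<lambda>y. frechet_derivative f (at y) u) (at x) v \<bullet> b =
     frechet_derivative (\<lambda>y. frechet_derivative f (at y) v) (at x) u \<bullet> b" for b
    unfolding * by (rule second_derivative_symmetric_real[OF _ S x])
  then show ?thesis using vector_eq_rdot by blast
qed

text \<open>This differentiates the tangent map \<open>(x, u) \<mapsto> Df(x) u\<close>: once to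
  obtain the transition maps of \<open>TM\<close> to first order, once to see how the derivative of
  a vector field changes with the chart.\<close>

lemma has_derivative_frechet_pair:
  fixes f :: "'d::{real_inner,heine_borel} \<Rightarrow> 'e::{real_inner,heine_borel}"
  assumes f: "smooth_on S f" and S: "open S" and x: "x \<in> S"
  shows "((\<lambda>p. frechet_derivative f (at (fst p)) (snd p)) has_derivative
     (\<lambda>h. frechet_derivative (\<lambda>x. frechet_derivative f (at x) u) (at x) (fst h) +
       frechet_derivative f (at x) (snd h))) (at (x, u))"
proof -
  let ?f = "\<lambda>x. frechet_derivative f (at x)"
  let ?F = "\<lambda>b. frechet_derivative (\<lambda>x. ?f x b) (at x)"
  have d: "((\<lambda>x. ?f x b) has_derivative ?F b) (at x)" for b
    by (rule smooth_on_has_derivative[OF smooth_on_derivative_dir[OF f] x])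
  have e: "?f y v = (\<Sum>b\<in>onb. (v \<bullet> b) *\<^sub>R ?f y b)" if "y \<in> S" for y v
    by (rule linear_onb_expand, rule has_derivative_linear, rule smooth_on_has_derivative[OF f that])
  have "((\<lambda>y. \<Sum>b\<in>onb. (u \<bullet> b) *\<^sub>R ?f y b) has_derivative (\<lambda>h. \<Sum>b\<in>onb. (u \<bullet> b) *\<^sub>R ?F b h)) (at x)"
    by (intro has_derivative_sum has_derivative_scaleR_right d)
  then have "((\<lambda>y. ?f y u) has_derivative (\<lambda>h. \<Sum>b\<in>onb. (u \<bullet> b) *\<^sub>R ?F b h)) (at x)"
    by (rule has_derivative_transform_within_open[OF _ S x]) (simp add: e)
  from frechet_derivative_eqI[OF this]
  have F: "?F u h = (\<Sum>b\<in>onb. (u \<bullet> b) *\<^sub>R ?F b h)" for h by simp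
  have "((\<lambda>p. ?f (fst p) b) has_derivative (\<lambda>h. ?F b (fst h))) (at (x, u))" for b
    using has_derivative_compose[OF bounded_linear_imp_has_derivative[OF bounded_linear_fst], where g="\<lambda>x. ?f x b" and x="(x, u)"] d[of b]
    by simp
  then have "((\<lambda>p. \<Sum>b\<in>onb. (snd p \<bullet> b) *\<^sub>R ?f (fst p) b) has_derivative
     (\<lambda>h. \<Sum>b\<in>onb. (snd (x, u) \<bullet> b) *\<^sub>R ?F b (fst h) + (snd h \<bullet> b) *\<^sub>R ?f (fst (x, u)) b)) (at (x, u))"
    by (intro has_derivative_sum has_derivative_scaleR has_derivative_inner_left
        bounded_linear_imp_has_derivative bounded_linear_snd)
  then have "((\<lambda>p. \<Sum>b\<in>onb. (snd p \<bullet> b) *\<^sub>R ?f (fst p) b) has_derivative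
     (\<lambda>h. ?F u (fst h) + ?f x (snd h))) (at (x, u))"
    by (simp add: sum.distrib F e[OF x, of "snd _"])
  then show ?thesis
    by (rule has_derivative_transform_within_open[where s="S \<times> UNIV"])
      (use x S in \<open>auto simp: e open_Times\<close>)
qed

subsection \<open>Bump functions\<close>

text \<open>The powers of \<open>inverse t\<close> make the family closed under differentiation up
  to linear combinations, so that smoothness of all members follows by one induction.\<close>

definition flat :: "nat \<Rightarrow> real \<Rightarrow> real" where
  "flat n t = (if t > 0 then inverse t ^ n * exp (- inverse t) else 0)"

lemma flat_has_derivative:
  "(flat n has_real_derivative - real n * flat (Suc n) t + flat (n + 2) t) (at t)"
proof -
  consider "t > 0" | "t < 0" | "t = 0" by linarith
  then show ?thesis
  proof cases
    case 1
    have "((\<lambda>t. inverse t ^ n * exp (- inverse t)) has_real_derivative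
        - real n * flat (Suc n) t + flat (n + 2) t) (at t)"
    proof (cases n)
      case 0
      then show ?thesis
        using 1 by (auto intro!: derivative_eq_intros simp: flat_def power2_eq_square)
    next
      case (Suc m)
      have "((\<lambda>t. inverse t ^ n * exp (- inverse t)) has_real_derivative
          real n * inverse t ^ m * - (inverse t * inverse t) * exp (- inverse t) +
          inverse t ^ n * (exp (- inverse t) * (inverse t * inverse t))) (at t)"
        unfolding Suc using 1
        by (auto intro!: derivative_eq_intros simp: algebra_simps simp flip: power_Suc)
      then show ?thesis using 1 by (simp add: flat_def Suc algebra_simps)
    qed
    then show ?thesis
      by (rule has_field_derivative_transform_within_open[of _ _ _ "{0<..}"])
        (use 1 in \<open>auto simp: flat_def\<close>)
  next
    case 2
    have "((\<lambda>t. 0) has_real_derivative - real n * flat (Suc n) t + flat (n + 2) t) (at t)"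
      using 2 by (auto simp: flat_def)
    then show ?thesis
      by (rule has_field_derivative_transform_within_open[of _ _ _ "{..<0}"])
        (use 2 in \<open>auto simp: flat_def\<close>)
  next
    case 3
    \<comment> \<open>Under \<open>x = inverse t\<close> this is the difference quotient of
      \<open>flat n\<close> at 0 from the right.\<close>
    have "((\<lambda>x::real. x ^ Suc n / exp x) \<longlongrightarrow> 0) at_top"
      by (rule tendsto_power_div_exp_0)
    from filterlim_compose[OF this filterlim_inverse_at_top_right]
    have "((\<lambda>t::real. inverse t ^ Suc n / exp (inverse t)) \<longlongrightarrow> 0) (at_right 0)" .
    then have r: "((\<lambda>t. (flat n t - flat n 0) / (t - 0)) \<longlongrightarrow> 0) (at_right 0)"
      by (rule Lim_transform_eventually)
        (auto simp: eventually_at_right_less flat_def exp_minus field_simps eventually_at_filter)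
    have l: "((\<lambda>t. (flat n t - flat n 0) / (t - 0)) \<longlongrightarrow> 0) (at_left 0)"
      by (rule Lim_transform_eventually[OF tendsto_const])
        (auto simp: flat_def eventually_at_filter)
    have "((\<lambda>t. (flat n t - flat n 0) / (t - 0)) \<longlongrightarrow> 0) (at 0)"
      using l r by (simp add: filterlim_split_at_real)
    then have "(flat n has_real_derivative 0) (at 0)"
      by (simp add: has_field_derivative_iff)
    then show ?thesis by (simp add: 3 flat_def)
  qed
qed

lemma smooth_on_flat: "smooth_on UNIV (flat n)"
proof -
  have "Ck_on k UNIV (flat n)" for k
  proof (induction k arbitrary: n)
    case 0
    show ?case
      by (auto intro!: continuous_at_imp_continuous_on DERIV_isCont[OF flat_has_derivative])
  next
    case (Suc k)
    have "Ck_on k UNIV (\<lambda>x. (- real n) *\<^sub>R flat (Suc n) x + 1 *\<^sub>R flat (n + 2) x)"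
      by (intro Ck_on_add Ck_on_bounded_linear[OF bounded_linear_scaleR_right] Suc open_UNIV)
    then have "Ck_on k UNIV (\<lambda>x. (- real n * flat (Suc n) x + flat (n + 2) x) * v)" for v
      by (intro Ck_on_bounded_linear[OF bounded_linear_mult_left]) auto
    then show ?case
      using flat_has_derivative unfolding has_field_derivative_def
      by (intro Ck_on_SucI[where f'="\<lambda>x v. (- real n * flat (Suc n) x + flat (n + 2) x) * v"]) auto
  qed
  then show ?thesis by (simp add: smooth_on_def)
qed

lemma smooth_bump_exists:
  fixes x :: "'e::{real_inner,heine_borel}"
  assumes "e > 0"
  obtains \<beta> :: "'e \<Rightarrow> real"
  where "smooth_on UNIV \<beta>" "\<beta> x = 1" "\<And>y. y \<notin> cball x e \<Longrightarrow> \<beta> y = 0"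
proof
  \<comment> \<open>The argument of \<open>flat\<close> is a polynomial in \<open>y\<close>,
    positive exactly inside the ball of radius \<open>e\<close>; the constant factor normalises the
    value at the centre to 1.\<close>
  let ?\<beta> = "\<lambda>y. inverse (flat 0 (e\<^sup>2)) * flat 0 (e\<^sup>2 - (y - x) \<bullet> (y - x))"
  show "smooth_on UNIV ?\<beta>"
    by (intro smooth_on_mult smooth_on_const open_UNIV smooth_on_compose[OF smooth_on_flat]
        smooth_on_diff smooth_on_inner smooth_on_ident) auto
  show "?\<beta> x = 1" using assms by (simp add: flat_def)
  show "?\<beta> y = 0" if "y \<notin> cball x e" for y
  proof -
    have "e\<^sup>2 \<le> (norm (y - x))\<^sup>2"
      using that assms by (intro power_mono) (auto simp: dist_norm norm_minus_commute)
    then show ?thesis by (simp add: flat_def power2_norm_eq_inner)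
  qed
qed

section \<open>The exterior algebra\<close>

text \<open>The map of exterior algebras induced by \<open>T\<close>. As multivectors are forms on
  covectors, it is composition with the transpose of \<open>T\<close>.\<close>

definition push :: "('e::real_normed_vector \<Rightarrow>\<^sub>L 'f::real_normed_vector) \<Rightarrow> 'e mvec \<Rightarrow> 'f mvec" where
  "push T w = (\<lambda>xs. w (map (\<lambda>x. x o\<^sub>L T) xs))"

text \<open>The interior product with a covector.\<close>

definition contract :: "('e::real_normed_vector \<Rightarrow>\<^sub>L real) \<Rightarrow> 'e mvec \<Rightarrow> 'e mvec" where
  "contract x w = (\<lambda>xs. w (x # xs))"

text \<open>This provides the sign which an interior product acquires when it passes over the first
  factor of a wedge product.\<close>

definition grade_involution :: "'e::real_normed_vector mvec \<Rightarrow> 'e mvec" where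
  "grade_involution w = (\<lambda>xs. (- 1) ^ length xs * w xs)"

definition scalar :: "real \<Rightarrow> 'e::real_normed_vector mvec" where
  "scalar a = (\<lambda>xs. if xs = [] then a else 0)"

definition vec1 :: "'e::real_normed_vector \<Rightarrow> 'e mvec" where
  "vec1 e = (\<lambda>xs. case xs of [x] \<Rightarrow> blinfun_apply x e | _ \<Rightarrow> 0)"

lemma exterior_linear:
  assumes "w \<in> exterior_algebra"
  shows "linear (\<lambda>x. w (ys @ x # zs))"
proof -
  have "linear (\<lambda>x. w ((ys @ 0 # zs)[length ys := x]))"
    by (rule assms[unfolded exterior_algebra_def mem_Collect_eq, THEN conjunct1, rule_format]) simp
  then show ?thesis by simp
qed

lemma exterior_not_distinct: "w \<in> exterior_algebra \<Longrightarrow> \<not> distinct xs \<Longrightarrow> w xs = 0"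
  by (simp add: exterior_algebra_def)

text \<open>Polarisation: the value with \<open>a + b\<close> in both slots vanishes, and so do the
  two diagonal terms of its expansion.\<close>

lemma alternating_swap:
  assumes lin: "\<And>ys zs. linear (\<lambda>x. w (ys @ x # zs))"
    and alt: "\<And>ys x zs. w (ys @ x # x # zs) = (0::real)"
  shows "w (ys @ a # b # zs) = - w (ys @ b # a # zs)"
proof -
  have "0 = w (ys @ (a + b) # (a + b) # zs)" using alt by simp
  also have "\<dots> = w (ys @ a # (a + b) # zs) + w (ys @ b # (a + b) # zs)"
    using linear_add[OF lin[of ys "(a + b) # zs"]] by simp
  also have "\<dots> = w (ys @ a # a # zs) + w (ys @ a # b # zs) + (w (ys @ b # a # zs) + w (ys @ b # b # zs))"
    using linear_add[OF lin[of "ys @ [a]" zs], of a b] linear_add[OF lin[of "ys @ [b]" zs], of a b]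
    by simp
  finally show ?thesis using alt by simp
qed

lemma exterior_swap:
  assumes "w \<in> exterior_algebra"
  shows "w (ys @ a # b # zs) = - w (ys @ b # a # zs)"
  by (rule alternating_swap) (auto intro: exterior_linear[OF assms] exterior_not_distinct[OF assms])

text \<open>Testing adjacent equal entries is enough, since it yields the sign rule for neighbours,
  by which equal entries far apart can be brought together.\<close>

lemma exterior_algebraI:
  assumes lin: "\<And>ys zs. linear (\<lambda>x. w (ys @ x # zs))"
    and alt: "\<And>ys x zs. w (ys @ x # x # zs) = 0"
  shows "w \<in> exterior_algebra"
proof -
  have alt': "w (ys @ x # ms @ x # zs) = 0" for ys x ms zs
  proof (induction ms arbitrary: ys)
    case Nil
    then show ?case using alt by simp
  next
    case (Cons m ms)
    have "w (ys @ x # m # (ms @ x # zs)) = - w (ys @ m # x # (ms @ x # zs))"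
      by (rule alternating_swap[OF lin alt])
    also have "\<dots> = 0" using Cons.IH[of "ys @ [m]"] by simp
    finally show ?case by simp
  qed
  have "linear (\<lambda>x. w (xs[i := x]))" if "i < length xs" for xs i
    using lin[of "take i xs" "drop (Suc i) xs"] that by (simp add: upd_conv_take_nth_drop)
  moreover have "w xs = 0" if "\<not> distinct xs" for xs
    using not_distinct_decomp[OF that] alt' by force
  ultimately show ?thesis by (simp add: exterior_algebra_def)
qed

lemma exterior_expand:
  fixes w :: "'e::{real_inner,heine_borel} mvec"
  assumes "w \<in> exterior_algebra"
  shows "w (ys @ x # zs) = (\<Sum>b\<in>onb. x b * w (ys @ blinfun_inner_right b # zs))"
  by (subst blinfun_onb_expand[of x, symmetric])
    (simp add: linear_sum[OF exterior_linear[OF assms]] linear_scale[OF exterior_linear[OF assms]])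

text \<open>Expanding every slot in the dual basis leaves values on lists of basis covectors, which
  must contain a repetition. In the induction \<open>ys\<close> is the part of the list already
  expanded.\<close>

lemma exterior_above_dimension:
  fixes w :: "'e::{real_inner,heine_borel} mvec"
  assumes w: "w \<in> exterior_algebra" and "card (onb :: 'e set) < length xs"
  shows "w xs = 0"
proof -
  let ?E = "blinfun_inner_right ` (onb :: 'e set)"
  have E: "finite ?E" "card ?E \<le> card (onb :: 'e set)" by (auto intro: card_image_le)
  have "w (ys @ xs) = 0" if "set ys \<subseteq> ?E" "card ?E < length (ys @ xs)" for ys
    using that
  proof (induction xs arbitrary: ys)
    case Nil
    then have "card (set ys) < length ys"
      using card_mono[OF E(1), of "set ys"] by simp
    then have "\<not> distinct ys" by (auto simp: distinct_card)
    then show ?case using exterior_not_distinct[OF w] by simp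
  next
    case (Cons x xs)
    have "w ((ys @ [blinfun_inner_right b]) @ xs) = 0" if "b \<in> onb" for b
      using Cons.prems that by (intro Cons.IH) auto
    then show ?case by (subst exterior_expand[OF w]) simp
  qed
  from this[of "[]"] assms(2) E(2) show ?thesis by simp
qed

lemma exterior_zero: "(\<lambda>_. 0) \<in> exterior_algebra"
  by (rule exterior_algebraI) (auto intro: linearI)

lemma exterior_lincomb:
  assumes "v \<in> exterior_algebra" "w \<in> exterior_algebra"
  shows "(\<lambda>xs. a * v xs + b * w xs) \<in> exterior_algebra"
proof (rule exterior_algebraI)
  show "linear (\<lambda>x. a * v (ys @ x # zs) + b * w (ys @ x # zs))" for ys zs
    using linear_add[OF exterior_linear[OF assms(1)]] linear_add[OF exterior_linear[OF assms(2)]]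
      linear_scale[OF exterior_linear[OF assms(1)]] linear_scale[OF exterior_linear[OF assms(2)]]
    by (intro linearI) (auto simp: algebra_simps)
qed (use assms in \<open>auto simp: exterior_not_distinct\<close>)

lemma exterior_scale: "w \<in> exterior_algebra \<Longrightarrow> (\<lambda>xs. a * w xs) \<in> exterior_algebra"
  using exterior_lincomb[of w w a 0] by simp

lemma exterior_restrict_degree:
  "w \<in> exterior_algebra \<Longrightarrow> (\<lambda>xs. if length xs = r then w xs else 0) \<in> exterior_algebra"
  by (rule exterior_algebraI)
    (auto simp: exterior_not_distinct linear_add[OF exterior_linear] linear_scale[OF exterior_linear]
      intro!: linearI)

lemma exterior_contract: "w \<in> exterior_algebra \<Longrightarrow> contract x w \<in> exterior_algebra"
  using exterior_linear[of w "x # _"]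
  by (intro exterior_algebraI) (auto simp: contract_def exterior_not_distinct)

lemma exterior_grade_involution: "w \<in> exterior_algebra \<Longrightarrow> grade_involution w \<in> exterior_algebra"
  unfolding grade_involution_def
  by (rule exterior_algebraI)
    (auto intro!: linearI simp: exterior_not_distinct linear_add[OF exterior_linear]
      linear_scale[OF exterior_linear] algebra_simps)

lemma exterior_scalar: "scalar a \<in> exterior_algebra"
  by (rule exterior_algebraI) (auto simp: scalar_def intro: linearI)

lemma exterior_vec1: "vec1 e \<in> exterior_algebra"
proof (rule exterior_algebraI)
  show "linear (\<lambda>x. vec1 e (ys @ x # zs))" for ys zs
  proof (cases "ys = [] \<and> zs = []")
    case True
    then show ?thesis
      by (auto simp: vec1_def intro!: bounded_linear.linear blinfun.bounded_linear_left)
  next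
    case False
    then have "(\<lambda>x. vec1 e (ys @ x # zs)) = (\<lambda>x. 0)"
      by (auto simp: vec1_def fun_eq_iff split: list.splits)
         (auto simp: append_eq_Cons_conv)
    then show ?thesis by (auto intro: linearI)
  qed
  show "vec1 e (ys @ x # x # zs) = 0" for ys x zs
    by (auto simp: vec1_def append_eq_Cons_conv split: list.splits)
qed

lemma vec1_inject: "vec1 e = vec1 e' \<Longrightarrow> e = (e' :: 'e::real_inner)"
proof -
  assume "vec1 e = vec1 e'"
  then have "vec1 e [blinfun_inner_right b] = vec1 e' [blinfun_inner_right b]" for b by simp
  then have "b \<bullet> e = b \<bullet> e'" for b by (simp add: vec1_def)
  then show ?thesis using vector_eq_ldot by blast
qed

lemma vec1_zero: "vec1 0 = (\<lambda>_. 0)"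
  by (auto simp: vec1_def blinfun.zero_right split: list.splits)

lemma exterior_push: 
  assumes "w \<in> exterior_algebra"
  shows "push T w \<in> exterior_algebra"
proof (rule exterior_algebraI)
  show "linear (\<lambda>x. push T w (ys @ x # zs))" for ys zs
    using linear_compose[OF bounded_linear.linear[OF bounded_bilinear.bounded_linear_left[OF
            bounded_bilinear_blinfun_compose, of T]] exterior_linear[OF assms]]
    by (simp add: push_def o_def)
qed (use assms in \<open>auto simp: push_def exterior_not_distinct\<close>)

lemma push_push: "push S (push T w) = push (S o\<^sub>L T) w"
proof -
  have "(\<lambda>x::_ \<Rightarrow>\<^sub>L real. (x o\<^sub>L S) o\<^sub>L T) = (\<lambda>x. x o\<^sub>L (S o\<^sub>L T))" by (auto intro!: blinfun_eqI)
  then show ?thesis by (simp add: push_def o_def)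
qed

lemma push_wedge: "push T (wedge v w) = wedge (push T v) (push T w)"
  by (simp add: push_def wedge_def nths_map)

lemma push_id: "(\<And>x. blinfun_apply T x = x) \<Longrightarrow> push T w = w"
proof -
  assume "\<And>x. blinfun_apply T x = x"
  then have "(\<lambda>x::_ \<Rightarrow>\<^sub>L real. x o\<^sub>L T) = (\<lambda>x. x)" by (auto intro!: blinfun_eqI)
  then show ?thesis unfolding push_def by simp
qed

lemma push_vec1: "push T (vec1 e) = vec1 (T e)"
  by (auto simp: push_def vec1_def fun_eq_iff split: list.splits)

lemma push_scalar: "push T (scalar a) = scalar a"
  by (simp add: push_def scalar_def)

lemma push_zero: "push T (\<lambda>_. 0) = (\<lambda>_. 0)"
  by (simp add: push_def)

lemma push_scale: "push T (\<lambda>xs. a * w xs) = (\<lambda>xs. a * push T w xs)"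
  by (simp add: push_def)

section \<open>The wedge product and its recursion\<close>

lemma wedge_Nil: "wedge v w [] = v [] * w []"
  by (simp add: wedge_def shuffle_sign_def)

text \<open>Selecting the first position creates no inversion: 0 lies below everything, and it is no
  longer among the indices left behind.\<close>

lemma shuffle_sign_insert: "finite S \<Longrightarrow> shuffle_sign (insert 0 (Suc ` S)) = shuffle_sign S"
proof -
  have "((i, j) \<in> {(i, j). i \<in> insert 0 (Suc ` S) \<and> j \<notin> insert 0 (Suc ` S) \<and> j < i}) \<longleftrightarrow>
     ((i, j) \<in> map_prod Suc Suc ` {(i, j). i \<in> S \<and> j \<notin> S \<and> j < i})" for i j
    by (cases i; cases j) (auto simp: image_iff)
  then have "{(i, j). i \<in> insert 0 (Suc ` S) \<and> j \<notin> insert 0 (Suc ` S) \<and> j < i} =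
     map_prod Suc Suc ` {(i, j). i \<in> S \<and> j \<notin> S \<and> j < i}"
    by (intro set_eqI) (auto simp only: split_paired_all)
  then show ?thesis
    by (simp add: shuffle_sign_def card_image inj_on_def)
qed

text \<open>If the first position is left behind, each of the \<open>card S\<close> selected indices
  has to pass over it.\<close>

lemma shuffle_sign_image:
  assumes S: "finite S"
  shows "shuffle_sign (Suc ` S) = (- 1) ^ card S * shuffle_sign S"
proof -
  have fin: "finite {(i, j). i \<in> S \<and> j \<notin> S \<and> j < i}"
    by (rule finite_subset[of _ "S \<times> {..Max S}"])
      (use S in \<open>auto simp: intro: order.trans[OF less_imp_le Max_ge]\<close>)
  have "((i, j) \<in> {(i, j). i \<in> Suc ` S \<and> j \<notin> Suc ` S \<and> j < i}) \<longleftrightarrow>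
     ((i, j) \<in> (\<lambda>i. (Suc i, 0)) ` S \<union> map_prod Suc Suc ` {(i, j). i \<in> S \<and> j \<notin> S \<and> j < i})" for i j
    by (cases i; cases j) (auto simp: image_iff)
  then have eq: "{(i, j). i \<in> Suc ` S \<and> j \<notin> Suc ` S \<and> j < i} =
     (\<lambda>i. (Suc i, 0)) ` S \<union> map_prod Suc Suc ` {(i, j). i \<in> S \<and> j \<notin> S \<and> j < i}"
    by (intro set_eqI) (auto simp only: split_paired_all)
  have "card {(i, j). i \<in> Suc ` S \<and> j \<notin> Suc ` S \<and> j < i} =
     card S + card {(i, j). i \<in> S \<and> j \<notin> S \<and> j < i}"
    unfolding eq using S fin
    by (subst card_Un_disjoint) (auto simp: card_image inj_on_def)
  then show ?thesis by (simp add: shuffle_sign_def power_add)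
qed

lemma Pow_lessThan_Suc:
  "Pow {..<Suc n} = image Suc ` Pow {..<n} \<union> (\<lambda>S. insert 0 (Suc ` S)) ` Pow {..<n}"
proof -
  have "{..<Suc n} = insert 0 (Suc ` {..<n})" by (auto simp: image_iff less_Suc_eq_0_disj)
  then show ?thesis by (simp add: Pow_insert image_Pow_surj[symmetric] image_image)
qed

text \<open>The interior product is an antiderivation; in terms of shuffles the two summands collect
  the sets with and without the first position. This recursion makes inductions on the list of
  covectors possible without further use of shuffles.\<close>

lemma wedge_Cons:
  "wedge v w (x # xs) = wedge (contract x v) w xs + wedge (grade_involution v) (contract x w) xs"
proof -
  let ?P = "Pow {..<length xs}"
  let ?f = "\<lambda>S. shuffle_sign S * v (nths (x # xs) S) * w (nths (x # xs) (- S))"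
  have fin: "finite S" if "S \<in> ?P" for S using that finite_subset by auto
  have nt: "nths (x # xs) (Suc ` S) = nths xs S" "nths (x # xs) (insert 0 (Suc ` S)) = x # nths xs S"
    "nths (x # xs) (- Suc ` S) = x # nths xs (- S)"
    "nths (x # xs) (- insert 0 (Suc ` S)) = nths xs (- S)" for S
    by (auto simp: nths_Cons image_iff Compl_eq intro!: arg_cong[where f="nths xs"])
  have "wedge v w (x # xs) = sum ?f (image Suc ` ?P) + sum ?f ((\<lambda>S. insert 0 (Suc ` S)) ` ?P)"
    unfolding wedge_def length_Cons Pow_lessThan_Suc by (rule sum.union_disjoint) auto
  also have "sum ?f (image Suc ` ?P) = (\<Sum>S\<in>?P. ?f (Suc ` S))"
    by (subst sum.reindex) (auto simp: inj_on_def inj_image_eq_iff)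
  also have "\<dots> = wedge (grade_involution v) (contract x w) xs"
    unfolding wedge_def
  proof (rule sum.cong)
    fix S assume S: "S \<in> ?P"
    then have "{i. i < length xs \<and> i \<in> S} = S" by auto
    then show "?f (Suc ` S) = shuffle_sign S * grade_involution v (nths xs S) * contract x w (nths xs (- S))"
      using fin[OF S] by (simp add: nt shuffle_sign_image grade_involution_def contract_def length_nths)
  qed simp
  also have "sum ?f ((\<lambda>S. insert 0 (Suc ` S)) ` ?P) = (\<Sum>S\<in>?P. ?f (insert 0 (Suc ` S)))"
    by (subst sum.reindex) (auto simp: inj_on_def insert_eq_iff inj_image_eq_iff)
  also have "\<dots> = wedge (contract x v) w xs"
    unfolding wedge_def using fin by (intro sum.cong) (auto simp: nt shuffle_sign_insert contract_def)
  finally show ?thesis by simp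
qed

lemma wedge_lincomb_left:
  "wedge (\<lambda>ys. a * v ys + b * v' ys) w xs = a * wedge v w xs + b * wedge v' w xs"
  by (simp add: wedge_def sum_distrib_left sum.distrib[symmetric] algebra_simps)

lemma wedge_lincomb_right:
  "wedge v (\<lambda>ys. a * w ys + b * w' ys) xs = a * wedge v w xs + b * wedge v w' xs"
  by (simp add: wedge_def sum_distrib_left sum.distrib[symmetric] algebra_simps)

lemma wedge_zero [simp]: "wedge (\<lambda>_. 0) w = (\<lambda>_. 0)" "wedge v (\<lambda>_. 0) = (\<lambda>_. 0)"
  by (simp_all add: wedge_def)

lemma wedge_scale:
  "wedge (\<lambda>ys. a * v ys) w = (\<lambda>xs. a * wedge v w xs)"
  "wedge v (\<lambda>ys. a * w ys) = (\<lambda>xs. a * wedge v w xs)"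
  by (simp_all add: wedge_def sum_distrib_left algebra_simps fun_eq_iff)

lemma wedge_scalar: "wedge (scalar a) w = (\<lambda>xs. a * w xs)" "wedge v (scalar a) = (\<lambda>xs. v xs * a)"
proof -
  have c: "contract x (scalar a) = (\<lambda>_. 0)" for x :: "'a \<Rightarrow>\<^sub>L real"
    by (simp add: contract_def scalar_def)
  have g: "grade_involution (scalar a :: 'a mvec) = scalar a"
    by (auto simp: grade_involution_def scalar_def)
  have "wedge (scalar a) w xs = a * w xs" for xs
    by (induction xs arbitrary: w) (simp_all add: wedge_Nil wedge_Cons c g, simp_all add: contract_def scalar_def)
  then show "wedge (scalar a) w = (\<lambda>xs. a * w xs)" by blast
next
  have c: "contract x (scalar a) = (\<lambda>_. 0)" for x :: "'b \<Rightarrow>\<^sub>L real"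
    by (simp add: contract_def scalar_def)
  have "wedge v (scalar a) xs = v xs * a" for xs
    by (induction xs arbitrary: v) (simp_all add: wedge_Nil wedge_Cons c, simp_all add: contract_def scalar_def)
  then show "wedge v (scalar a) = (\<lambda>xs. v xs * a)" by blast
qed

text \<open>Contracting twice with the same \<open>x\<close> kills each single factor, and the two
  mixed terms have opposite signs because contraction anticommutes with
  \<open>grade_involution\<close>.\<close>

lemma wedge_adjacent:
  assumes "v \<in> exterior_algebra" "w \<in> exterior_algebra"
  shows "wedge v w (ys @ x # x # zs) = 0"
  using assms
proof (induction ys arbitrary: v w)
  case Nil
  have "contract x (contract x v) = (\<lambda>_. 0)" "contract x (contract x w) = (\<lambda>_. 0)"
    using Nil by (auto simp: contract_def exterior_not_distinct)
  moreover have "contract x (grade_involution v) = (\<lambda>ys. (-1) * grade_involution (contract x v) ys)"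
    by (simp add: contract_def grade_involution_def)
  ultimately show ?case by (simp add: wedge_Cons wedge_scale(1)[of "- 1", simplified])
next
  case (Cons y ys)
  then show ?case
    by (simp add: wedge_Cons exterior_contract exterior_grade_involution)
qed

lemma wedge_linear:
  assumes "v \<in> exterior_algebra" "w \<in> exterior_algebra"
  shows "linear (\<lambda>x. wedge v w (ys @ x # zs))"
  using assms
proof (induction ys arbitrary: v w)
  case Nil
  have c: "contract (a *\<^sub>R x + b *\<^sub>R y) u = (\<lambda>ys. a * contract x u ys + b * contract y u ys)"
    if "u \<in> exterior_algebra" for u :: "'a mvec" and a x b y
    using linear_add[OF exterior_linear[OF that, of "[]"]] linear_scale[OF exterior_linear[OF that, of "[]"]]
    by (simp add: contract_def)
  have *: "wedge v w ((a *\<^sub>R x + b *\<^sub>R y) # zs) = a * wedge v w (x # zs) + b * wedge v w (y # zs)" for a x b y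
    by (simp add: wedge_Cons c Nil wedge_lincomb_left wedge_lincomb_right algebra_simps)
  show ?case
    using *[of 1 _ 1] *[of _ _ 0] by (intro linearI) simp_all
next
  case (Cons y ys)
  then show ?case
    by (simp add: wedge_Cons exterior_contract exterior_grade_involution linear_compose_add)
qed

lemma exterior_wedge:
  "v \<in> exterior_algebra \<Longrightarrow> w \<in> exterior_algebra \<Longrightarrow> wedge v w \<in> exterior_algebra"
  by (rule exterior_algebraI) (simp_all add: wedge_linear wedge_adjacent)

text \<open>The Euler identity for the degree operator; it allows inductions on the degree without
  multi-indices.\<close>

lemma sum_vec1_wedge_contract:
  fixes w :: "'e::{real_inner,heine_borel} mvec"
  assumes "w \<in> exterior_algebra"
  shows "(\<Sum>b\<in>onb. wedge (vec1 b) (contract (blinfun_inner_right b) w) xs) = length xs * w xs"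
  using assms
proof (induction xs arbitrary: w)
  case Nil
  then show ?case by (simp add: wedge_Nil vec1_def)
next
  case (Cons x xs)
  have v: "contract x (vec1 b) = scalar (x b)" "grade_involution (vec1 b) = (\<lambda>ys. (-1) * vec1 b ys)" for b :: 'e
    by (auto simp: contract_def vec1_def scalar_def grade_involution_def fun_eq_iff split: list.splits)
  have c: "contract x (contract y w) = (\<lambda>ys. (-1) * contract y (contract x w) ys)" for y
  proof
    show "contract x (contract y w) ys = (-1) * contract y (contract x w) ys" for ys
      using exterior_swap[OF Cons.prems, of "[]" y x ys] by (simp add: contract_def)
  qed
  \<comment> \<open>The numbers \<open>x b\<close> are coordinates of \<open>x\<close> in the dual
    basis, so the first sum is \<open>w (x # xs)\<close>. In the second sum the sign from passing
    over \<open>vec1 b\<close> cancels the one from exchanging the two contractions.\<close>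
  have "(\<Sum>b\<in>onb. wedge (vec1 b) (contract (blinfun_inner_right b) w) (x # xs)) =
    (\<Sum>b\<in>onb. x b * contract (blinfun_inner_right b) w xs)
    + (\<Sum>b\<in>onb. wedge (vec1 b) (contract (blinfun_inner_right b) (contract x w)) xs)"
    by (simp add: wedge_Cons v c wedge_scalar wedge_scale(1)[of "- 1", simplified]
        wedge_scale(2)[of _ "- 1", simplified] sum.distrib)
  also have "\<dots> = w (x # xs) + length xs * contract x w xs"
    using exterior_expand[OF Cons.prems, of "[]" x xs] Cons.IH[OF exterior_contract[OF Cons.prems]]
    by (simp add: contract_def)
  finally show ?case by (simp add: contract_def algebra_simps)
qed

subsection \<open>Families of multivectors\<close>

text \<open>Smoothness is known for fixed covectors only; by multilinearity, varying covectors
  contribute their coordinates as scalar factors.\<close>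

lemma smooth_on_exterior:
  fixes w :: "'z::real_normed_vector \<Rightarrow> 'e::{real_inner,heine_borel} mvec"
  assumes S: "open S" and w: "\<And>z. w z \<in> exterior_algebra"
    and sw: "\<And>ys. smooth_on S (\<lambda>z. w z ys)"
    and sg: "\<And>k y. k \<in> set xs \<Longrightarrow> smooth_on S (\<lambda>z. blinfun_apply (g k z) y)"
  shows "smooth_on S (\<lambda>z. w z (map (\<lambda>k. g k z) xs))"
proof -
  have "smooth_on S (\<lambda>z. w z (ys @ map (\<lambda>k. g k z) xs))" for ys
    using sg
  proof (induction xs arbitrary: ys)
    case Nil
    then show ?case using sw by simp
  next
    case (Cons k xs)
    have "smooth_on S (\<lambda>z. \<Sum>b\<in>onb. g k z b * w z ((ys @ [blinfun_inner_right b]) @ map (\<lambda>k. g k z) xs))"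
      using Cons.prems by (intro smooth_on_sum smooth_on_mult S Cons.IH) auto
    then show ?case
      by (simp add: exterior_expand[OF w, of _ ys "g k _"])
  qed
  from this[of "[]"] show ?thesis by simp
qed

text \<open>The derivative at \<open>t = 0\<close> of \<open>w (x + t u)\<close> on the covectors \<open>g k + t g' k\<close>.\<close>

definition mv_der :: "('z::real_normed_vector \<Rightarrow> 'e::real_normed_vector mvec) \<Rightarrow> 'z \<Rightarrow> 'z \<Rightarrow>
    ('k \<Rightarrow> 'e \<Rightarrow>\<^sub>L real) \<Rightarrow> ('k \<Rightarrow> 'e \<Rightarrow>\<^sub>L real) \<Rightarrow> 'k list \<Rightarrow> real" where
  "mv_der w x u g g' xs = frechet_derivative (\<lambda>z. w z (map g xs)) (at x) u +
     (\<Sum>i<length xs. w x ((map g xs)[i := g' (xs ! i)]))"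

text \<open>The Leibniz rule for a multilinear form with varying arguments. Slots are expanded one
  after the other, and the prefix \<open>ys\<close> holds the fixed basis covectors that replace
  them.\<close>

lemma has_derivative_exterior:
  fixes w :: "'z::real_normed_vector \<Rightarrow> 'e::{real_inner,heine_borel} mvec"
  assumes w: "\<And>z. w z \<in> exterior_algebra"
    and dw: "\<And>ys. (\<lambda>z. w z ys) differentiable (at z0)"
    and dg: "\<And>k y. k \<in> set xs \<Longrightarrow> ((\<lambda>z. blinfun_apply (g k z) y) has_derivative (\<lambda>h. blinfun_apply (g' k h) y)) (at z0)"
  shows "((\<lambda>z. w z (map (\<lambda>k. g k z) xs)) has_derivative
    (\<lambda>h. mv_der w z0 h (\<lambda>k. g k z0) (\<lambda>k. g' k h) xs)) (at z0)"
proof -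
  let ?D = "\<lambda>ys. frechet_derivative (\<lambda>z. w z ys) (at z0)"
  let ?m = "map (\<lambda>k. g k z0)"
  have "((\<lambda>z. w z (ys @ map (\<lambda>k. g k z) xs)) has_derivative
     (\<lambda>h. ?D (ys @ ?m xs) h + (\<Sum>i<length xs. w z0 (ys @ (?m xs)[i := g' (xs ! i) h])))) (at z0)" for ys
    using dg
  proof (induction xs arbitrary: ys)
    case Nil
    show ?case using differentiable_frechetD[OF dw[of ys]] by simp
  next
    case (Cons k xs)
    let ?b = "blinfun_inner_right :: 'e \<Rightarrow> _"
    let ?R = "\<lambda>b h. ?D ((ys @ [?b b]) @ ?m xs) h + (\<Sum>i<length xs. w z0 ((ys @ [?b b]) @ (?m xs)[i := g' (xs ! i) h]))"
    have IH: "((\<lambda>z. w z ((ys @ [?b b]) @ map (\<lambda>k. g k z) xs)) has_derivative ?R b) (at z0)" for b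
      using Cons.prems by (intro Cons.IH) auto
    have "((\<lambda>z. \<Sum>b\<in>onb. g k z b * w z ((ys @ [?b b]) @ map (\<lambda>k. g k z) xs)) has_derivative
       (\<lambda>h. \<Sum>b\<in>onb. g k z0 b * ?R b h + g' k h b * w z0 ((ys @ [?b b]) @ ?m xs))) (at z0)"
      using Cons.prems by (intro has_derivative_sum has_derivative_mult IH) auto
    \<comment> \<open>Differentiation in \<open>z\<close> at fixed covectors inherits linearity in
      each slot.\<close>
    moreover have "?D (ys @ g k z0 # ?m xs) h = (\<Sum>b\<in>onb. g k z0 b * ?D ((ys @ [?b b]) @ ?m xs) h)" for h
    proof -
      have "((\<lambda>z. \<Sum>b\<in>onb. g k z0 b * w z ((ys @ [?b b]) @ ?m xs)) has_derivative
        (\<lambda>h. \<Sum>b\<in>onb. g k z0 b * ?D ((ys @ [?b b]) @ ?m xs) h)) (at z0)"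
        by (intro has_derivative_sum has_derivative_mult_right differentiable_frechetD dw)
      then have "((\<lambda>z. w z (ys @ g k z0 # ?m xs)) has_derivative
        (\<lambda>h. \<Sum>b\<in>onb. g k z0 b * ?D ((ys @ [?b b]) @ ?m xs) h)) (at z0)"
        by (simp add: exterior_expand[OF w, of _ ys "g k z0"])
      then show ?thesis by (simp only: frechet_derivative_eqI)
    qed
    then have "(\<Sum>b\<in>onb. g k z0 b * ?R b h + g' k h b * w z0 ((ys @ [?b b]) @ ?m xs)) =
       ?D (ys @ ?m (k # xs)) h + (\<Sum>i<length (k # xs). w z0 (ys @ (?m (k # xs))[i := g' ((k # xs) ! i) h]))" for h
    proof -
      have "(\<Sum>i<length xs. w z0 (ys @ g k z0 # (?m xs)[i := g' (xs ! i) h])) =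
        (\<Sum>i<length xs. \<Sum>b\<in>onb. g k z0 b * w z0 (ys @ ?b b # (?m xs)[i := g' (xs ! i) h]))"
        by (intro sum.cong refl exterior_expand[OF w])
      also have "\<dots> = (\<Sum>b\<in>onb. g k z0 b * (\<Sum>i<length xs. w z0 (ys @ ?b b # (?m xs)[i := g' (xs ! i) h])))"
        by (subst sum.swap) (simp add: sum_distrib_left)
      finally show ?thesis
        using \<open>\<And>h. ?D (ys @ g k z0 # ?m xs) h = _ h\<close>
        by (simp only: length_Cons sum.lessThan_Suc_shift list.map list_update_code nth_Cons_0 nth_Cons_Suc
            exterior_expand[OF w, of z0 ys "g' k h"] o_def)
          (simp add: sum.distrib distrib_left)
    qed
    ultimately show ?case
      by (simp add: exterior_expand[OF w, of _ ys "g k _"])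
  qed
  from this[of "[]"] show ?thesis unfolding mv_der_def by simp
qed

text \<open>Only the position and the velocity of the curve \<open>c\<close> at 0 enter, so a
  straight line may be replaced by any curve with the same velocity; this is used when the chart is
  changed.\<close>

lemma has_vector_derivative_exterior:
  fixes w :: "'z::real_normed_vector \<Rightarrow> 'e::{real_inner,heine_borel} mvec"
  assumes w: "\<And>z. w z \<in> exterior_algebra"
    and dw: "\<And>ys. (\<lambda>z. w z ys) differentiable (at (c 0))"
    and c: "(c has_vector_derivative u) (at 0)"
    and dg: "\<And>k y. k \<in> set xs \<Longrightarrow> ((\<lambda>t. blinfun_apply (g k t) y) has_vector_derivative blinfun_apply (g' k) y) (at 0)"
  shows "((\<lambda>t. w (c t) (map (\<lambda>k. g k t) xs)) has_vector_derivative
    mv_der w (c 0) u (\<lambda>k. g k 0) g' xs) (at 0)"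
proof -
  have fd: "((\<lambda>t. w (c t) ys) has_derivative (\<lambda>h. frechet_derivative (\<lambda>z. w z ys) (at (c 0)) (h *\<^sub>R u))) (at 0)" for ys
    using has_derivative_compose[OF c[unfolded has_vector_derivative_def] differentiable_frechetD[OF dw[of ys]]] .
  have "((\<lambda>t. w (c t) (map (\<lambda>k. g k t) xs)) has_derivative
    (\<lambda>h. mv_der (\<lambda>t. w (c t)) 0 h (\<lambda>k. g k 0) (\<lambda>k. h *\<^sub>R g' k) xs)) (at 0)"
    using dg by (intro has_derivative_exterior w) (auto simp: differentiable_def has_vector_derivative_def scaleR_blinfun.rep_eq intro: fd)
  moreover have "mv_der (\<lambda>t. w (c t)) 0 h (\<lambda>k. g k 0) (\<lambda>k. h *\<^sub>R g' k) xs =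
     h *\<^sub>R mv_der w (c 0) u (\<lambda>k. g k 0) g' xs" for h
  proof -
    have "w (c 0) ((map (\<lambda>k. g k 0) xs)[i := h *\<^sub>R g' (xs ! i)]) = h * w (c 0) ((map (\<lambda>k. g k 0) xs)[i := g' (xs ! i)])"
      if "i < length xs" for i
    proof -
      have "linear (\<lambda>x. w (c 0) ((map (\<lambda>k. g k 0) xs)[i := x]))"
        using w[of "c 0"] that unfolding exterior_algebra_def by simp
      from linear_scale[OF this] show ?thesis by simp
    qed
    then show ?thesis
      by (simp add: mv_der_def frechet_derivative_eqI[OF fd] distrib_left sum_distrib_left
          linear_scale[OF has_derivative_linear[OF differentiable_frechetD[OF dw]]])
  qed
  ultimately show ?thesis by (simp add: has_vector_derivative_def)
qed

text \<open>Linearity and alternation are linear identities between values of \<open>k t\<close>, so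
  they pass to the derivative by its uniqueness.\<close>

lemma exterior_derivative_curve:
  assumes k: "\<And>t. k t \<in> exterior_algebra"
    and D: "\<And>xs. ((\<lambda>t. k t xs) has_vector_derivative D xs) (at 0)"
  shows "D \<in> exterior_algebra"
proof (rule exterior_algebraI)
  show "linear (\<lambda>x. D (ys @ x # zs))" for ys zs
  proof (rule linearI)
    fix x y and r :: real
    have "((\<lambda>t. k t (ys @ x # zs) + k t (ys @ y # zs)) has_vector_derivative D (ys @ x # zs) + D (ys @ y # zs)) (at 0)"
      by (intro has_vector_derivative_add D)
    then have "((\<lambda>t. k t (ys @ (x + y) # zs)) has_vector_derivative D (ys @ x # zs) + D (ys @ y # zs)) (at 0)"
      by (simp add: linear_add[OF exterior_linear[OF k]])
    from vector_derivative_unique_at[OF D this]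
    show "D (ys @ (x + y) # zs) = D (ys @ x # zs) + D (ys @ y # zs)" .
    have "((\<lambda>t. r * k t (ys @ x # zs)) has_vector_derivative r * D (ys @ x # zs)) (at 0)"
      by (intro has_vector_derivative_mult_right D)
    then have "((\<lambda>t. k t (ys @ (r *\<^sub>R x) # zs)) has_vector_derivative r * D (ys @ x # zs)) (at 0)"
      by (simp add: linear_scale[OF exterior_linear[OF k]])
    from vector_derivative_unique_at[OF D this]
    show "D (ys @ (r *\<^sub>R x) # zs) = r *\<^sub>R D (ys @ x # zs)" by simp
  qed
  show "D (ys @ x # x # zs) = 0" for ys x zs
  proof -
    have "((\<lambda>t. 0) has_vector_derivative D (ys @ x # x # zs)) (at 0)"
      using D[of "ys @ x # x # zs"] by (simp add: exterior_not_distinct[OF k])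
    then show ?thesis
      by (rule vector_derivative_unique_at[OF _ has_vector_derivative_const])
  qed
qed

lemma wedge_derivative_curve:
  assumes "\<And>xs. ((\<lambda>t. v t xs) has_vector_derivative V xs) (at 0)"
    and "\<And>xs. ((\<lambda>t. w t xs) has_vector_derivative W xs) (at 0)"
  shows "((\<lambda>t. wedge (v t) (w t) xs) has_vector_derivative
     wedge V (w 0) xs + wedge (v 0) W xs) (at 0)"
proof -
  have "((\<lambda>t. wedge (v t) (w t) xs) has_vector_derivative
    (\<Sum>S\<in>Pow {..<length xs}. shuffle_sign S * v 0 (nths xs S) * W (nths xs (- S))
     + shuffle_sign S * V (nths xs S) * w 0 (nths xs (- S)))) (at 0)"
    unfolding wedge_def
  proof (rule has_vector_derivative_sum)
    fix S
    show "((\<lambda>t. shuffle_sign S * v t (nths xs S) * w t (nths xs (- S))) has_vector_derivative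
      shuffle_sign S * v 0 (nths xs S) * W (nths xs (- S))
       + shuffle_sign S * V (nths xs S) * w 0 (nths xs (- S))) (at 0)"
      by (rule has_vector_derivative_mult[OF has_vector_derivative_mult_right[OF assms(1)] assms(2)])
  qed
  then show ?thesis by (simp add: wedge_def sum.distrib add.commute)
qed

section \<open>Atlases\<close>

text \<open>Charts are pairs, but quantifiers over charts are not to be split.\<close>

declare split_paired_All [simp del] split_paired_Ex [simp del]

text \<open>The \<^const>\<open>Blinfun\<close> form is the one which occurs in \<^const>\<open>multivectors_at\<close>.\<close>

definition jac :: "('a, 'e::real_normed_vector) chart \<Rightarrow> ('a, 'e) chart \<Rightarrow> 'e \<Rightarrow> 'e \<Rightarrow>\<^sub>L 'e" where
  "jac c d x = Blinfun (frechet_derivative (trans_map c d) (at x))"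

text \<open>On the fibre over \<open>p\<close> this inverts \<open>v \<mapsto> v c\<close>; it
  supplies the points of \<open>TM\<close> with given coordinates in the chart induced by
  \<open>c\<close>.\<close>

definition extend_tvec ::
  "('a, 'e::{real_inner, heine_borel}) chart set \<Rightarrow> 'a \<Rightarrow> ('a, 'e) chart \<Rightarrow> 'e \<Rightarrow> ('a, 'e) tvec" where
  "extend_tvec A p c u = (\<lambda>d. if d \<in> charts_at A p then jac c d (snd c p) u else 0)"

text \<open>Compatibility of charts is separated from the topology because it passes to the tangent
  bundle by a computation with transition maps.\<close>

locale atlas =
  fixes A :: "('a, 'e::{real_inner, heine_borel}) chart set"
  assumes inj_chart: "c \<in> A \<Longrightarrow> inj_on (snd c) (fst c)"
    and open_chart: "c \<in> A \<Longrightarrow> open (snd c ` fst c)"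
    and open_overlap: "c \<in> A \<Longrightarrow> d \<in> A \<Longrightarrow> open (snd c ` (fst c \<inter> fst d))"
    and smooth_trans: "c \<in> A \<Longrightarrow> d \<in> A \<Longrightarrow> smooth_on (snd c ` (fst c \<inter> fst d)) (trans_map c d)"
begin

lemma charts_at_iff: "c \<in> charts_at A p \<longleftrightarrow> c \<in> A \<and> p \<in> fst c"
  by (simp add: charts_at_def)

lemma chart_inv_chart [simp]: "c \<in> A \<Longrightarrow> p \<in> fst c \<Longrightarrow> chart_inv c (snd c p) = p"
  by (simp add: chart_inv_def inj_chart)

lemma chart_inv_mem: "x \<in> snd c ` fst c \<Longrightarrow> chart_inv c x \<in> fst c"
  by (simp add: chart_inv_def inv_into_into)

lemma chart_chart_inv: "x \<in> snd c ` fst c \<Longrightarrow> snd c (chart_inv c x) = x"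
  by (simp add: chart_inv_def f_inv_into_f)

lemma chart_inv_overlap:
  assumes "c \<in> A" "x \<in> snd c ` (fst c \<inter> U)"
  shows "chart_inv c x \<in> fst c" "chart_inv c x \<in> U" "snd c (chart_inv c x) = x"
  using assms by auto

lemma trans_map_chart [simp]: "c \<in> A \<Longrightarrow> p \<in> fst c \<Longrightarrow> trans_map c d (snd c p) = snd d p"
  by (simp add: trans_map_def)

lemma trans_differentiable:
  assumes "c \<in> A" "d \<in> A" "x \<in> snd c ` (fst c \<inter> fst d)"
  shows "trans_map c d differentiable (at x)"
  using smooth_on_differentiable[OF smooth_trans] assms by blast

lemma jac_apply:
  assumes "c \<in> A" "d \<in> A" "x \<in> snd c ` (fst c \<inter> fst d)"
  shows "blinfun_apply (jac c d x) = frechet_derivative (trans_map c d) (at x)"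
  unfolding jac_def using smooth_on_linear_derivative[OF smooth_trans] assms
  by (intro bounded_linear_Blinfun_apply) blast

lemma has_derivative_trans:
  assumes "c \<in> A" "d \<in> A" "x \<in> snd c ` (fst c \<inter> fst d)"
  shows "(trans_map c d has_derivative jac c d x) (at x)"
  using trans_differentiable[OF assms] by (simp add: jac_apply[OF assms] differentiable_frechetD)

lemma smooth_jac:
  assumes "c \<in> A" "d \<in> A"
  shows "smooth_on (snd c ` (fst c \<inter> fst d)) (\<lambda>x. jac c d x v)"
  by (rule smooth_on_cong[OF open_overlap[OF assms] smooth_on_derivative_dir[OF smooth_trans[OF assms]]])
    (simp add: jac_apply[OF assms])

text \<open>The chain rule, in the form of the cocycle identity on which the consistency of every
  family of components rests.\<close>

lemma jac_compose:
  assumes c: "c \<in> charts_at A p" and d: "d \<in> charts_at A p" and e: "e \<in> charts_at A p"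
  shows "jac d e (snd d p) o\<^sub>L jac c d (snd c p) = jac c e (snd c p)"
proof -
  have A: "c \<in> A" "d \<in> A" "e \<in> A" and p: "p \<in> fst c" "p \<in> fst d" "p \<in> fst e"
    using assms by (auto simp: charts_at_iff)
  have "((\<lambda>x. trans_map d e (trans_map c d x)) has_derivative
     (\<lambda>v. jac d e (snd d p) (jac c d (snd c p) v))) (at (snd c p))"
    using has_derivative_compose[OF has_derivative_trans[OF A(1,2)], where g="trans_map d e" and x="snd c p"]
      has_derivative_trans[OF A(2,3), of "snd d p"] A p by simp
  then have "(trans_map c e has_derivative (\<lambda>v. jac d e (snd d p) (jac c d (snd c p) v))) (at (snd c p))"
    by (rule has_derivative_transform_within_open[OF _ open_overlap[OF A(1,2)]])
      (use A p in auto)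
  then have "blinfun_apply (jac c e (snd c p)) = (\<lambda>v. jac d e (snd d p) (jac c d (snd c p) v))"
    using jac_apply[OF A(1,3), of "snd c p"] p frechet_derivative_eqI by auto
  then show ?thesis by (intro blinfun_eqI) simp
qed

lemma jac_self:
  assumes "c \<in> charts_at A p"
  shows "jac c c (snd c p) v = v"
proof -
  have c: "c \<in> A" "p \<in> fst c" using assms by (auto simp: charts_at_iff)
  have "((\<lambda>x. x) has_derivative (\<lambda>v. v)) (at (snd c p))" by (rule has_derivative_ident)
  then have "(trans_map c c has_derivative (\<lambda>v. v)) (at (snd c p))"
    by (rule has_derivative_transform_within_open[OF _ open_chart[OF c(1)]]) (use c in auto)
  from frechet_derivative_eqI[OF this] show ?thesis
    using jac_apply[OF c(1) c(1), of "snd c p"] c by simp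
qed

section \<open>Tangent vectors and multivectors in terms of Jacobians\<close>

lemma tangent_space_iff:
  "v \<in> tangent_space A p \<longleftrightarrow>
    (\<forall>c\<in>charts_at A p. \<forall>d\<in>charts_at A p. v d = jac c d (snd c p) (v c)) \<and>
    (\<forall>c. c \<notin> charts_at A p \<longrightarrow> v c = 0)"
proof -
  have *: "jac c d (snd c p) u = frechet_derivative (trans_map c d) (at (snd c p)) u"
    if "c \<in> charts_at A p" "d \<in> charts_at A p" for c d u
    using jac_apply[of c d "snd c p"] that by (auto simp: charts_at_iff)
  show ?thesis unfolding tangent_space_def mem_Collect_eq
    by (intro arg_cong2[where f="(\<and>)"] ball_cong refl) (simp only: *)
qed

lemma tangent_spaceD:
  "v \<in> tangent_space A p \<Longrightarrow> c \<in> charts_at A p \<Longrightarrow> d \<in> charts_at A p \<Longrightarrow> v d = jac c d (snd c p) (v c)"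
  unfolding tangent_space_iff by blast

lemma tangent_space_outside: "v \<in> tangent_space A p \<Longrightarrow> c \<notin> charts_at A p \<Longrightarrow> v c = 0"
  unfolding tangent_space_iff by blast

lemma zero_tangent: "(\<lambda>_. 0) \<in> tangent_space A p"
  by (simp add: tangent_space_iff blinfun.zero_right)

lemma extend_tvec_tangent: "c \<in> charts_at A p \<Longrightarrow> extend_tvec A p c u \<in> tangent_space A p"
  unfolding tangent_space_iff
proof (intro conjI ballI allI impI)
  fix d e assume c: "c \<in> charts_at A p" and "d \<in> charts_at A p" "e \<in> charts_at A p"
  then show "extend_tvec A p c u e = jac d e (snd d p) (extend_tvec A p c u d)"
    using arg_cong[OF jac_compose[of c p d e], of "\<lambda>T. T u"] by (simp add: extend_tvec_def)
qed (simp add: extend_tvec_def)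

lemma extend_tvec_self: "c \<in> charts_at A p \<Longrightarrow> extend_tvec A p c u c = u"
  by (simp add: extend_tvec_def jac_self)

lemma extend_tvec_tangent_space:
  "v \<in> tangent_space A p \<Longrightarrow> c \<in> charts_at A p \<Longrightarrow> extend_tvec A p c (v c) = v"
proof (rule ext)
  fix d assume v: "v \<in> tangent_space A p" and c: "c \<in> charts_at A p"
  show "extend_tvec A p c (v c) d = v d"
    using tangent_spaceD[OF v c] tangent_space_outside[OF v] by (simp add: extend_tvec_def)
qed

lemma multivectors_at_iff:
  "w \<in> multivectors_at A p \<longleftrightarrow>
     (\<forall>c. w c \<in> exterior_algebra) \<and>
     (\<forall>c\<in>charts_at A p. \<forall>d\<in>charts_at A p. w d = push (jac c d (snd c p)) (w c)) \<and>
     (\<forall>c. c \<notin> charts_at A p \<longrightarrow> w c = (\<lambda>_. 0))"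
  unfolding multivectors_at_def push_def jac_def fun_eq_iff mem_Collect_eq by (rule refl)

lemma mem_carrier: "p \<in> carrier_of A \<longleftrightarrow> (\<exists>c. c \<in> charts_at A p)"
  by (auto simp: carrier_of_def charts_at_def)

lemma some_chart: "p \<in> carrier_of A \<Longrightarrow> some_chart A p \<in> charts_at A p"
  unfolding mem_carrier some_chart_def by (rule someI_ex)

end

subsection \<open>Bump functions on manifolds\<close>

text \<open>The last clause is a chartwise form of the support of \<open>h\<close> lying in
  \<open>fst c\<close>. Vanishing on neighbourhoods, not merely at points, is what permits smooth
  extension by zero.\<close>

definition bump_at :: "('a, 'e::{real_inner, heine_borel}) chart set \<Rightarrow> ('a, 'e) chart \<Rightarrow> 'a \<Rightarrow> ('a \<Rightarrow> real) \<Rightarrow> bool" where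
  "bump_at A c p h \<longleftrightarrow> h \<in> smooth_functions A \<and> h p = 1 \<and>
     (\<forall>d\<in>A. \<forall>x\<in>snd d ` (fst d - fst c). \<exists>N. open N \<and> x \<in> N \<and>
        (\<forall>y\<in>N \<inter> snd d ` fst d. h (chart_inv d y) = 0))"

text \<open>Bump functions are the form in which the topology enters the uniqueness proofs. Stated
  as an assumption, they can be transferred from \<open>M\<close> to \<open>TM\<close>, so that one
  uniqueness lemma serves operators on both.\<close>

locale bump_atlas = atlas A for A :: "('a, 'e::{real_inner, heine_borel}) chart set" +
  assumes bump_exists: "c \<in> A \<Longrightarrow> p \<in> fst c \<Longrightarrow> \<exists>h. bump_at A c p h"

lemma (in atlas) bump_at_outside:
  assumes "bump_at A c p h" "q \<in> carrier_of A" "q \<notin> fst c"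
  shows "h q = 0"
proof -
  obtain d where "d \<in> A" "q \<in> fst d" using assms(2) by (auto simp: carrier_of_def)
  moreover from this have "snd d q \<in> snd d ` (fst d - fst c)" using assms(3) by blast
  ultimately show ?thesis using assms(1) unfolding bump_at_def
    by (metis IntI chart_inv_chart imageI)
qed

text \<open>On the overlap \<open>g\<close> is a product of smooth functions; every other point of
  the chart has a neighbourhood on which \<open>h\<close> vanishes, and with it
  \<open>g\<close>.\<close>

lemma (in atlas) smooth_on_extend_bump:
  assumes b: "bump_at A c p h" and A: "c \<in> A" "d \<in> A"
    and f: "smooth_on (snd d ` (fst d \<inter> fst c)) f"
    and g: "\<And>x. x \<in> snd d ` (fst d \<inter> fst c) \<Longrightarrow> g x = h (chart_inv d x) *\<^sub>R f x"
    and g0: "\<And>x. x \<in> snd d ` (fst d - fst c) \<Longrightarrow> g x = 0"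
  shows "smooth_on (snd d ` fst d) g"
proof (rule smooth_on_local)
  fix x assume x: "x \<in> snd d ` fst d"
  let ?T = "snd d ` (fst d \<inter> fst c)"
  show "\<exists>T. open T \<and> x \<in> T \<and> smooth_on T g"
  proof (cases "x \<in> ?T")
    case True
    have h: "smooth_on ?T (\<lambda>x. h (chart_inv d x))"
      using b A(2) by (auto simp: bump_at_def smooth_functions_def o_def intro: smooth_on_subset)
    have o: "open ?T" by (rule open_overlap[OF A(2,1)])
    have "smooth_on ?T g"
      by (rule smooth_on_cong[OF o smooth_on_scaleR[OF o h f]]) (simp add: g)
    with o True show ?thesis by blast
  next
    case False
    then have x': "x \<in> snd d ` (fst d - fst c)" using x by auto
    then obtain N where N: "open N" "x \<in> N" "\<forall>y\<in>N \<inter> snd d ` fst d. h (chart_inv d y) = 0"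
      using b A(2) unfolding bump_at_def by meson
    let ?N = "N \<inter> snd d ` fst d"
    have o: "open ?N" using N(1) open_chart[OF A(2)] by blast
    have "g y = 0" if "y \<in> ?N" for y
    proof (cases "y \<in> ?T")
      case True
      then show ?thesis using N(3) that by (simp add: g)
    next
      case False
      then show ?thesis using that by (intro g0) auto
    qed
    then have "smooth_on ?N g"
      using smooth_on_cong[OF o smooth_on_const[OF o, of 0]] by metis
    then show ?thesis using o N(2) x by blast
  qed
qed

text \<open>The constant \<open>topology\<close> returns the given family of sets once this family
  is known to be a topology. For intersections, injectivity of the charts lets images commute with
  them.\<close>

lemma (in atlas) openin_manifold_topology:
  "openin (manifold_topology A) U \<longleftrightarrow> U \<subseteq> carrier_of A \<and> (\<forall>c\<in>A. open (snd c ` (U \<inter> fst c)))"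
proof -
  let ?P = "\<lambda>U. U \<subseteq> carrier_of A \<and> (\<forall>c\<in>A. open (snd c ` (U \<inter> fst c)))"
  have "istopology ?P"
    unfolding istopology_def
  proof (rule conjI; intro allI impI)
    fix U V assume U: "?P U" and V: "?P V"
    have "snd c ` (U \<inter> V \<inter> fst c) = snd c ` (U \<inter> fst c) \<inter> snd c ` (V \<inter> fst c)" if "c \<in> A" for c
      using inj_chart[OF that] unfolding inj_on_def by blast
    then have "open (snd c ` (U \<inter> V \<inter> fst c))" if "c \<in> A" for c
      using U V that by (metis open_Int)
    then show "?P (U \<inter> V)" using U by blast
  next
    fix \<K> assume K: "\<forall>K\<in>\<K>. ?P K"
    have "open (\<Union>K\<in>\<K>. snd c ` (K \<inter> fst c))" if "c \<in> A" for c
      using K that by (intro open_UN) blast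
    moreover have "(\<Union>K\<in>\<K>. snd c ` (K \<inter> fst c)) = snd c ` (\<Union>\<K> \<inter> fst c)" for c :: "('a, 'e) chart"
      by blast
    ultimately have "open (snd c ` (\<Union>\<K> \<inter> fst c))" if "c \<in> A" for c
      using that by metis
    moreover have "\<Union>\<K> \<subseteq> carrier_of A" using K by blast
    ultimately show "?P (\<Union>\<K>)" by blast
  qed
  then show ?thesis unfolding manifold_topology_def by (simp only: topology_inverse')
qed

text \<open>A closed ball in the chart corresponds to a compact set \<open>?K\<close>, which is
  closed because the manifold is Hausdorff. Hence the Euclidean bump function, extended by zero,
  vanishes on the open complement of \<open>?K\<close>, which contains all points outside the chart
  domain.\<close>

lemma bump_atlas_smooth_manifold:
  fixes A :: "('a, 'e::{real_inner, heine_borel}) chart set"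
  assumes "smooth_manifold A"
  shows "bump_atlas A"
proof -
  interpret atlas A
    using assms unfolding smooth_manifold_def by (intro atlas.intro) blast+
  let ?X = "manifold_topology A"
  have top: "topspace ?X = carrier_of A"
  proof -
    have "fst c \<subseteq> carrier_of A" if "c \<in> A" for c using that by (auto simp: carrier_of_def)
    then have "openin ?X (carrier_of A)"
      unfolding openin_manifold_topology using open_chart by (simp add: Int_absorb1)
    then have "carrier_of A \<subseteq> topspace ?X" by (rule openin_subset)
    moreover have "topspace ?X \<subseteq> carrier_of A"
      using openin_topspace[of ?X] unfolding openin_manifold_topology by blast
    ultimately show ?thesis by blast
  qed
  show ?thesis
  proof (unfold_locales)
    fix c p assume c: "c \<in> A" "p \<in> fst c"
    let ?S = "snd c ` fst c"
    obtain e where e: "e > 0" "cball (snd c p) e \<subseteq> ?S"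
      using open_chart[OF c(1)] c(2) open_contains_cball by (metis imageI)
    obtain \<beta> :: "'e \<Rightarrow> real" where \<beta>: "smooth_on UNIV \<beta>" "\<beta> (snd c p) = 1"
      "\<And>y. y \<notin> cball (snd c p) e \<Longrightarrow> \<beta> y = 0"
      using smooth_bump_exists[OF e(1)] by metis
    let ?K = "chart_inv c ` cball (snd c p) e"
    have "continuous_map (top_of_set ?S) ?X (chart_inv c)"
      unfolding continuous_map_def
    proof (intro conjI allI impI)
      show "chart_inv c \<in> topspace (top_of_set ?S) \<rightarrow> topspace ?X"
        using c by (auto simp: top carrier_of_def)
      fix U assume "openin ?X U"
      then have "open (snd c ` (U \<inter> fst c))" using c by (simp add: openin_manifold_topology)
      moreover have "{x \<in> topspace (top_of_set ?S). chart_inv c x \<in> U} = snd c ` (U \<inter> fst c)"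
        using c by auto
      ultimately show "openin (top_of_set ?S) {x \<in> topspace (top_of_set ?S). chart_inv c x \<in> U}"
        by (metis (no_types, lifting) Int_lower2 image_mono open_subset)
    qed
    moreover have "compactin (top_of_set ?S) (cball (snd c p) e)"
      using e(2) by (simp add: compactin_subtopology)
    ultimately have "compactin ?X ?K" by (rule image_compactin[rotated])
    then have "closedin ?X ?K"
      using assms compactin_imp_closedin unfolding smooth_manifold_def by blast
    then have "openin ?X (carrier_of A - ?K)" using top by (metis closedin_def)
    then have W: "open (snd d ` ((carrier_of A - ?K) \<inter> fst d))" if "d \<in> A" for d
      using that by (simp add: openin_manifold_topology)
    define h where "h q = (if q \<in> fst c then \<beta> (snd c q) else 0)" for q
    have h0: "h q = 0" if "q \<notin> ?K" for q
    proof (cases "q \<in> fst c")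
      case True
      then have "snd c q \<notin> cball (snd c p) e"
        using that c(1) chart_inv_chart[OF c(1) True] by (metis imageI)
      then show ?thesis using \<beta>(3) by (simp add: h_def)
    qed (simp add: h_def)
    have Kc: "?K \<subseteq> fst c" using e(2) c by auto
    have 1: "\<exists>N. open N \<and> x \<in> N \<and> (\<forall>y\<in>N. h (chart_inv d y) = 0)"
      if d: "d \<in> A" and x: "x \<in> snd d ` (fst d - fst c)" for d x
    proof (intro exI conjI ballI)
      show "x \<in> snd d ` ((carrier_of A - ?K) \<inter> fst d)"
        using x Kc d by (auto simp: carrier_of_def)
      show "h (chart_inv d y) = 0" if "y \<in> snd d ` ((carrier_of A - ?K) \<inter> fst d)" for y
        using that d h0 by auto
    qed (rule W[OF d])
    have "smooth_on (snd d ` fst d) (h \<circ> chart_inv d)" if d: "d \<in> A" for d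
    proof (rule smooth_on_local)
      fix x assume x: "x \<in> snd d ` fst d"
      show "\<exists>T. open T \<and> x \<in> T \<and> smooth_on T (h \<circ> chart_inv d)"
      proof (cases "x \<in> snd d ` (fst d \<inter> fst c)")
        case True
        have o: "open (snd d ` (fst d \<inter> fst c))" by (rule open_overlap[OF d c(1)])
        have "smooth_on (snd d ` (fst d \<inter> fst c)) (\<lambda>x. \<beta> (trans_map d c x))"
          by (rule smooth_on_compose[OF \<beta>(1) smooth_trans[OF d c(1)] o]) auto
        then have "smooth_on (snd d ` (fst d \<inter> fst c)) (h \<circ> chart_inv d)"
          by (rule smooth_on_cong[OF o]) (use d in \<open>auto simp: h_def\<close>)
        then show ?thesis using o True by blast
      next
        case False
        then have "x \<in> snd d ` (fst d - fst c)" using x by auto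
        from 1[OF d this] obtain N where N: "open N" "x \<in> N" "\<forall>y\<in>N. h (chart_inv d y) = 0" by blast
        have "smooth_on N (h \<circ> chart_inv d)"
          by (rule smooth_on_cong[OF N(1) smooth_on_const[OF N(1), of 0]]) (use N(3) in auto)
        then show ?thesis using N by blast
      qed
    qed
    then have "h \<in> smooth_functions A" by (simp add: smooth_functions_def)
    moreover have "h p = 1" using c \<beta>(2) by (simp add: h_def)
    ultimately have "bump_at A c p h"
      unfolding bump_at_def using 1 by (meson IntD1)
    then show "\<exists>h. bump_at A c p h" by blast
  qed
qed

section \<open>The tangent bundle\<close>

context atlas
begin

abbreviation TC where "TC \<equiv> tangent_chart A"
abbreviation TA where "TA \<equiv> tangent_bundle A"

lemma fst_TC: "fst (TC c) = {(p, v). p \<in> fst c \<and> v \<in> tangent_space A p}"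
  by (simp add: tangent_chart_def)

lemma snd_TC: "snd (TC c) (p, v) = (snd c p, v c)"
  by (simp add: tangent_chart_def)

text \<open>The domain of the chart is recovered by projection, as each fibre contains the zero
  vector. Injectivity is what makes \<open>base_chart\<close> return the chart one started
  from.\<close>

lemma TC_inj: "TC c = TC d \<Longrightarrow> c = d"
proof (rule prod_eqI)
  assume eq: "TC c = TC d"
  have "fst c = fst ` fst (TC c)" for c
    using zero_tangent by (force simp: fst_TC)
  then show "fst c = fst d" using eq by metis
  show "snd c = snd d" using eq snd_TC by (metis ext prod.inject)
qed

lemma base_chart_TC [simp]: "c \<in> A \<Longrightarrow> base_chart A (TC c) = c"
  by (simp add: base_chart_def inj_on_def TC_inj)

lemma charts_at_TA:
  "C \<in> charts_at TA (p, v) \<longleftrightarrow> v \<in> tangent_space A p \<and> (\<exists>c\<in>charts_at A p. C = TC c)"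
  by (auto simp: charts_at_def tangent_bundle_def fst_TC)

lemma TC_charts_at: "v \<in> tangent_space A p \<Longrightarrow> c \<in> charts_at A p \<Longrightarrow> TC c \<in> charts_at TA (p, v)"
  using charts_at_TA by blast

lemma TC_image: 
  assumes "c \<in> A" "d \<in> A"
  shows "snd (TC c) ` (fst (TC c) \<inter> fst (TC d)) = snd c ` (fst c \<inter> fst d) \<times> UNIV"
proof (intro equalityI subsetI)
  fix z assume "z \<in> snd c ` (fst c \<inter> fst d) \<times> (UNIV :: 'e set)"
  then obtain p u where p: "p \<in> fst c" "p \<in> fst d" "z = (snd c p, u)" by auto
  have c: "c \<in> charts_at A p" using p assms by (simp add: charts_at_iff)
  have "z = snd (TC c) (p, extend_tvec A p c u)"
    using p c by (simp add: snd_TC extend_tvec_self)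
  moreover have "(p, extend_tvec A p c u) \<in> fst (TC c) \<inter> fst (TC d)"
    using p extend_tvec_tangent[OF c] by (simp add: fst_TC)
  ultimately show "z \<in> snd (TC c) ` (fst (TC c) \<inter> fst (TC d))" by blast
qed (auto simp: fst_TC snd_TC)

lemma TC_image_self: "c \<in> A \<Longrightarrow> snd (TC c) ` fst (TC c) = snd c ` fst c \<times> UNIV"
  using TC_image[of c c] by simp

lemma TC_inj_on: "c \<in> A \<Longrightarrow> inj_on (snd (TC c)) (fst (TC c))"
proof (rule inj_onI)
  fix q q' assume c: "c \<in> A" and q: "q \<in> fst (TC c)" "q' \<in> fst (TC c)" "snd (TC c) q = snd (TC c) q'"
  obtain p v p' v' where *: "q = (p, v)" "q' = (p', v')" by (cases q, cases q')
  have pp: "p \<in> fst c" "p' \<in> fst c" "v \<in> tangent_space A p" "v' \<in> tangent_space A p'"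
    "snd c p = snd c p'" "v c = v' c"
    using q by (auto simp: * fst_TC snd_TC)
  then have "p = p'" using inj_chart[OF c] by (auto simp: inj_on_def)
  moreover have "v = v'"
    using pp extend_tvec_tangent_space[of v p c] extend_tvec_tangent_space[of v' p c] \<open>p = p'\<close> c
    by (simp add: charts_at_iff)
  ultimately show "q = q'" by (simp add: *)
qed

lemma chart_inv_TC:
  assumes "c \<in> A" "x \<in> snd c ` fst c"
  shows "chart_inv (TC c) (x, u) = (chart_inv c x, extend_tvec A (chart_inv c x) c u)"
proof -
  have c: "c \<in> charts_at A (chart_inv c x)"
    using assms by (simp add: charts_at_iff chart_inv_mem)
  have "(chart_inv c x, extend_tvec A (chart_inv c x) c u) \<in> fst (TC c)"
    using c extend_tvec_tangent[OF c] by (simp add: fst_TC charts_at_iff)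
  moreover have "snd (TC c) (chart_inv c x, extend_tvec A (chart_inv c x) c u) = (x, u)"
    using assms c by (simp add: snd_TC extend_tvec_self chart_chart_inv)
  ultimately show ?thesis
    unfolding chart_inv_def[of "TC c"] using inv_into_f_f[OF TC_inj_on[OF assms(1)]] by metis
qed

lemma trans_map_TC:
  assumes A: "c \<in> A" "d \<in> A" and x: "x \<in> snd c ` (fst c \<inter> fst d)"
  shows "trans_map (TC c) (TC d) (x, u) = (trans_map c d x, jac c d x u)"
proof -
  have "chart_inv c x \<in> fst d" "snd c (chart_inv c x) = x" "x \<in> snd c ` fst c"
    using chart_inv_overlap[OF A(1) x] x by auto
  then show ?thesis using A
    by (simp add: trans_map_def chart_inv_TC snd_TC extend_tvec_def charts_at_iff)
qed

text \<open>The second derivative of the transition map, the term that distinguishes changes of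
  charts on \<open>TM\<close> from those on \<open>M\<close>.\<close>

definition hess where
  "hess c d x u v = frechet_derivative (\<lambda>y. frechet_derivative (trans_map c d) (at y) u) (at x) v"

lemma has_derivative_jac:
  assumes A: "c \<in> A" "d \<in> A" and x: "x \<in> snd c ` (fst c \<inter> fst d)"
  shows "((\<lambda>y. jac c d y u) has_derivative hess c d x u) (at x)"
proof -
  have "((\<lambda>y. frechet_derivative (trans_map c d) (at y) u) has_derivative hess c d x u) (at x)"
    unfolding hess_def[abs_def]
    by (rule smooth_on_has_derivative[OF smooth_on_derivative_dir[OF smooth_trans[OF A]] x])
  then show ?thesis
    by (rule has_derivative_transform_within_open[OF _ open_overlap[OF A] x]) (simp add: jac_apply[OF A])
qed

lemma hess_symmetric:
  assumes A: "c \<in> A" "d \<in> A" and x: "x \<in> snd c ` (fst c \<inter> fst d)"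
  shows "hess c d x u v = hess c d x v u"
  unfolding hess_def by (rule second_derivative_symmetric[OF smooth_trans[OF A] open_overlap[OF A] x])

text \<open>The derivative is block triangular: horizontal components transform like tangent vectors
  of \<open>M\<close>, while vertical ones acquire a Hessian term.\<close>

lemma has_derivative_trans_TC:
  assumes A: "c \<in> A" "d \<in> A" and x: "x \<in> snd c ` (fst c \<inter> fst d)"
  shows "(trans_map (TC c) (TC d) has_derivative
     (\<lambda>h. (jac c d x (fst h), hess c d x u (fst h) + jac c d x (snd h)))) (at (x, u))"
proof -
  let ?S = "snd c ` (fst c \<inter> fst d)"
  have 1: "((\<lambda>z. trans_map c d (fst z)) has_derivative (\<lambda>h. jac c d x (fst h))) (at (x, u))"
    using has_derivative_compose[OF bounded_linear_imp_has_derivative[OF bounded_linear_fst],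
        where g="trans_map c d" and x="(x, u)"] has_derivative_trans[OF A x] by simp
  have "((\<lambda>z. frechet_derivative (trans_map c d) (at (fst z)) (snd z)) has_derivative
     (\<lambda>h. hess c d x u (fst h) + jac c d x (snd h))) (at (x, u))"
    unfolding hess_def jac_apply[OF A x]
    by (rule has_derivative_frechet_pair[OF smooth_trans[OF A] open_overlap[OF A] x])
  from has_derivative_Pair[OF 1 this] show ?thesis
    by (rule has_derivative_transform_within_open[where s="?S \<times> UNIV"])
      (use x open_overlap[OF A] trans_map_TC[OF A] jac_apply[OF A] in \<open>auto intro: open_Times\<close>)
qed

lemma smooth_trans_TC:
  assumes A: "c \<in> A" "d \<in> A"
  shows "smooth_on (snd c ` (fst c \<inter> fst d) \<times> UNIV) (trans_map (TC c) (TC d))"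
proof -
  let ?S = "snd c ` (fst c \<inter> fst d)"
  have o: "open ?S" by (rule open_overlap[OF A])
  have o2: "open (?S \<times> (UNIV :: 'e set))" by (simp add: o open_Times)
  have "smooth_on (?S \<times> UNIV) (\<lambda>z. (trans_map c d (fst z), frechet_derivative (trans_map c d) (at (fst z)) (snd z)))"
    by (intro smooth_on_Pair o2 o smooth_on_derivative[OF smooth_trans[OF A]] smooth_on_compose[OF smooth_trans[OF A]]
        smooth_on_fst smooth_on_snd smooth_on_ident) auto
  then show ?thesis
    by (rule smooth_on_cong[OF o2]) (use trans_map_TC[OF A] jac_apply[OF A] in auto)
qed

lemma atlas_tangent_bundle: "atlas TA"
proof
  fix C D assume "C \<in> TA" "D \<in> TA"
  then obtain c d where c: "c \<in> A" "C = TC c" and d: "d \<in> A" "D = TC d" by (auto simp: tangent_bundle_def)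
  show "inj_on (snd C) (fst C)" using TC_inj_on c by simp
  show "open (snd C ` fst C)" using TC_image_self c open_chart by (simp add: open_Times)
  show "open (snd C ` (fst C \<inter> fst D))" using TC_image c d open_overlap by (simp add: open_Times)
  show "smooth_on (snd C ` (fst C \<inter> fst D)) (trans_map C D)"
    using smooth_trans_TC TC_image c d by simp
qed

lemma jac_TC:
  assumes "c \<in> charts_at A p" "d \<in> charts_at A p" "v \<in> tangent_space A p"
  shows "jac (TC c) (TC d) (snd c p, v c) h =
     (jac c d (snd c p) (fst h), hess c d (snd c p) (v c) (fst h) + jac c d (snd c p) (snd h))"
proof -
  interpret T: atlas TA by (rule atlas_tangent_bundle)
  have A: "c \<in> A" "d \<in> A" "p \<in> fst c" "p \<in> fst d" using assms by (auto simp: charts_at_iff)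
  have "blinfun_apply (jac (TC c) (TC d) (snd c p, v c)) = frechet_derivative (trans_map (TC c) (TC d)) (at (snd c p, v c))"
    using A by (intro T.jac_apply) (auto simp: tangent_bundle_def TC_image)
  also have "\<dots> = (\<lambda>h. (jac c d (snd c p) (fst h), hess c d (snd c p) (v c) (fst h) + jac c d (snd c p) (snd h)))"
    using A by (intro frechet_derivative_eqI has_derivative_trans_TC) auto
  finally show ?thesis by simp
qed

lemma carrier_TA: "(p, v) \<in> carrier_of TA \<longleftrightarrow> p \<in> carrier_of A \<and> v \<in> tangent_space A p"
  by (auto simp: carrier_of_def tangent_bundle_def fst_TC)

end

text \<open>A bump function on \<open>M\<close> composed with the projection is supported over the
  domain of \<open>c\<close>, and everything over that domain belongs to the induced chart.\<close>

lemma (in bump_atlas) bump_atlas_tangent_bundle: "bump_atlas TA"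
proof -
  interpret T: atlas TA by (rule atlas_tangent_bundle)
  show ?thesis
  proof
    fix C q assume C: "C \<in> TA" "q \<in> fst C"
    then obtain c p v where c: "c \<in> A" "C = TC c" "q = (p, v)" "p \<in> fst c"
      by (cases q) (auto simp: tangent_bundle_def fst_TC)
    obtain h where h: "bump_at A c p h" using bump_exists c by blast
    have hd: "smooth_on (snd d ` fst d) (\<lambda>x. h (chart_inv d x))" if "d \<in> A" for d
      using h that by (auto simp: bump_at_def smooth_functions_def o_def)
    have "smooth_on (snd d ` fst d \<times> UNIV) ((h \<circ> fst) \<circ> chart_inv (TC d))" if d: "d \<in> A" for d
    proof -
      have o: "open (snd d ` fst d \<times> (UNIV :: 'e set))" using open_chart[OF d] by (simp add: open_Times)
      have "smooth_on (snd d ` fst d \<times> (UNIV :: 'e set)) (\<lambda>z. h (chart_inv d (fst z)))"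
        by (rule smooth_on_compose[OF hd[OF d]]) (use o open_chart[OF d] in \<open>auto intro: smooth_on_fst smooth_on_ident\<close>)
      then show ?thesis
        by (rule smooth_on_cong[OF o]) (use chart_inv_TC[OF d] in auto)
    qed
    then have "h \<circ> fst \<in> smooth_functions TA"
      by (auto simp: smooth_functions_def tangent_bundle_def TC_image_self)
    moreover have "\<exists>N. open N \<and> z \<in> N \<and> (\<forall>y\<in>N \<inter> snd D ` fst D. (h \<circ> fst) (chart_inv D y) = 0)"
      if D: "D \<in> TA" and z: "z \<in> snd D ` (fst D - fst C)" for D z
    proof -
      obtain d where d: "d \<in> A" "D = TC d" using D by (auto simp: tangent_bundle_def)
      have "fst z \<in> snd d ` (fst d - fst c)" using z by (auto simp: d c fst_TC snd_TC)
      then obtain N where N: "open N" "fst z \<in> N" "\<forall>y\<in>N \<inter> snd d ` fst d. h (chart_inv d y) = 0"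
        using h d(1) unfolding bump_at_def by blast
      show ?thesis
      proof (intro exI conjI ballI)
        show "open (N \<times> (UNIV :: 'e set))" using N(1) by (simp add: open_Times)
        show "z \<in> N \<times> UNIV" using N(2) by (cases z) auto
        show "(h \<circ> fst) (chart_inv D y) = 0" if "y \<in> N \<times> UNIV \<inter> snd D ` fst D" for y
          using that N(3) chart_inv_TC[OF d(1)] unfolding d TC_image_self[OF d(1)] by (cases y) auto
      qed
    qed
    ultimately show "\<exists>h. bump_at TA C q h"
      using h c by (intro exI[of _ "h \<circ> fst"]) (simp add: bump_at_def)
  qed
qed

section \<open>Multivector fields\<close>

lemma of_vector_field_vec1: "of_vector_field Y p c = vec1 (Y p c)"
  by (simp add: of_vector_field_def vec1_def)

context atlas
begin

lemma mvfI:
  assumes "\<And>p c. c \<notin> charts_at A p \<Longrightarrow> w p c = (\<lambda>_. 0)"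
    and "\<And>p c. c \<in> charts_at A p \<Longrightarrow> w p c \<in> exterior_algebra"
    and "\<And>p c d. c \<in> charts_at A p \<Longrightarrow> d \<in> charts_at A p \<Longrightarrow> w p d = push (jac c d (snd c p)) (w p c)"
    and "\<And>c xs. c \<in> A \<Longrightarrow> smooth_on (snd c ` fst c) (\<lambda>x. w (chart_inv c x) c xs)"
  shows "w \<in> multivector_fields A"
proof -
  have "w p c \<in> exterior_algebra" for p c
    using assms(1,2) exterior_zero by (cases "c \<in> charts_at A p") auto
  then have "w p \<in> multivectors_at A p" for p
    unfolding multivectors_at_iff using assms(1,3) by blast
  then show ?thesis using assms(4) by (simp add: multivector_fields_def)
qed

lemma mvfD:
  assumes "w \<in> multivector_fields A"
  shows "w p c \<in> exterior_algebra"
    and "c \<notin> charts_at A p \<Longrightarrow> w p c = (\<lambda>_. 0)"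
    and "c \<in> charts_at A p \<Longrightarrow> d \<in> charts_at A p \<Longrightarrow> w p d = push (jac c d (snd c p)) (w p c)"
    and "c \<in> A \<Longrightarrow> smooth_on (snd c ` fst c) (\<lambda>x. w (chart_inv c x) c xs)"
proof -
  have *: "w p \<in> multivectors_at A p" using assms by (simp add: multivector_fields_def)
  show "w p c \<in> exterior_algebra"
    "c \<notin> charts_at A p \<Longrightarrow> w p c = (\<lambda>_. 0)"
    "c \<in> charts_at A p \<Longrightarrow> d \<in> charts_at A p \<Longrightarrow> w p d = push (jac c d (snd c p)) (w p c)"
    using * unfolding multivectors_at_iff by blast+
  show "c \<in> A \<Longrightarrow> smooth_on (snd c ` fst c) (\<lambda>x. w (chart_inv c x) c xs)"
    using assms by (simp add: multivector_fields_def)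
qed

lemma of_function_scalar:
  "of_function A f p c = (if c \<in> charts_at A p then scalar (f p) else (\<lambda>_. 0))"
  by (auto simp: of_function_def scalar_def)

lemma chart_at_chart_inv: "c \<in> A \<Longrightarrow> x \<in> snd c ` fst c \<Longrightarrow> c \<in> charts_at A (chart_inv c x)"
  by (auto simp: charts_at_iff)

lemma mv_lincomb_mvf:
  assumes v: "v \<in> multivector_fields A" and w: "w \<in> multivector_fields A"
  shows "mv_lincomb a v b w \<in> multivector_fields A"
proof (rule mvfI)
  fix c xs assume "c \<in> A"
  then show "smooth_on (snd c ` fst c) (\<lambda>x. mv_lincomb a v b w (chart_inv c x) c xs)"
    unfolding mv_lincomb_def
    by (intro smooth_on_add smooth_on_mult smooth_on_const open_chart mvfD v w)
next
  fix p c d assume "c \<in> charts_at A p" "d \<in> charts_at A p"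
  from mvfD(3)[OF v this] mvfD(3)[OF w this]
  show "mv_lincomb a v b w p d = push (jac c d (snd c p)) (mv_lincomb a v b w p c)"
    by (simp add: mv_lincomb_def push_def)
qed (simp_all add: mv_lincomb_def mvfD(2)[OF v] mvfD(2)[OF w] mvfD(1)[OF v] mvfD(1)[OF w]
    exterior_lincomb)

lemma mv_wedge_mvf:
  assumes v: "v \<in> multivector_fields A" and w: "w \<in> multivector_fields A"
  shows "mv_wedge v w \<in> multivector_fields A"
proof (rule mvfI)
  fix c xs assume "c \<in> A"
  then show "smooth_on (snd c ` fst c) (\<lambda>x. mv_wedge v w (chart_inv c x) c xs)"
    unfolding mv_wedge_def wedge_def
    by (intro smooth_on_sum smooth_on_mult smooth_on_const open_chart mvfD v w)
next
  fix p c d assume "c \<in> charts_at A p" "d \<in> charts_at A p"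
  from mvfD(3)[OF v this] mvfD(3)[OF w this]
  show "mv_wedge v w p d = push (jac c d (snd c p)) (mv_wedge v w p c)"
    by (simp add: mv_wedge_def push_wedge)
qed (simp_all add: mv_wedge_def mvfD(2)[OF v] mvfD(1)[OF v] mvfD(1)[OF w] exterior_wedge)

lemma of_function_mvf:
  assumes "f \<in> smooth_functions A"
  shows "of_function A f \<in> multivector_fields A"
proof (rule mvfI)
  fix c :: "('a, 'e) chart" and xs :: "('e \<Rightarrow>\<^sub>L real) list" assume c: "c \<in> A"
  have "smooth_on (snd c ` fst c) (\<lambda>x. if xs = [] then f (chart_inv c x) else 0)"
    using assms c by (cases "xs = []") (auto simp: smooth_functions_def o_def intro: smooth_on_const open_chart)
  then show "smooth_on (snd c ` fst c) (\<lambda>x. of_function A f (chart_inv c x) c xs)"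
    by (rule smooth_on_cong[OF open_chart[OF c]]) (simp add: of_function_def chart_at_chart_inv[OF c])
qed (simp_all add: of_function_scalar exterior_scalar push_scalar)

lemma vector_fieldsD:
  assumes "Y \<in> vector_fields A"
  shows "Y p \<in> tangent_space A p"
    and "c \<in> A \<Longrightarrow> smooth_on (snd c ` fst c) (vector_rep c Y)"
  using assms by (simp_all add: vector_fields_def)

lemma of_vector_field_mvf:
  assumes Y: "Y \<in> vector_fields A"
  shows "of_vector_field Y \<in> multivector_fields A"
proof (rule mvfI)
  fix p c assume "c \<notin> charts_at A p"
  then have "Y p c = 0" using tangent_space_outside[OF vector_fieldsD(1)[OF Y]] by blast
  then show "of_vector_field Y p c = (\<lambda>_. 0)"
    by (auto simp: of_vector_field_def blinfun.zero_right split: list.splits)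
next
  fix p c d assume "c \<in> charts_at A p" "d \<in> charts_at A p"
  from tangent_spaceD[OF vector_fieldsD(1)[OF Y] this]
  show "of_vector_field Y p d = push (jac c d (snd c p)) (of_vector_field Y p c)"
    by (simp add: of_vector_field_vec1 push_vec1)
next
  fix c xs assume c: "c \<in> A"
  show "smooth_on (snd c ` fst c) (\<lambda>x. of_vector_field Y (chart_inv c x) c xs)"
  proof (cases "\<exists>\<xi>. xs = [\<xi>]")
    case True
    then obtain \<xi> where "xs = [\<xi>]" by blast
    then have "(\<lambda>x. of_vector_field Y (chart_inv c x) c xs) = (\<lambda>x. \<xi> (vector_rep c Y x))"
      by (simp add: of_vector_field_def vector_rep_def)
    then show ?thesis
      using smooth_on_bounded_linear[OF blinfun.bounded_linear_right open_chart[OF c] vector_fieldsD(2)[OF Y c]]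
      by simp
  next
    case False
    then have "(\<lambda>x. of_vector_field Y (chart_inv c x) c xs) = (\<lambda>x. 0)"
      by (auto simp: of_vector_field_def split: list.splits)
    then show ?thesis using smooth_on_const[OF open_chart[OF c]] by simp
  qed
qed (simp add: of_vector_field_vec1 exterior_vec1)

lemma mvf_restrict_degree:
  assumes w: "w \<in> multivector_fields A"
  shows "(\<lambda>p c xs. if length xs = r then w p c xs else 0) \<in> multivector_fields_deg r A"
proof -
  have "(\<lambda>p c xs. if length xs = r then w p c xs else 0) \<in> multivector_fields A"
  proof (rule mvfI)
    fix c :: "('a, 'e) chart" and xs :: "('e \<Rightarrow>\<^sub>L real) list" assume "c \<in> A"
    then show "smooth_on (snd c ` fst c) (\<lambda>x. if length xs = r then w (chart_inv c x) c xs else 0)"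
      by (cases "length xs = r") (simp_all add: mvfD(4)[OF w] smooth_on_const open_chart)
  next
    fix p c d assume "c \<in> charts_at A p" "d \<in> charts_at A p"
    from mvfD(3)[OF w this]
    show "(\<lambda>xs. if length xs = r then w p d xs else 0) =
      push (jac c d (snd c p)) (\<lambda>xs. if length xs = r then w p c xs else 0)"
      by (auto simp: push_def)
  qed (auto simp: mvfD(2)[OF w] exterior_restrict_degree[OF mvfD(1)[OF w]])
  then show ?thesis by (simp add: multivector_fields_deg_def)
qed

text \<open>Degrees above the dimension vanish, so finitely many suffice. The factors
  \<open>1 *\<close> give the sum the shape required by \<open>mv_linear_sum\<close>.\<close>

lemma mvf_degree_expand:
  assumes w: "w \<in> multivector_fields A"
  shows "(\<lambda>p c xs. \<Sum>r\<in>{..card (onb :: 'e set)}. 1 * (if length xs = r then w p c xs else 0)) = w"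
proof (intro ext)
  fix p c xs
  show "(\<Sum>r\<in>{..card (onb :: 'e set)}. 1 * (if length xs = r then w p c xs else 0)) = w p c xs"
    using exterior_above_dimension[OF mvfD(1)[OF w], of xs p c]
    by (cases "length xs \<le> card (onb :: 'e set)") simp_all
qed

lemma mv_sum_mvf:
  assumes "finite I" "\<And>i. i \<in> I \<Longrightarrow> W i \<in> multivector_fields A"
  shows "(\<lambda>p c xs. \<Sum>i\<in>I. k i * W i p c xs) \<in> multivector_fields A"
  using assms
proof (induction I)
  case empty
  have "(\<lambda>p c xs. 0) \<in> multivector_fields A"
    by (rule mvfI) (auto simp: exterior_zero push_zero intro: smooth_on_const open_chart)
  then show ?case by simp
next
  case (insert i I)
  then have "mv_lincomb (k i) (W i) 1 (\<lambda>p c xs. \<Sum>i\<in>I. k i * W i p c xs) \<in> multivector_fields A"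
    by (intro mv_lincomb_mvf) auto
  then show ?case using insert by (simp add: mv_lincomb_def)
qed

lemma mv_linear_lincomb:
  "\<lbrakk>mv_linear A B F; v \<in> multivector_fields A; w \<in> multivector_fields A\<rbrakk>
    \<Longrightarrow> F (mv_lincomb a v b w) = mv_lincomb a (F v) b (F w)"
  unfolding mv_linear_def by blast

lemma mv_linear_sum:
  assumes F: "mv_linear A B F" and I: "finite I" "I \<noteq> {}"
    and W: "\<And>i. i \<in> I \<Longrightarrow> W i \<in> multivector_fields A"
  shows "F (\<lambda>p c xs. \<Sum>i\<in>I. k i * W i p c xs) = (\<lambda>p c xs. \<Sum>i\<in>I. k i * F (W i) p c xs)"
  using I W
proof (induction I rule: finite_ne_induct)
  case (singleton i)
  have "F (mv_lincomb (k i) (W i) 0 (W i)) = mv_lincomb (k i) (F (W i)) 0 (F (W i))"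
    by (intro mv_linear_lincomb[OF F] singleton) simp_all
  then show ?case by (simp add: mv_lincomb_def)
next
  case (insert i I)
  have "F (mv_lincomb (k i) (W i) 1 (\<lambda>p c xs. \<Sum>i\<in>I. k i * W i p c xs)) =
     mv_lincomb (k i) (F (W i)) 1 (F (\<lambda>p c xs. \<Sum>i\<in>I. k i * W i p c xs))"
    by (intro mv_linear_lincomb[OF F] mv_sum_mvf insert) simp_all
  also have "F (\<lambda>p c xs. \<Sum>i\<in>I. k i * W i p c xs) = (\<lambda>p c xs. \<Sum>i\<in>I. k i * F (W i) p c xs)"
    by (intro insert.IH insert.prems) simp
  finally show ?case using insert.hyps by (simp add: mv_lincomb_def)
qed

section \<open>Global fields from local data\<close>

text \<open>Here \<open>w\<close> is a family of multivectors in the coordinates of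
  \<open>c\<close>. Operators act on global fields only, so local data have to be put into this form
  before an operator can be applied.\<close>

definition extend_mv where
  "extend_mv h c w = (\<lambda>p d. if d \<in> charts_at A p \<and> p \<in> fst c
     then (\<lambda>xs. h p * push (jac c d (snd c p)) (w (snd c p)) xs) else (\<lambda>_. 0))"

definition extend_vector where
  "extend_vector h c e = (\<lambda>p d. if d \<in> charts_at A p \<and> p \<in> fst c
     then h p *\<^sub>R jac c d (snd c p) e else (0 :: 'e))"

lemma smooth_jac_trans:
  assumes A: "c \<in> A" "d \<in> A"
  shows "smooth_on (snd d ` (fst d \<inter> fst c)) (\<lambda>x. jac c d (trans_map d c x) y)"
  by (rule smooth_on_compose[OF smooth_jac[OF A] smooth_trans[OF A(2,1)] open_overlap[OF A(2,1)] open_overlap[OF A]])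
    (use A in auto)

lemma extend_mv_mvf:
  assumes h: "bump_at A c p0 h" and c: "c \<in> A"
    and w: "\<And>x. w x \<in> exterior_algebra" "\<And>xs. smooth_on (snd c ` fst c) (\<lambda>x. w x xs)"
  shows "extend_mv h c w \<in> multivector_fields A"
proof (rule mvfI)
  fix p d assume "d \<notin> charts_at A p"
  then show "extend_mv h c w p d = (\<lambda>_. 0)" by (simp add: extend_mv_def)
next
  fix p d assume "d \<in> charts_at A p"
  then show "extend_mv h c w p d \<in> exterior_algebra"
    by (simp add: extend_mv_def exterior_zero exterior_scale exterior_push w)
next
  fix p d e assume d: "d \<in> charts_at A p" "e \<in> charts_at A p"
  show "extend_mv h c w p e = push (jac d e (snd d p)) (extend_mv h c w p d)"
  proof (cases "p \<in> fst c")
    case True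
    then have "jac d e (snd d p) o\<^sub>L jac c d (snd c p) = jac c e (snd c p)"
      using c d by (intro jac_compose) (auto simp: charts_at_iff)
    then show ?thesis using d True
      by (simp add: extend_mv_def push_scale push_push)
  qed (simp add: extend_mv_def push_zero)
next
  fix d xs assume d: "d \<in> A"
  let ?S = "snd d ` (fst d \<inter> fst c)"
  have o: "open ?S" by (rule open_overlap[OF d c])
  have "smooth_on ?S (\<lambda>x. w (trans_map d c x) (map (\<lambda>\<xi>. \<xi> o\<^sub>L jac c d (trans_map d c x)) xs))"
  proof (rule smooth_on_exterior[OF o w(1)])
    show "smooth_on ?S (\<lambda>z. w (trans_map d c z) ys)" for ys
      by (rule smooth_on_compose[OF w(2) smooth_trans[OF d c] o open_chart[OF c]]) (use d in auto)
    show "smooth_on ?S (\<lambda>z. (\<xi> o\<^sub>L jac c d (trans_map d c z)) y)" for \<xi> :: "'e \<Rightarrow>\<^sub>L real" and y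
      using smooth_on_bounded_linear[OF blinfun.bounded_linear_right o smooth_jac_trans[OF c d]] by simp
  qed
  then show "smooth_on (snd d ` fst d) (\<lambda>x. extend_mv h c w (chart_inv d x) d xs)"
    by (rule smooth_on_extend_bump[OF h c d])
      (use d in \<open>auto simp: extend_mv_def charts_at_iff push_def\<close>)
qed

lemma extend_vector_vector_fields:
  assumes h: "bump_at A c p0 h" and c: "c \<in> A"
  shows "extend_vector h c e \<in> vector_fields A"
proof -
  have "extend_vector h c e p \<in> tangent_space A p" for p
    unfolding tangent_space_iff
  proof (intro conjI ballI allI impI)
    fix d d' assume d: "d \<in> charts_at A p" "d' \<in> charts_at A p"
    show "extend_vector h c e p d' = jac d d' (snd d p) (extend_vector h c e p d)"
    proof (cases "p \<in> fst c")
      case True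
      then have "jac d d' (snd d p) o\<^sub>L jac c d (snd c p) = jac c d' (snd c p)"
        using c d by (intro jac_compose) (auto simp: charts_at_iff)
      from arg_cong[OF this, of "\<lambda>T. T e"] show ?thesis using d True
        by (simp add: extend_vector_def blinfun.scaleR_right)
    qed (simp add: extend_vector_def blinfun.zero_right)
  qed (simp add: extend_vector_def)
  moreover have "smooth_on (snd d ` fst d) (vector_rep d (extend_vector h c e))" if d: "d \<in> A" for d
    by (rule smooth_on_extend_bump[OF h c d smooth_jac_trans[OF c d]])
      (use d in \<open>auto simp: extend_vector_def vector_rep_def charts_at_iff\<close>)
  ultimately show ?thesis by (simp add: vector_fields_def)
qed

lemma mv_wedge_of_function:
  "w \<in> multivector_fields A \<Longrightarrow> mv_wedge (of_function A f) w = (\<lambda>p c xs. f p * w p c xs)"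
  by (intro ext) (simp add: mv_wedge_def of_function_scalar wedge_scalar mvfD(2))

end

section \<open>Linear maps determined by their values on functions and vector fields\<close>

context bump_atlas
begin

text \<open>At a point of the chart domain this is the Euler identity in the chart \<open>c\<close>,
  carried to \<open>d\<close> by the multiplicative map \<open>push\<close>. Elsewhere both sides
  vanish.\<close>

lemma bump_square_decomposition:
  assumes h: "bump_at A c p0 h" and c: "c \<in> A" and w: "w \<in> multivector_fields_deg (Suc r) A"
  shows "mv_wedge (of_function A (\<lambda>p. h p * h p)) w = (\<lambda>p d xs. \<Sum>b\<in>onb. 1 / real (Suc r) *
     mv_wedge (of_vector_field (extend_vector h c b))
       (extend_mv h c (\<lambda>x. contract (blinfun_inner_right b) (w (chart_inv c x) c))) p d xs)"
proof -
  have W: "w \<in> multivector_fields A" and deg: "\<And>p c xs. length xs \<noteq> Suc r \<Longrightarrow> w p c xs = 0"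
    using w by (auto simp: multivector_fields_deg_def)
  show ?thesis
    unfolding mv_wedge_of_function[OF W]
  proof (intro ext)
    fix p d xs
    let ?R = "\<Sum>b\<in>onb. 1 / real (Suc r) *
     mv_wedge (of_vector_field (extend_vector h c b))
       (extend_mv h c (\<lambda>x. contract (blinfun_inner_right b) (w (chart_inv c x) c))) p d xs"
    show "h p * h p * w p d xs = ?R"
    proof (cases "d \<in> charts_at A p")
      case False
      then show ?thesis using mvfD(2)[OF W] by (simp add: mv_wedge_def extend_mv_def)
    next
      case d: True
      show ?thesis
      proof (cases "p \<in> fst c")
        case False
        have "h p = 0" using bump_at_outside[OF h _ False] d mem_carrier by blast
        then show ?thesis using False by (simp add: mv_wedge_def extend_mv_def)
      next
        case True
        then have cp: "c \<in> charts_at A p" using c by (simp add: charts_at_iff)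
        let ?J = "jac c d (snd c p)"
        let ?b = "blinfun_inner_right :: 'e \<Rightarrow> _"
        have vec: "vec1 (a *\<^sub>R e) = (\<lambda>xs. a * vec1 e xs)" for a and e :: 'e
          by (auto simp: vec1_def blinfun.scaleR_right split: list.splits)
        have "?R = 1 / real (Suc r) * (h p * h p * (\<Sum>b\<in>onb. wedge (vec1 b) (contract (?b b) (w p c)) (map (\<lambda>x. x o\<^sub>L ?J) xs)))"
          using d True c
          by (simp add: mv_wedge_def of_vector_field_vec1 extend_vector_def extend_mv_def vec wedge_scale
              push_vec1[symmetric] push_wedge[symmetric] sum_distrib_left mult.assoc)
             (simp add: push_def)
        also have "\<dots> = 1 / real (Suc r) * (h p * h p * (length xs * w p d xs))"
          using sum_vec1_wedge_contract[OF mvfD(1)[OF W], of p c "map (\<lambda>x. x o\<^sub>L ?J) xs"]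
          by (simp add: mvfD(3)[OF W cp d] push_def)
        also have "\<dots> = h p * h p * w p d xs"
          \<comment> \<open>For lists of length \<open>Suc r\<close> the factor cancels; for all
            others \<open>w\<close> is zero.\<close>
          using deg[of xs p d] by (cases "length xs = Suc r") simp_all
        finally show ?thesis by simp
      qed
    qed
  qed
qed

text \<open>Homomorphisms and derivations are treated together: \<open>wd\<close> says that
  agreement passes to products, and \<open>ev\<close> expresses locality, recovering the value at
  \<open>q\<close> from a product with a function equal to 1 at a corresponding point
  \<open>p\<close>. The bump function may therefore depend on the point.\<close>

lemma mv_linear_unique:
  assumes F: "mv_linear A B F" and F': "mv_linear A B F'"
    and fn: "\<And>f. f \<in> smooth_functions A \<Longrightarrow> F (of_function A f) = F' (of_function A f)"
    and vf: "\<And>Y. Y \<in> vector_fields A \<Longrightarrow> F (of_vector_field Y) = F' (of_vector_field Y)"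
    and wd: "\<And>v w. \<lbrakk>v \<in> multivector_fields A; w \<in> multivector_fields A; F v = F' v; F w = F' w\<rbrakk>
       \<Longrightarrow> F (mv_wedge v w) = F' (mv_wedge v w)"
    and ev: "\<And>q. q \<in> carrier_of B \<Longrightarrow> \<exists>p\<in>carrier_of A. \<forall>f\<in>smooth_functions A. \<forall>w\<in>multivector_fields A.
       f p = 1 \<longrightarrow> F (mv_wedge (of_function A f) w) = F' (mv_wedge (of_function A f) w) \<longrightarrow> F w q = F' w q"
  shows "F = F'"
proof -
  have eqI: "F w = F' w" if w: "w \<in> multivector_fields A"
    and local: "\<And>p. p \<in> carrier_of A \<Longrightarrow> \<exists>f\<in>smooth_functions A. f p = 1 \<and>
       F (mv_wedge (of_function A f) w) = F' (mv_wedge (of_function A f) w)" for w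
  proof
    fix q
    show "F w q = F' w q"
    proof (cases "q \<in> carrier_of B")
      case True
      then show ?thesis using ev local w by metis
    next
      case False
      \<comment> \<open>Off the carrier there are no charts, and all components are zero by
        convention.\<close>
      then have "c \<notin> charts_at B q" for c by (auto simp: carrier_of_def charts_at_def)
      moreover have "F w q \<in> multivectors_at B q" "F' w q \<in> multivectors_at B q"
        using F F' w by (auto simp: mv_linear_def multivector_fields_def PiE_iff)
      ultimately show ?thesis
        unfolding multivectors_at_def mem_Collect_eq by (metis ext)
    qed
  qed
  have deg: "F w = F' w" if "w \<in> multivector_fields_deg r A" for w r
    using that
  proof (induction r arbitrary: w)
    case 0
    then have w: "w \<in> multivector_fields A" and w0: "\<And>p c xs. xs \<noteq> [] \<Longrightarrow> w p c xs = 0"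
      by (auto simp: multivector_fields_deg_def)
    \<comment> \<open>In degree zero \<open>push\<close> changes nothing, so the value on the empty
      list is the same in every chart at \<open>p\<close> and defines a function.\<close>
    define f where "f p = w p (some_chart A p) []" for p
    have f: "w p c [] = f p" if c: "c \<in> charts_at A p" for p c
    proof -
      have "some_chart A p \<in> charts_at A p" using c mem_carrier some_chart by blast
      from mvfD(3)[OF w this c] show ?thesis by (simp add: f_def push_def)
    qed
    have "w = of_function A f"
    proof (intro ext)
      fix p c xs
      show "w p c xs = of_function A f p c xs"
        using f[of c p] mvfD(2)[OF w, of c p] w0 by (cases "xs = []") (auto simp: of_function_def)
    qed
    moreover have "f \<in> smooth_functions A"
      unfolding smooth_functions_def mem_Collect_eq
    proof
      fix c assume c: "c \<in> A"
      show "smooth_on (snd c ` fst c) (f \<circ> chart_inv c)"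
        by (rule smooth_on_cong[OF open_chart[OF c] mvfD(4)[OF w c, of "[]"]])
          (simp add: f[OF chart_at_chart_inv[OF c]])
    qed
    ultimately show ?case using fn by blast
  next
    case (Suc r)
    have w: "w \<in> multivector_fields A" and w0: "\<And>p c xs. length xs \<noteq> Suc r \<Longrightarrow> w p c xs = 0"
      using Suc.prems by (auto simp: multivector_fields_deg_def)
    show ?case
    proof (rule eqI[OF w])
      fix p assume "p \<in> carrier_of A"
      then obtain c where c: "c \<in> A" "p \<in> fst c" by (auto simp: carrier_of_def)
      obtain h where h: "bump_at A c p h" using bump_exists c by blast
      have hs: "h \<in> smooth_functions A" "h p = 1" using h by (auto simp: bump_at_def)
      have hh: "(\<lambda>p. h p * h p) \<in> smooth_functions A"
        using hs(1) by (auto simp: smooth_functions_def o_def intro: smooth_on_mult open_chart)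
      let ?V = "\<lambda>b. of_vector_field (extend_vector h c b)"
      let ?W = "\<lambda>b. extend_mv h c (\<lambda>x. contract (blinfun_inner_right b) (w (chart_inv c x) c))"
      have V: "extend_vector h c b \<in> vector_fields A" for b
        by (rule extend_vector_vector_fields[OF h c(1)])
      have W: "?W b \<in> multivector_fields A" for b
        by (rule extend_mv_mvf[OF h c(1)])
          (simp_all add: exterior_contract mvfD(1)[OF w], simp add: contract_def mvfD(4)[OF w c(1)])
      moreover have "?W b p c xs = 0" if "length xs \<noteq> r" for b p c xs
        using that w0 by (simp add: extend_mv_def contract_def push_def)
      ultimately have Wr: "?W b \<in> multivector_fields_deg r A" for b
        by (simp add: multivector_fields_deg_def)
      have VW: "mv_wedge (?V b) (?W b) \<in> multivector_fields A" for b
        by (intro mv_wedge_mvf of_vector_field_mvf V W)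
      have FVW: "F (mv_wedge (?V b) (?W b)) = F' (mv_wedge (?V b) (?W b))" for b
        by (intro wd of_vector_field_mvf V W vf Suc.IH Wr)
      have "F (mv_wedge (of_function A (\<lambda>p. h p * h p)) w) = F' (mv_wedge (of_function A (\<lambda>p. h p * h p)) w)"
      proof (cases "(onb :: 'e set) = {}")
        case True
        \<comment> \<open>In dimension zero the sum is empty, outside the scope of
          \<open>mv_linear_sum\<close>; the product is then the zero function, on which the maps
          agree.\<close>
        then have "mv_wedge (of_function A (\<lambda>p. h p * h p)) w = of_function A (\<lambda>_. 0)"
          unfolding bump_square_decomposition[OF h c(1) Suc.prems] by (simp add: of_function_def)
        moreover have "(\<lambda>_. 0) \<in> smooth_functions A"
          by (auto simp: smooth_functions_def o_def intro: smooth_on_const open_chart)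
        ultimately show ?thesis using fn by metis
      next
        case False
        show ?thesis
          unfolding bump_square_decomposition[OF h c(1) Suc.prems]
            mv_linear_sum[OF F finite_onb False VW] mv_linear_sum[OF F' finite_onb False VW]
          by (simp only: FVW)
      qed
      then show "\<exists>f\<in>smooth_functions A. f p = 1 \<and>
          F (mv_wedge (of_function A f) w) = F' (mv_wedge (of_function A f) w)"
        using hh hs(2) by (intro bexI[OF _ hh]) simp
    qed
  qed
  show ?thesis
  proof
    fix w
    show "F w = F' w"
    proof (cases "w \<in> multivector_fields A")
      case True
      let ?W = "\<lambda>r p c xs. if length xs = r then w p c xs else 0"
      have d: "?W r \<in> multivector_fields_deg r A" for r by (rule mvf_restrict_degree[OF True])
      then have W: "?W r \<in> multivector_fields A" for r by (simp add: multivector_fields_deg_def)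
      have "F (\<lambda>p c xs. \<Sum>r\<in>{..card (onb :: 'e set)}. 1 * ?W r p c xs) =
         F' (\<lambda>p c xs. \<Sum>r\<in>{..card (onb :: 'e set)}. 1 * ?W r p c xs)"
      proof -
        have "F (\<lambda>p c xs. \<Sum>r\<in>{..card (onb :: 'e set)}. 1 * ?W r p c xs) =
           (\<lambda>p c xs. \<Sum>r\<in>{..card (onb :: 'e set)}. 1 * F (?W r) p c xs)"
          by (rule mv_linear_sum[OF F _ _ W]) auto
        moreover have "F' (\<lambda>p c xs. \<Sum>r\<in>{..card (onb :: 'e set)}. 1 * ?W r p c xs) =
           (\<lambda>p c xs. \<Sum>r\<in>{..card (onb :: 'e set)}. 1 * F' (?W r) p c xs)"
          by (rule mv_linear_sum[OF F' _ _ W]) auto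
        ultimately show ?thesis by (simp only: deg[OF d])
      qed
      then show ?thesis by (simp only: mvf_degree_expand[OF True])
    next
      case False
      \<comment> \<open>Both maps are extensional, hence \<open>undefined\<close> here.\<close>
      then show ?thesis using F F' by (auto simp: mv_linear_def PiE_def extensional_def)
    qed
  qed
qed

end

context bump_atlas
begin

text \<open>The map \<open>\<phi>\<close> of points underlies the action on functions.
  Multiplication by \<open>f\<close> becomes multiplication by \<open>f (\<phi> q)\<close>, which
  gives locality with \<open>\<phi> q\<close> as the point corresponding to
  \<open>q\<close>.\<close>

lemma graded_algebra_hom_unique:
  assumes B: "atlas B" and F: "graded_algebra_hom A B F" and F': "graded_algebra_hom A B F'"
    and \<phi>: "\<And>q. q \<in> carrier_of B \<Longrightarrow> \<phi> q \<in> carrier_of A"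
    and fn: "\<And>f. f \<in> smooth_functions A \<Longrightarrow> F (of_function A f) = of_function B (\<lambda>q. f (\<phi> q))"
    and fn': "\<And>f. f \<in> smooth_functions A \<Longrightarrow> F' (of_function A f) = of_function B (\<lambda>q. f (\<phi> q))"
    and vf: "\<And>Y. Y \<in> vector_fields A \<Longrightarrow> F (of_vector_field Y) = F' (of_vector_field Y)"
  shows "F = F'"
proof -
  interpret B: atlas B by (rule B)
  have lin: "mv_linear A B F" "mv_linear A B F'" using F F' by (simp_all add: graded_algebra_hom_def)
  have mem: "F w \<in> multivector_fields B" "F' w \<in> multivector_fields B" if "w \<in> multivector_fields A" for w
    using lin that by (auto simp: mv_linear_def PiE_iff)
  have wd: "F (mv_wedge v w) = mv_wedge (F v) (F w)" "F' (mv_wedge v w) = mv_wedge (F' v) (F' w)"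
    if "v \<in> multivector_fields A" "w \<in> multivector_fields A" for v w
    using F F' that unfolding graded_algebra_hom_def by blast+
  show ?thesis
  proof (rule mv_linear_unique[OF lin])
    show "F (of_function A f) = F' (of_function A f)" if "f \<in> smooth_functions A" for f
      using fn fn' that by simp
    show "F (mv_wedge v w) = F' (mv_wedge v w)"
      if "v \<in> multivector_fields A" "w \<in> multivector_fields A" "F v = F' v" "F w = F' w" for v w
      using wd that by simp
    fix q assume q: "q \<in> carrier_of B"
    show "\<exists>p\<in>carrier_of A. \<forall>f\<in>smooth_functions A. \<forall>w\<in>multivector_fields A. f p = 1 \<longrightarrow>
        F (mv_wedge (of_function A f) w) = F' (mv_wedge (of_function A f) w) \<longrightarrow> F w q = F' w q"
    proof (rule bexI[OF _ \<phi>[OF q]], intro ballI impI)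
      fix f w assume f: "f \<in> smooth_functions A" and w: "w \<in> multivector_fields A" and 1: "f (\<phi> q) = 1"
        and eq: "F (mv_wedge (of_function A f) w) = F' (mv_wedge (of_function A f) w)"
      have "(\<lambda>p c xs. f (\<phi> p) * F w p c xs) = (\<lambda>p c xs. f (\<phi> p) * F' w p c xs)"
        using eq by (simp only: wd[OF of_function_mvf[OF f] w] fn[OF f] fn'[OF f] B.mv_wedge_of_function mem[OF w])
      from fun_cong[OF this, of q] show "F w q = F' w q" using 1 by simp
    qed
  qed (rule vf)
qed

text \<open>The Leibniz rule is taken relative to a map \<open>G\<close>, so that both the complete
  lift, with \<open>G\<close> the vertical lift, and the Lie derivative, with \<open>G\<close> the
  identity, are covered.\<close>

lemma derivation_unique:
  assumes B: "atlas B" and F: "mv_linear A B F" and F': "mv_linear A B F'"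
    and \<phi>: "\<And>q. q \<in> carrier_of B \<Longrightarrow> \<phi> q \<in> carrier_of A"
    and G: "\<And>f. f \<in> smooth_functions A \<Longrightarrow> G (of_function A f) = of_function B (\<lambda>q. f (\<phi> q))"
    and wd: "\<And>v w. v \<in> multivector_fields A \<Longrightarrow> w \<in> multivector_fields A \<Longrightarrow>
       F (mv_wedge v w) = mv_lincomb 1 (mv_wedge (F v) (G w)) 1 (mv_wedge (G v) (F w))"
    and wd': "\<And>v w. v \<in> multivector_fields A \<Longrightarrow> w \<in> multivector_fields A \<Longrightarrow>
       F' (mv_wedge v w) = mv_lincomb 1 (mv_wedge (F' v) (G w)) 1 (mv_wedge (G v) (F' w))"
    and fn: "\<And>f. f \<in> smooth_functions A \<Longrightarrow> F (of_function A f) = F' (of_function A f)"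
    and vf: "\<And>Y. Y \<in> vector_fields A \<Longrightarrow> F (of_vector_field Y) = F' (of_vector_field Y)"
  shows "F = F'"
proof -
  interpret B: atlas B by (rule B)
  have mem: "F w \<in> multivector_fields B" "F' w \<in> multivector_fields B" if "w \<in> multivector_fields A" for w
    using F F' that by (auto simp: mv_linear_def PiE_iff)
  show ?thesis
  proof (rule mv_linear_unique[OF F F' fn vf])
    show "F (mv_wedge v w) = F' (mv_wedge v w)"
      if "v \<in> multivector_fields A" "w \<in> multivector_fields A" "F v = F' v" "F w = F' w" for v w
      using wd wd' that by simp
    fix q assume q: "q \<in> carrier_of B"
    show "\<exists>p\<in>carrier_of A. \<forall>f\<in>smooth_functions A. \<forall>w\<in>multivector_fields A. f p = 1 \<longrightarrow>
        F (mv_wedge (of_function A f) w) = F' (mv_wedge (of_function A f) w) \<longrightarrow> F w q = F' w q"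
    proof (rule bexI[OF _ \<phi>[OF q]], intro ballI impI)
      fix f w assume f: "f \<in> smooth_functions A" and w: "w \<in> multivector_fields A" and 1: "f (\<phi> q) = 1"
        and eq: "F (mv_wedge (of_function A f) w) = F' (mv_wedge (of_function A f) w)"
      \<comment> \<open>The term in which \<open>f\<close> itself is differentiated is common to
        both maps and drops out.\<close>
      let ?U = "mv_wedge (F' (of_function A f)) (G w)"
      have "mv_lincomb 1 ?U 1 (\<lambda>p c xs. f (\<phi> p) * F w p c xs) = mv_lincomb 1 ?U 1 (\<lambda>p c xs. f (\<phi> p) * F' w p c xs)"
        using eq by (simp only: wd[OF of_function_mvf[OF f] w] wd'[OF of_function_mvf[OF f] w]
            fn[OF f] G[OF f] B.mv_wedge_of_function mem[OF w])
      from fun_cong[OF this, of q] show "F w q = F' w q" using 1 by (simp add: mv_lincomb_def fun_eq_iff)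
    qed
  qed
qed

end

text \<open>Lifts and pullbacks of vector fields inherit smoothness and the transformation law from
  the corresponding constructions on multivector fields.\<close>

lemma (in atlas) vector_fields_if_mvf:
  assumes w: "of_vector_field Y \<in> multivector_fields A"
  shows "Y \<in> vector_fields A"
proof -
  have "Y p \<in> tangent_space A p" for p
    unfolding tangent_space_iff
  proof (intro conjI ballI allI impI)
    fix c d assume "c \<in> charts_at A p" "d \<in> charts_at A p"
    from mvfD(3)[OF w this] show "Y p d = jac c d (snd c p) (Y p c)"
      by (intro vec1_inject) (simp add: of_vector_field_vec1 push_vec1)
  next
    fix c assume "c \<notin> charts_at A p"
    from mvfD(2)[OF w this] show "Y p c = 0"
      by (intro vec1_inject) (simp add: of_vector_field_vec1 vec1_zero)
  qed
  moreover have "smooth_on (snd c ` fst c) (vector_rep c Y)" if c: "c \<in> A" for c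
  proof -
    \<comment> \<open>The vector is reassembled from its values on the dual basis.\<close>
    have "smooth_on (snd c ` fst c) (\<lambda>x. \<Sum>b\<in>onb. of_vector_field Y (chart_inv c x) c [blinfun_inner_right b] *\<^sub>R b)"
      by (intro smooth_on_sum smooth_on_scaleR smooth_on_const open_chart[OF c] mvfD(4)[OF w c])
    moreover have "(\<lambda>x. \<Sum>b\<in>onb. of_vector_field Y (chart_inv c x) c [blinfun_inner_right b] *\<^sub>R b) = vector_rep c Y"
      using onb_expand by (intro ext) (simp add: of_vector_field_def vector_rep_def inner_commute[of _ "Y _ c"])
    ultimately show ?thesis by simp
  qed
  ultimately show ?thesis by (simp add: vector_fields_def)
qed

section \<open>Explicit formulas for the lifts\<close>

definition lift_map :: "real \<Rightarrow> 'e::real_normed_vector \<Rightarrow>\<^sub>L ('e \<times> 'e)" where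
  "lift_map t = Blinfun (\<lambda>u. (t *\<^sub>R u, u))"

text \<open>The derivative of \<open>lift_map t\<close> with respect to \<open>t\<close>.\<close>

definition horizontal_map :: "'e::real_normed_vector \<Rightarrow>\<^sub>L ('e \<times> 'e)" where
  "horizontal_map = Blinfun (\<lambda>u. (u, 0))"

lemma lift_map_apply [simp]: "lift_map t u = (t *\<^sub>R u, u)"
  unfolding lift_map_def
  by (subst bounded_linear_Blinfun_apply[OF bounded_linear_Pair[OF bounded_linear_scaleR_right bounded_linear_ident]])
    (rule refl)

lemma horizontal_map_apply [simp]: "horizontal_map u = (u, 0)"
  unfolding horizontal_map_def
  by (subst bounded_linear_Blinfun_apply[OF bounded_linear_Pair[OF bounded_linear_ident bounded_linear_zero]])
    (rule refl)

lemma mv_der_map: "mv_der w x u g g' (map f xs) = mv_der w x u (\<lambda>k. g (f k)) (\<lambda>k. g' (f k)) xs"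
  by (auto simp: mv_der_def o_def intro!: sum.cong)

lemma mv_der_cong:
  "(\<And>k. g k = h k) \<Longrightarrow> (\<And>k. g' k = h' k) \<Longrightarrow> mv_der w x u g g' xs = mv_der w x u h h' xs"
proof -
  assume "\<And>k. g k = h k" "\<And>k. g' k = h' k"
  then have "g = h" "g' = h'" by auto
  then show ?thesis by simp
qed

context atlas
begin

interpretation T: atlas TA by (rule atlas_tangent_bundle)

lemma TA_cases:
  assumes "C \<in> charts_at TA q"
  obtains p v c where "q = (p, v)" "C = TC c" "v \<in> tangent_space A p" "c \<in> charts_at A p"
proof -
  obtain p v where q: "q = (p, v)" by (cases q)
  from assms[unfolded q charts_at_TA] obtain c where "v \<in> tangent_space A p" "c \<in> charts_at A p" "C = TC c"
    by blast
  with q that show thesis by blast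
qed

lemma mvf_TA_I:
  assumes "\<And>q C. C \<notin> charts_at TA q \<Longrightarrow> w q C = (\<lambda>_. 0)"
    and "\<And>p v c. v \<in> tangent_space A p \<Longrightarrow> c \<in> charts_at A p \<Longrightarrow> w (p, v) (TC c) \<in> exterior_algebra"
    and "\<And>p v c d. v \<in> tangent_space A p \<Longrightarrow> c \<in> charts_at A p \<Longrightarrow> d \<in> charts_at A p \<Longrightarrow>
       w (p, v) (TC d) = push (jac (TC c) (TC d) (snd c p, v c)) (w (p, v) (TC c))"
    and "\<And>c xs. c \<in> A \<Longrightarrow> smooth_on (snd c ` fst c \<times> UNIV)
       (\<lambda>z. w (chart_inv c (fst z), extend_tvec A (chart_inv c (fst z)) c (snd z)) (TC c) xs)"
  shows "w \<in> multivector_fields TA"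
proof (rule T.mvfI)
  fix q C assume "C \<in> charts_at TA q"
  then obtain p v c where "q = (p, v)" "C = TC c" "v \<in> tangent_space A p" "c \<in> charts_at A p"
    by (rule TA_cases)
  then show "w q C \<in> exterior_algebra"
    using assms(2)[of v p c] by simp
next
  fix q C D assume C: "C \<in> charts_at TA q" and D: "D \<in> charts_at TA q"
  from C obtain p v c where 1: "q = (p, v)" "C = TC c" "v \<in> tangent_space A p" "c \<in> charts_at A p"
    by (rule TA_cases)
  moreover from D obtain d where 2: "d \<in> charts_at A p" "D = TC d"
    unfolding 1 charts_at_TA by blast
  ultimately show "w q D = push (jac C D (snd C q)) (w q C)"
    using assms(3)[of v p c d] by (simp only: snd_TC)
next
  fix C xs assume "C \<in> TA"
  then obtain c where c: "c \<in> A" "C = TC c" by (auto simp: tangent_bundle_def)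
  show "smooth_on (snd C ` fst C) (\<lambda>x. w (chart_inv C x) C xs)"
    unfolding c(2) TC_image_self[OF c(1)]
  proof (rule smooth_on_cong[OF _ assms(4)[OF c(1)]])
    show "open (snd c ` fst c \<times> (UNIV :: 'e set))" using open_chart[OF c(1)] by (simp add: open_Times)
    fix z :: "'e \<times> 'e" assume "z \<in> snd c ` fst c \<times> UNIV"
    then show "w (chart_inv c (fst z), extend_tvec A (chart_inv c (fst z)) c (snd z)) (TC c) xs =
      w (chart_inv (TC c) z) (TC c) xs"
      by (cases z) (simp only: chart_inv_TC[OF c(1)] fst_conv snd_conv mem_Times_iff)
  qed
qed (rule assms(1))

lemma base_chart_charts_at: "c \<in> charts_at A p \<Longrightarrow> base_chart A (TC c) = c"
  by (simp add: charts_at_iff)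

lemma linear_hess:
  assumes "c \<in> charts_at A p" "d \<in> charts_at A p"
  shows "linear (hess c d (snd c p) u)"
  using has_derivative_linear[OF has_derivative_jac[of c d "snd c p"]] assms by (auto simp: charts_at_iff)

lemma differential_chart:
  assumes f: "f \<in> smooth_functions A" and c: "c \<in> charts_at A p" and v: "v \<in> tangent_space A p"
  shows "differential A f p v = frechet_derivative (f \<circ> chart_inv c) (at (snd c p)) (v c)"
proof -
  define d where "d = some_chart A p"
  have d: "d \<in> charts_at A p" using c mem_carrier some_chart d_def by blast
  have A: "c \<in> A" "d \<in> A" "p \<in> fst c" "p \<in> fst d" using c d by (auto simp: charts_at_iff)
  have "(f \<circ> chart_inv c) differentiable (at (snd c p))"
    using f A smooth_on_differentiable[of "snd c ` fst c" "f \<circ> chart_inv c" "snd c p"] by (auto simp: smooth_functions_def)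
  then have D: "((f \<circ> chart_inv c) has_derivative frechet_derivative (f \<circ> chart_inv c) (at (snd c p)))
     (at (trans_map d c (snd d p)))"
    using A by (simp only: trans_map_chart differentiable_frechetD)
  have "((\<lambda>x. (f \<circ> chart_inv c) (trans_map d c x)) has_derivative
     (\<lambda>h. frechet_derivative (f \<circ> chart_inv c) (at (snd c p)) (jac d c (snd d p) h))) (at (snd d p))"
    using A by (intro has_derivative_compose[OF has_derivative_trans[OF A(2,1)] D]) auto
  then have "((f \<circ> chart_inv d) has_derivative
     (\<lambda>h. frechet_derivative (f \<circ> chart_inv c) (at (snd c p)) (jac d c (snd d p) h))) (at (snd d p))"
    by (rule has_derivative_transform_within_open[OF _ open_overlap[OF A(2,1)]]) (use A in auto)
  from frechet_derivative_eqI[OF this] show ?thesis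
    using tangent_spaceD[OF v d c] by (simp add: differential_def d_def[symmetric] Let_def)
qed

section \<open>The vertical and complete lifts of multivector fields\<close>

definition vertical_mv where
  "vertical_mv w q C = (if C \<in> charts_at TA q then push (lift_map 0) (w (fst q) (base_chart A C)) else (\<lambda>_. 0))"

text \<open>The derivative of the curve formula is written out with \<open>mv_der\<close>: this form
  shows the smooth dependence on the point of \<open>TM\<close>, while
  \<open>complete_mv_curve\<close> provides the form suited to algebraic identities.\<close>

definition complete_mv where
  "complete_mv w q C = (\<lambda>xs. if C \<in> charts_at TA q
     then mv_der (\<lambda>x. w (chart_inv (base_chart A C) x) (base_chart A C)) (snd (base_chart A C) (fst q))
       (snd q (base_chart A C)) (\<lambda>\<xi>. \<xi> o\<^sub>L lift_map 0) (\<lambda>\<xi>. \<xi> o\<^sub>L horizontal_map) xs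
     else 0)"

lemma vertical_mv_TC:
  "v \<in> tangent_space A p \<Longrightarrow> c \<in> charts_at A p \<Longrightarrow> vertical_mv w (p, v) (TC c) = push (lift_map 0) (w p c)"
  by (simp add: vertical_mv_def TC_charts_at base_chart_charts_at)

lemma complete_mv_TC:
  "v \<in> tangent_space A p \<Longrightarrow> c \<in> charts_at A p \<Longrightarrow> complete_mv w (p, v) (TC c) =
    mv_der (\<lambda>x. w (chart_inv c x) c) (snd c p) (v c) (\<lambda>\<xi>. \<xi> o\<^sub>L lift_map 0) (\<lambda>\<xi>. \<xi> o\<^sub>L horizontal_map)"
  by (simp add: complete_mv_def TC_charts_at base_chart_charts_at)

lemma vertical_mv_mvf:
  assumes w: "w \<in> multivector_fields A"
  shows "vertical_mv w \<in> multivector_fields TA"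
proof (rule mvf_TA_I)
  fix p v c assume "v \<in> tangent_space A p" "c \<in> charts_at A p"
  then show "vertical_mv w (p, v) (TC c) \<in> exterior_algebra"
    by (simp add: vertical_mv_TC exterior_push mvfD(1)[OF w])
next
  fix p v c d assume v: "v \<in> tangent_space A p" and c: "c \<in> charts_at A p" and d: "d \<in> charts_at A p"
  let ?J = "jac (TC c) (TC d) (snd c p, v c)"
  \<comment> \<open>The Hessian term of the transition map acts on horizontal components, and
    \<open>lift_map 0\<close> produces none.\<close>
  have "?J o\<^sub>L lift_map 0 = lift_map 0 o\<^sub>L jac c d (snd c p)"
    by (intro blinfun_eqI) (simp add: jac_TC[OF c d v] linear_0[OF linear_hess[OF c d]] blinfun.zero_right)
  then show "vertical_mv w (p, v) (TC d) = push ?J (vertical_mv w (p, v) (TC c))"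
    by (simp add: vertical_mv_TC v c d push_push mvfD(3)[OF w c d])
next
  fix c xs assume c: "c \<in> A"
  have o: "open (snd c ` fst c \<times> (UNIV :: 'e set))" using open_chart[OF c] by (simp add: open_Times)
  have "smooth_on (snd c ` fst c \<times> (UNIV :: 'e set)) (\<lambda>z. w (chart_inv c (fst z)) c (map (\<lambda>\<xi>. \<xi> o\<^sub>L lift_map 0) xs))"
    by (rule smooth_on_compose[OF mvfD(4)[OF w c] smooth_on_fst[OF o smooth_on_ident[OF o]] o open_chart[OF c]]) auto
  then show "smooth_on (snd c ` fst c \<times> UNIV)
     (\<lambda>z. vertical_mv w (chart_inv c (fst z), extend_tvec A (chart_inv c (fst z)) c (snd z)) (TC c) xs)"
    by (rule smooth_on_cong[OF o])
      (use chart_at_chart_inv[OF c] extend_tvec_tangent in \<open>simp add: mem_Times_iff vertical_mv_TC push_def\<close>)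
qed (simp add: vertical_mv_def)

lemma complete_mv_curve:
  assumes w: "w \<in> multivector_fields A" and v: "v \<in> tangent_space A p" and c: "c \<in> charts_at A p"
  shows "((\<lambda>t. push (lift_map t) (w (chart_inv c (snd c p + t *\<^sub>R v c)) c) xs) has_vector_derivative
     complete_mv w (p, v) (TC c) xs) (at 0)"
proof -
  have A: "c \<in> A" "p \<in> fst c" using c by (auto simp: charts_at_iff)
  have "((\<lambda>t. (\<lambda>x. w (chart_inv c x) c) (snd c p + t *\<^sub>R v c) (map (\<lambda>\<xi>. \<xi> o\<^sub>L lift_map t) xs)) has_vector_derivative
    mv_der (\<lambda>x. w (chart_inv c x) c) (snd c p + 0 *\<^sub>R v c) (v c) (\<lambda>\<xi>. \<xi> o\<^sub>L lift_map 0) (\<lambda>\<xi>. \<xi> o\<^sub>L horizontal_map) xs) (at 0)"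
  proof (rule has_vector_derivative_exterior)
    show "w (chart_inv c z) c \<in> exterior_algebra" for z by (rule mvfD(1)[OF w])
    show "(\<lambda>z. w (chart_inv c z) c ys) differentiable at (snd c p + 0 *\<^sub>R v c)" for ys
      using smooth_on_differentiable[OF mvfD(4)[OF w A(1)]] A by simp
    show "((\<lambda>t. snd c p + t *\<^sub>R v c) has_vector_derivative v c) (at 0)"
      by (auto intro!: derivative_eq_intros simp: has_vector_derivative_def)
    show "((\<lambda>t. blinfun_apply (\<xi> o\<^sub>L lift_map t) y) has_vector_derivative blinfun_apply (\<xi> o\<^sub>L horizontal_map) y) (at 0)"
      for \<xi> :: "('e \<times> 'e) \<Rightarrow>\<^sub>L real" and y
    proof -
      have "((\<lambda>t. (t *\<^sub>R y, y)) has_derivative (\<lambda>h. (h *\<^sub>R y, 0))) (at 0)"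
        by (auto intro!: derivative_eq_intros)
      from bounded_linear.has_derivative[OF blinfun.bounded_linear_right this, of \<xi>]
      show ?thesis
        by (simp add: has_vector_derivative_def linear_scale[OF bounded_linear.linear[OF blinfun.bounded_linear_right[of \<xi>]], of _ "(y, 0)", simplified])
    qed
  qed
  then show ?thesis by (simp add: complete_mv_TC[OF v c] push_def)
qed

text \<open>A complete lift is computed from any expression for the curve valid near 0. The
  neighbourhood \<open>S\<close> allows for lines that leave the image of the chart.\<close>

lemma complete_mv_eqI:
  assumes w: "w \<in> multivector_fields A" and v: "v \<in> tangent_space A p" and c: "c \<in> charts_at A p"
    and f: "(f has_vector_derivative D) (at 0)" and S: "open S" "0 \<in> S"
    and eq: "\<And>t. t \<in> S \<Longrightarrow> f t = push (lift_map t) (w (chart_inv c (snd c p + t *\<^sub>R v c)) c) xs"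
  shows "complete_mv w (p, v) (TC c) xs = D"
  by (rule vector_derivative_unique_at[OF complete_mv_curve[OF w v c]
        has_vector_derivative_transform_within_open[OF f S eq]])

lemma chart_line_open:
  assumes "c \<in> charts_at A p" "d \<in> charts_at A p"
  shows "open {t. snd c p + t *\<^sub>R u \<in> snd c ` (fst c \<inter> fst d)}"
    and "0 \<in> {t. snd c p + t *\<^sub>R u \<in> snd c ` (fst c \<inter> fst d)}"
proof -
  have "open ((\<lambda>t. snd c p + t *\<^sub>R u) -` (snd c ` (fst c \<inter> fst d)))"
    using assms by (intro open_vimage open_overlap continuous_intros) (auto simp: charts_at_iff)
  then show "open {t. snd c p + t *\<^sub>R u \<in> snd c ` (fst c \<inter> fst d)}" by (simp add: vimage_def)
  show "0 \<in> {t. snd c p + t *\<^sub>R u \<in> snd c ` (fst c \<inter> fst d)}"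
    using assms by (auto simp: charts_at_iff)
qed

text \<open>Along the line, the transformation law of \<open>w\<close> involves a Jacobian that
  depends on \<open>t\<close>. Its derivative is the Hessian at \<open>y\<close> and
  \<open>v c\<close>, whereas the transition map of \<open>TM\<close> supplies the Hessian at
  \<open>v c\<close> and \<open>y\<close>; symmetry identifies the two.\<close>

lemma complete_mv_transform:
  assumes w: "w \<in> multivector_fields A" and v: "v \<in> tangent_space A p"
    and c: "c \<in> charts_at A p" and d: "d \<in> charts_at A p"
  shows "complete_mv w (p, v) (TC d) = push (jac (TC c) (TC d) (snd c p, v c)) (complete_mv w (p, v) (TC c))"
proof
  fix xs
  let ?J = "jac (TC c) (TC d) (snd c p, v c)"
  let ?S = "{t. snd c p + t *\<^sub>R v c \<in> snd c ` (fst c \<inter> fst d)}"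
  let ?\<gamma> = "\<lambda>t. snd c p + t *\<^sub>R v c"
  let ?w = "\<lambda>d x. w (chart_inv d x) d"
  have A: "c \<in> A" "d \<in> A" "p \<in> fst c" "p \<in> fst d" using c d by (auto simp: charts_at_iff)
  have x: "snd c p \<in> snd c ` (fst c \<inter> fst d)" using A by auto
  have line: "(?\<gamma> has_vector_derivative v c) (at 0)"
    by (auto intro!: derivative_eq_intros simp: has_vector_derivative_def)
  have dw: "(\<lambda>z. ?w c z ys) differentiable (at (snd c p))" if "c \<in> charts_at A p" for c ys
    using smooth_on_differentiable[OF mvfD(4)[OF w]] that by (auto simp: charts_at_iff)
  have line': "((\<lambda>t. trans_map c d (?\<gamma> t)) has_vector_derivative v d) (at 0)"
    using has_derivative_line[where f="trans_map c d" and x="snd c p" and s=0 and u="v c"] has_derivative_trans[OF A(1,2) x]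
      tangent_spaceD[OF v c d] by simp
  have lift: "((\<lambda>t. blinfun_apply \<xi> (t *\<^sub>R f t, f t)) has_vector_derivative blinfun_apply \<xi> (f 0, f')) (at 0)"
    if "(f has_vector_derivative f') (at 0)" for f f' and \<xi> :: "('e \<times> 'e) \<Rightarrow>\<^sub>L real"
  proof -
    have "((\<lambda>t. (t *\<^sub>R f t, f t)) has_derivative (\<lambda>h. (0 *\<^sub>R (h *\<^sub>R f') + h *\<^sub>R f 0, h *\<^sub>R f'))) (at 0)"
      using that unfolding has_vector_derivative_def
      by (intro has_derivative_Pair has_derivative_scaleR has_derivative_ident)
    then have "((\<lambda>t. (t *\<^sub>R f t, f t)) has_derivative (\<lambda>h. h *\<^sub>R (f 0, f'))) (at 0)" by simp
    from bounded_linear.has_derivative[OF blinfun.bounded_linear_right this, of \<xi>]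
    show ?thesis by (simp only: has_vector_derivative_def blinfun.scaleR_right)
  qed
  \<comment> \<open>The line in the chart \<open>c\<close> may be curved in the chart
    \<open>d\<close>, but its velocity at 0 is \<open>v d\<close>, so the derivative is still the
    complete lift in \<open>d\<close>.\<close>
  have "((\<lambda>t. ?w d (trans_map c d (?\<gamma> t)) (map (\<lambda>\<xi>. \<xi> o\<^sub>L lift_map t) xs)) has_vector_derivative
    mv_der (?w d) (trans_map c d (?\<gamma> 0)) (v d) (\<lambda>\<xi>. \<xi> o\<^sub>L lift_map 0) (\<lambda>\<xi>. \<xi> o\<^sub>L horizontal_map) xs) (at 0)"
  proof (rule has_vector_derivative_exterior[OF mvfD(1)[OF w] _ line'])
    show "(\<lambda>z. ?w d z ys) differentiable at (trans_map c d (?\<gamma> 0))" for ys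
      using dw[OF d] A by simp
    show "((\<lambda>t. blinfun_apply (\<xi> o\<^sub>L lift_map t) y) has_vector_derivative blinfun_apply (\<xi> o\<^sub>L horizontal_map) y) (at 0)"
      for \<xi> :: "('e \<times> 'e) \<Rightarrow>\<^sub>L real" and y
      using lift[OF has_vector_derivative_const[of y]] by simp
  qed
  then have 1: "((\<lambda>t. ?w d (trans_map c d (?\<gamma> t)) (map (\<lambda>\<xi>. \<xi> o\<^sub>L lift_map t) xs)) has_vector_derivative
     complete_mv w (p, v) (TC d) xs) (at 0)"
    using A by (simp add: complete_mv_TC[OF v d])
  have 2: "((\<lambda>t. ?w c (?\<gamma> t) (map (\<lambda>\<xi>. \<xi> o\<^sub>L lift_map t o\<^sub>L jac c d (?\<gamma> t)) xs)) has_vector_derivative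
    mv_der (?w c) (?\<gamma> 0) (v c) (\<lambda>\<xi>. \<xi> o\<^sub>L lift_map 0 o\<^sub>L jac c d (?\<gamma> 0)) (\<lambda>\<xi>. \<xi> o\<^sub>L ?J o\<^sub>L horizontal_map) xs) (at 0)"
  proof (rule has_vector_derivative_exterior[OF mvfD(1)[OF w] _ line])
    show "(\<lambda>z. ?w c z ys) differentiable at (?\<gamma> 0)" for ys
      using dw[OF c] by simp
    show "((\<lambda>t. blinfun_apply (\<xi> o\<^sub>L lift_map t o\<^sub>L jac c d (?\<gamma> t)) y) has_vector_derivative
        blinfun_apply (\<xi> o\<^sub>L ?J o\<^sub>L horizontal_map) y) (at 0)" for \<xi> :: "('e \<times> 'e) \<Rightarrow>\<^sub>L real" and y
    proof -
      have "((\<lambda>t. jac c d (?\<gamma> t) y) has_vector_derivative hess c d (snd c p) y (v c)) (at 0)"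
        using has_derivative_line[where f="\<lambda>x. jac c d x y" and x="snd c p" and s=0 and u="v c"]
          has_derivative_jac[OF A(1,2) x] by simp
      from lift[OF this, of \<xi>] show ?thesis
        by (simp add: jac_TC[OF c d v] blinfun.zero_right hess_symmetric[OF A(1,2) x, of y])
    qed
  qed
  have "((\<lambda>t. ?w d (trans_map c d (?\<gamma> t)) (map (\<lambda>\<xi>. \<xi> o\<^sub>L lift_map t) xs)) has_vector_derivative
     mv_der (?w c) (?\<gamma> 0) (v c) (\<lambda>\<xi>. \<xi> o\<^sub>L lift_map 0 o\<^sub>L jac c d (?\<gamma> 0)) (\<lambda>\<xi>. \<xi> o\<^sub>L ?J o\<^sub>L horizontal_map) xs) (at 0)"
  proof (rule has_vector_derivative_transform_within_open[OF 2 chart_line_open[OF c d]])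
    fix t assume "t \<in> ?S"
    then obtain q where q: "q \<in> fst c" "q \<in> fst d" "?\<gamma> t = snd c q" by auto
    then have "w q d = push (jac c d (snd c q)) (w q c)"
      using A by (intro mvfD(3)[OF w]) (auto simp: charts_at_iff)
    then show "?w c (?\<gamma> t) (map (\<lambda>\<xi>. \<xi> o\<^sub>L lift_map t o\<^sub>L jac c d (?\<gamma> t)) xs) =
      ?w d (trans_map c d (?\<gamma> t)) (map (\<lambda>\<xi>. \<xi> o\<^sub>L lift_map t) xs)"
      using q A by (simp add: push_def o_def)
  qed
  from vector_derivative_unique_at[OF 1 this]
  have "complete_mv w (p, v) (TC d) xs = mv_der (?w c) (snd c p) (v c)
     (\<lambda>\<xi>. \<xi> o\<^sub>L lift_map 0 o\<^sub>L jac c d (snd c p)) (\<lambda>\<xi>. \<xi> o\<^sub>L ?J o\<^sub>L horizontal_map) xs" by simp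
  also have "\<dots> = push ?J (complete_mv w (p, v) (TC c)) xs"
    unfolding push_def complete_mv_TC[OF v c] mv_der_map
  proof (rule mv_der_cong)
    show "\<xi> o\<^sub>L lift_map 0 o\<^sub>L jac c d (snd c p) = \<xi> o\<^sub>L ?J o\<^sub>L lift_map 0" for \<xi> :: "('e \<times> 'e) \<Rightarrow>\<^sub>L real"
      \<comment> \<open>As for the vertical lift, there is no horizontal component for the Hessian
        to act on.\<close>
      by (intro blinfun_eqI) (simp add: jac_TC[OF c d v] linear_0[OF linear_hess[OF c d]] blinfun.zero_right)
  qed simp
  finally show "complete_mv w (p, v) (TC d) xs = push ?J (complete_mv w (p, v) (TC c)) xs" .
qed

lemma complete_mv_mvf:
  assumes w: "w \<in> multivector_fields A"
  shows "complete_mv w \<in> multivector_fields TA"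
proof (rule mvf_TA_I)
  fix p v c assume v: "v \<in> tangent_space A p" and c: "c \<in> charts_at A p"
  show "complete_mv w (p, v) (TC c) \<in> exterior_algebra"
    by (rule exterior_derivative_curve[OF exterior_push[OF mvfD(1)[OF w]] complete_mv_curve[OF w v c]])
next
  fix c and xs :: "(('e \<times> 'e) \<Rightarrow>\<^sub>L real) list" assume c: "c \<in> A"
  let ?S = "snd c ` fst c \<times> (UNIV :: 'e set)"
  let ?g = "map (\<lambda>\<xi>. \<xi> o\<^sub>L lift_map 0) xs"
  have o: "open ?S" using open_chart[OF c] by (simp add: open_Times)
  note f = smooth_on_fst[OF o smooth_on_ident[OF o]]
  have "smooth_on ?S (\<lambda>z. frechet_derivative (\<lambda>x. w (chart_inv c x) c ?g) (at (fst z)) (snd z) +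
     (\<Sum>i<length xs. w (chart_inv c (fst z)) c (?g[i := (xs ! i) o\<^sub>L horizontal_map])))"
    by (intro smooth_on_add smooth_on_sum o smooth_on_derivative[OF mvfD(4)[OF w c]] f
        smooth_on_snd smooth_on_ident smooth_on_compose[OF mvfD(4)[OF w c]] open_chart[OF c]) auto
  then show "smooth_on ?S (\<lambda>z. complete_mv w (chart_inv c (fst z), extend_tvec A (chart_inv c (fst z)) c (snd z)) (TC c) xs)"
  proof (rule smooth_on_cong[OF o])
    fix z assume "z \<in> ?S"
    then have z: "c \<in> charts_at A (chart_inv c (fst z))" "fst z \<in> snd c ` fst c"
      using chart_at_chart_inv[OF c] by (auto simp: mem_Times_iff)
    show "frechet_derivative (\<lambda>x. w (chart_inv c x) c ?g) (at (fst z)) (snd z) +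
     (\<Sum>i<length xs. w (chart_inv c (fst z)) c (?g[i := (xs ! i) o\<^sub>L horizontal_map])) =
     complete_mv w (chart_inv c (fst z), extend_tvec A (chart_inv c (fst z)) c (snd z)) (TC c) xs"
      by (simp add: complete_mv_TC[OF extend_tvec_tangent[OF z(1)] z(1)] mv_der_def
          extend_tvec_self[OF z(1)] chart_chart_inv[OF z(2)])
  qed
qed (simp add: complete_mv_def, rule complete_mv_transform[OF w])

end

lemma (in atlas) TA_eqI:
  assumes "\<And>q C. C \<notin> charts_at TA q \<Longrightarrow> v q C = w q C"
    and "\<And>p u c xs. u \<in> tangent_space A p \<Longrightarrow> c \<in> charts_at A p \<Longrightarrow> v (p, u) (TC c) xs = w (p, u) (TC c) xs"
  shows "v = w"
proof (intro ext)
  fix q C xs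
  show "v q C xs = w q C xs"
  proof (cases "C \<in> charts_at TA q")
    case True
    then obtain p u c where "q = (p, u)" "C = TC c" "u \<in> tangent_space A p" "c \<in> charts_at A p"
      by (rule TA_cases)
    then show ?thesis using assms(2) by blast
  qed (simp add: assms(1))
qed

context bump_atlas
begin

interpretation T: atlas TA by (rule atlas_tangent_bundle)

section \<open>Identification of \<open>vT\<close> and \<open>dT\<close>\<close>

lemma mv_linear_restrict:
  assumes "\<And>w. w \<in> multivector_fields A \<Longrightarrow> F w \<in> multivector_fields B"
    and "\<And>v w a b. \<lbrakk>v \<in> multivector_fields A; w \<in> multivector_fields A\<rbrakk> \<Longrightarrow>
      F (mv_lincomb a v b w) = mv_lincomb a (F v) b (F w)"
  shows "mv_linear A B (restrict F (multivector_fields A))"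
  using assms mv_lincomb_mvf by (simp add: mv_linear_def)

lemma one_smooth: "(\<lambda>_. 1) \<in> smooth_functions A"
  by (auto simp: smooth_functions_def o_def intro: smooth_on_const open_chart)

lemma graded_algebra_hom_restrict:
  assumes "\<And>w. w \<in> multivector_fields A \<Longrightarrow> F w \<in> multivector_fields B"
    and "\<And>v w a b. \<lbrakk>v \<in> multivector_fields A; w \<in> multivector_fields A\<rbrakk> \<Longrightarrow>
      F (mv_lincomb a v b w) = mv_lincomb a (F v) b (F w)"
    and "\<And>v w. \<lbrakk>v \<in> multivector_fields A; w \<in> multivector_fields A\<rbrakk> \<Longrightarrow>
      F (mv_wedge v w) = mv_wedge (F v) (F w)"
    and "F (of_function A (\<lambda>_. 1)) = of_function B (\<lambda>_. 1)"
    and "\<And>r w q c xs. \<lbrakk>w \<in> multivector_fields A; \<And>p c xs. length xs \<noteq> r \<Longrightarrow> w p c xs = 0; length xs \<noteq> r\<rbrakk>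
      \<Longrightarrow> F w q c xs = 0"
  shows "graded_algebra_hom A B (restrict F (multivector_fields A))"
  unfolding graded_algebra_hom_def
proof (intro conjI ballI allI)
  show "mv_linear A B (restrict F (multivector_fields A))"
    by (rule mv_linear_restrict[OF assms(1,2)])
  show "restrict F (multivector_fields A) (of_function A (\<lambda>_. 1)) = of_function B (\<lambda>_. 1)"
    using of_function_mvf[OF one_smooth] assms(4) by simp
  show "restrict F (multivector_fields A) (mv_wedge v w) =
      mv_wedge (restrict F (multivector_fields A) v) (restrict F (multivector_fields A) w)"
    if "v \<in> multivector_fields A" "w \<in> multivector_fields A" for v w
    using that assms(3) mv_wedge_mvf by simp
  show "restrict F (multivector_fields A) ` multivector_fields_deg r A \<subseteq> multivector_fields_deg r B" for r
  proof
    fix u assume "u \<in> restrict F (multivector_fields A) ` multivector_fields_deg r A"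
    then obtain w where w: "w \<in> multivector_fields A" "\<And>p c xs. length xs \<noteq> r \<Longrightarrow> w p c xs = 0" "u = F w"
      by (auto simp: multivector_fields_deg_def)
    then have "u q c xs = 0" if "length xs \<noteq> r" for q c xs using assms(5) that by metis
    then show "u \<in> multivector_fields_deg r B"
      using w assms(1) by (simp add: multivector_fields_deg_def)
  qed
qed

lemma vertical_mv_of_function: "vertical_mv (of_function A f) = of_function TA (\<lambda>q. f (fst q))"
proof (rule TA_eqI)
  fix p u c xs assume "u \<in> tangent_space A p" "c \<in> charts_at A p"
  then show "vertical_mv (of_function A f) (p, u) (TC c) xs = of_function TA (\<lambda>q. f (fst q)) (p, u) (TC c) xs"
    by (simp add: vertical_mv_TC TC_charts_at of_function_scalar T.of_function_scalar push_scalar)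
qed (simp add: vertical_mv_def T.of_function_scalar)

lemma vertical_mv_of_vector_field: "vertical_mv (of_vector_field Y) = of_vector_field (vertical_lift A Y)"
proof (rule TA_eqI)
  fix p u c xs assume "u \<in> tangent_space A p" "c \<in> charts_at A p"
  then show "vertical_mv (of_vector_field Y) (p, u) (TC c) xs = of_vector_field (vertical_lift A Y) (p, u) (TC c) xs"
    by (simp add: vertical_mv_TC TC_charts_at of_vector_field_vec1 push_vec1 vertical_lift_def base_chart_charts_at)
qed (simp add: vertical_mv_def of_vector_field_vec1 vertical_lift_def vec1_zero)

lemma graded_algebra_hom_vertical: "graded_algebra_hom A TA (restrict vertical_mv (multivector_fields A))"
proof (rule graded_algebra_hom_restrict)
  show "vertical_mv (mv_lincomb a v b w) = mv_lincomb a (vertical_mv v) b (vertical_mv w)" for v w a b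
    by (intro ext) (simp add: vertical_mv_def mv_lincomb_def push_def)
  show "vertical_mv (mv_wedge v w) = mv_wedge (vertical_mv v) (vertical_mv w)" for v w
    by (intro ext) (simp add: vertical_mv_def mv_wedge_def push_wedge)
  show "vertical_mv (of_function A (\<lambda>_. 1)) = of_function TA (\<lambda>_. 1)"
    by (simp add: vertical_mv_of_function)
qed (simp_all add: vertical_mv_mvf, simp add: vertical_mv_def push_def)

text \<open>The explicit formula settles existence, restriction to the fields making it extensional;
  uniqueness is that of homomorphisms over the projection.\<close>

lemma vT_eq: "vT A = restrict vertical_mv (multivector_fields A)"
  unfolding vT_def
proof (rule the_equality, intro conjI ballI)
  let ?F = "restrict vertical_mv (multivector_fields A)"
  show 1: "graded_algebra_hom A TA ?F" by (rule graded_algebra_hom_vertical)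
  show 2: "?F (of_function A f) = of_function TA (f \<circ> fst)" if "f \<in> smooth_functions A" for f
    using of_function_mvf[OF that] by (simp add: vertical_mv_of_function o_def)
  show 3: "?F (of_vector_field Y) = of_vector_field (vertical_lift A Y)" if "Y \<in> vector_fields A" for Y
    using of_vector_field_mvf[OF that] by (simp add: vertical_mv_of_vector_field)
  fix F assume F: "graded_algebra_hom A TA F \<and>
    (\<forall>f\<in>smooth_functions A. F (of_function A f) = of_function TA (f \<circ> fst)) \<and>
    (\<forall>Y\<in>vector_fields A. F (of_vector_field Y) = of_vector_field (vertical_lift A Y))"
  show "F = ?F"
  proof (rule graded_algebra_hom_unique[OF atlas_tangent_bundle _ 1, where \<phi>=fst])
    show "fst q \<in> carrier_of A" if "q \<in> carrier_of TA" for q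
      using that by (cases q) (simp add: carrier_TA)
  qed (use F 2 3 in \<open>simp_all add: o_def\<close>)
qed

lemma complete_mv_lincomb:
  assumes v: "v \<in> multivector_fields A" and w: "w \<in> multivector_fields A"
  shows "complete_mv (mv_lincomb a v b w) = mv_lincomb a (complete_mv v) b (complete_mv w)"
proof (rule TA_eqI)
  fix p u c xs assume u: "u \<in> tangent_space A p" and c: "c \<in> charts_at A p"
  show "complete_mv (mv_lincomb a v b w) (p, u) (TC c) xs = mv_lincomb a (complete_mv v) b (complete_mv w) (p, u) (TC c) xs"
    unfolding mv_lincomb_def[of _ "complete_mv v"]
    by (rule complete_mv_eqI[OF mv_lincomb_mvf[OF v w] u c has_vector_derivative_add[OF
          has_vector_derivative_mult_right[OF complete_mv_curve[OF v u c, of xs]]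
          has_vector_derivative_mult_right[OF complete_mv_curve[OF w u c, of xs]]] open_UNIV])
      (simp_all add: mv_lincomb_def push_def)
qed (simp add: complete_mv_def mv_lincomb_def)

text \<open>In the product rule the undifferentiated factors are taken at \<open>t = 0\<close>,
  where \<open>push (lift_map 0)\<close> is the vertical lift.\<close>

lemma complete_mv_wedge:
  assumes v: "v \<in> multivector_fields A" and w: "w \<in> multivector_fields A"
  shows "complete_mv (mv_wedge v w) =
    mv_lincomb 1 (mv_wedge (complete_mv v) (vertical_mv w)) 1 (mv_wedge (vertical_mv v) (complete_mv w))"
proof (rule TA_eqI)
  fix p u c xs assume u: "u \<in> tangent_space A p" and c: "c \<in> charts_at A p"
  have c0: "chart_inv c (snd c p) = p" using c by (simp add: charts_at_iff)
  have "complete_mv (mv_wedge v w) (p, u) (TC c) xs =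
    wedge (complete_mv v (p, u) (TC c)) (push (lift_map 0) (w (chart_inv c (snd c p + 0 *\<^sub>R u c)) c)) xs +
    wedge (push (lift_map 0) (v (chart_inv c (snd c p + 0 *\<^sub>R u c)) c)) (complete_mv w (p, u) (TC c)) xs"
    by (rule complete_mv_eqI[OF mv_wedge_mvf[OF v w] u c wedge_derivative_curve[OF
          complete_mv_curve[OF v u c] complete_mv_curve[OF w u c], where xs=xs] open_UNIV])
      (simp_all add: mv_wedge_def push_wedge)
  then show "complete_mv (mv_wedge v w) (p, u) (TC c) xs =
    mv_lincomb 1 (mv_wedge (complete_mv v) (vertical_mv w)) 1 (mv_wedge (vertical_mv v) (complete_mv w)) (p, u) (TC c) xs"
    by (simp add: mv_lincomb_def mv_wedge_def vertical_mv_TC[OF u c] c0)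
qed (simp add: complete_mv_def mv_lincomb_def mv_wedge_def)

text \<open>In degree zero \<open>push\<close> has no effect, and what remains is the derivative of
  \<open>f\<close> along the line. The comparison is restricted to the times when the line stays in
  the chart, since \<open>of_function\<close> has value zero in a chart that does not contain the
  point.\<close>

lemma complete_mv_of_function:
  assumes f: "f \<in> smooth_functions A"
  shows "complete_mv (of_function A f) = of_function TA (\<lambda>(p, v). differential A f p v)"
proof (rule TA_eqI)
  fix p u c and xs :: "(('e \<times> 'e) \<Rightarrow>\<^sub>L real) list" assume u: "u \<in> tangent_space A p" and c: "c \<in> charts_at A p"
  have A: "c \<in> A" "p \<in> fst c" using c by (auto simp: charts_at_iff)
  have "((f \<circ> chart_inv c) has_derivative frechet_derivative (f \<circ> chart_inv c) (at (snd c p))) (at (snd c p + 0 *\<^sub>R u c))"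
    using f A smooth_on_has_derivative[of "snd c ` fst c" "f \<circ> chart_inv c" "snd c p"] by (auto simp: smooth_functions_def)
  from has_derivative_line[OF this]
  have d: "((\<lambda>t. (f \<circ> chart_inv c) (snd c p + t *\<^sub>R u c)) has_vector_derivative differential A f p u) (at 0)"
    by (simp add: differential_chart[OF f c u])
  have "complete_mv (of_function A f) (p, u) (TC c) xs = (if xs = [] then differential A f p u else 0)"
  proof (rule complete_mv_eqI[OF of_function_mvf[OF f] u c _ chart_line_open[OF c c]])
    show "((\<lambda>t. if xs = [] then (f \<circ> chart_inv c) (snd c p + t *\<^sub>R u c) else 0) has_vector_derivative
       (if xs = [] then differential A f p u else 0)) (at 0)"
      using d by (cases "xs = []") simp_all
    fix t assume "t \<in> {t. snd c p + t *\<^sub>R u c \<in> snd c ` (fst c \<inter> fst c)}"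
    then have "c \<in> charts_at A (chart_inv c (snd c p + t *\<^sub>R u c))"
      using chart_at_chart_inv[OF A(1)] by simp
    then show "(if xs = [] then (f \<circ> chart_inv c) (snd c p + t *\<^sub>R u c) else 0) =
      push (lift_map t) (of_function A f (chart_inv c (snd c p + t *\<^sub>R u c)) c) xs"
      by (simp add: of_function_scalar push_scalar) (simp add: scalar_def)
  qed
  then show "complete_mv (of_function A f) (p, u) (TC c) xs =
    of_function TA (\<lambda>(p, v). differential A f p v) (p, u) (TC c) xs"
    using TC_charts_at[OF u c] by (simp add: of_function_def)
qed (simp add: complete_mv_def of_function_def)

lemma complete_mv_of_vector_field:
  assumes Y: "Y \<in> vector_fields A"
  shows "complete_mv (of_vector_field Y) = of_vector_field (complete_lift A Y)"
proof (rule TA_eqI)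
  fix p u c and xs :: "(('e \<times> 'e) \<Rightarrow>\<^sub>L real) list" assume u: "u \<in> tangent_space A p" and c: "c \<in> charts_at A p"
  have A: "c \<in> A" "p \<in> fst c" using c by (auto simp: charts_at_iff)
  let ?D = "frechet_derivative (vector_rep c Y) (at (snd c p)) (u c)"
  let ?y = "\<lambda>t. vector_rep c Y (snd c p + t *\<^sub>R u c)"
  have "(vector_rep c Y has_derivative frechet_derivative (vector_rep c Y) (at (snd c p))) (at (snd c p + 0 *\<^sub>R u c))"
    using A smooth_on_has_derivative[OF vector_fieldsD(2)[OF Y A(1)], of "snd c p"] by simp
  from has_derivative_line[OF this] have "(?y has_derivative (\<lambda>h. h *\<^sub>R ?D)) (at 0)"
    by (simp add: has_vector_derivative_def)
  \<comment> \<open>The factor \<open>t\<close> makes the first component contribute its value at 0,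
    the base part of the complete lift; the second contributes the derivative of \<open>Y\<close>
    along \<open>u\<close>.\<close>
  then have "((\<lambda>t. (t *\<^sub>R ?y t, ?y t)) has_derivative (\<lambda>h. (0 *\<^sub>R (h *\<^sub>R ?D) + h *\<^sub>R ?y 0, h *\<^sub>R ?D))) (at 0)"
    by (intro has_derivative_Pair has_derivative_scaleR has_derivative_ident)
  moreover have "?y 0 = Y p c" using A by (simp add: vector_rep_def)
  ultimately have "((\<lambda>t. (t *\<^sub>R ?y t, ?y t)) has_derivative (\<lambda>h. h *\<^sub>R (Y p c, ?D))) (at 0)" by simp
  from bounded_linear.has_derivative[OF blinfun.bounded_linear_right this]
  have d: "((\<lambda>t. blinfun_apply \<xi> (t *\<^sub>R ?y t, ?y t)) has_vector_derivative \<xi> (Y p c, ?D)) (at 0)"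
    for \<xi> :: "('e \<times> 'e) \<Rightarrow>\<^sub>L real"
    by (simp only: has_vector_derivative_def blinfun.scaleR_right)
  have "((\<lambda>t. vec1 (t *\<^sub>R ?y t, ?y t) xs) has_vector_derivative vec1 (Y p c, ?D) xs) (at 0)"
    using d by (auto simp: vec1_def split: list.splits)
  then have "complete_mv (of_vector_field Y) (p, u) (TC c) xs = vec1 (Y p c, ?D) xs"
    by (rule complete_mv_eqI[OF of_vector_field_mvf[OF Y] u c _ open_UNIV])
      (simp_all add: of_vector_field_vec1 push_vec1 vector_rep_def)
  then show "complete_mv (of_vector_field Y) (p, u) (TC c) xs = of_vector_field (complete_lift A Y) (p, u) (TC c) xs"
    using TC_charts_at[OF u c] by (simp add: of_vector_field_vec1 complete_lift_def base_chart_charts_at[OF c])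
qed (simp add: complete_mv_def of_vector_field_vec1 complete_lift_def vec1_zero)

lemma dT_eq: "dT A = restrict complete_mv (multivector_fields A)"
  unfolding dT_def
proof (rule the_equality, intro conjI ballI)
  let ?F = "restrict complete_mv (multivector_fields A)"
  show 1: "mv_linear A TA ?F"
    by (rule mv_linear_restrict[OF complete_mv_mvf complete_mv_lincomb])
  show 2: "?F (of_function A f) = of_function TA (\<lambda>(p, v). differential A f p v)" if "f \<in> smooth_functions A" for f
    using of_function_mvf[OF that] complete_mv_of_function[OF that] by simp
  show 3: "?F (of_vector_field Y) = of_vector_field (complete_lift A Y)" if "Y \<in> vector_fields A" for Y
    using of_vector_field_mvf[OF that] complete_mv_of_vector_field[OF that] by simp
  show 4: "?F (mv_wedge v w) = mv_lincomb 1 (mv_wedge (?F v) (vT A w)) 1 (mv_wedge (vT A v) (?F w))"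
    if "v \<in> multivector_fields A" "w \<in> multivector_fields A" for v w
    using that complete_mv_wedge[OF that] mv_wedge_mvf[OF that] by (simp add: vT_eq)
  fix F assume F: "mv_linear A TA F \<and>
    (\<forall>f\<in>smooth_functions A. F (of_function A f) = of_function TA (\<lambda>(p, v). differential A f p v)) \<and>
    (\<forall>Y\<in>vector_fields A. F (of_vector_field Y) = of_vector_field (complete_lift A Y)) \<and>
    (\<forall>v\<in>multivector_fields A. \<forall>w\<in>multivector_fields A. F (mv_wedge v w) =
        mv_lincomb 1 (mv_wedge (F v) (vT A w)) 1 (mv_wedge (vT A v) (F w)))"
  show "F = ?F"
  proof (rule derivation_unique[OF atlas_tangent_bundle _ 1, where \<phi>=fst and G="vT A"])
    show "fst q \<in> carrier_of A" if "q \<in> carrier_of TA" for q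
      using that by (cases q) (simp add: carrier_TA)
    show "vT A (of_function A f) = of_function TA (\<lambda>q. f (fst q))" if "f \<in> smooth_functions A" for f
      using of_function_mvf[OF that] by (simp add: vT_eq vertical_mv_of_function)
  qed (use F 2 3 4 in simp_all)
qed

end

section \<open>The pullback along a vector field\<close>

text \<open>The kernel at \<open>(p, X p)\<close> is the tangent space of \<open>X(M)\<close>, and
  vertical vectors are mapped to their fibre components: this is the projection along
  \<open>X(M)\<close> with vertical vectors identified with tangent vectors of
  \<open>M\<close>.\<close>

definition vertical_part ::
  "('a \<Rightarrow> ('a, 'e::{real_inner, heine_borel}) tvec) \<Rightarrow> 'a \<Rightarrow> ('a, 'e) chart \<Rightarrow> ('e \<times> 'e) \<Rightarrow>\<^sub>L 'e" where
  "vertical_part X p c = Blinfun (\<lambda>h. snd h - frechet_derivative (vector_rep c X) (at (snd c p)) (fst h))"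

context bump_atlas
begin

interpretation T: bump_atlas TA by (rule bump_atlas_tangent_bundle)

definition pull_mv where
  "pull_mv X w p c = (if c \<in> charts_at A p then push (vertical_part X p c) (w (p, X p) (TC c)) else (\<lambda>_. 0))"

context
  fixes X
  assumes X: "X \<in> vector_fields A"
begin

lemma X_tangent: "X p \<in> tangent_space A p"
  by (rule vector_fieldsD(1)[OF X])

lemma X_TC: "c \<in> charts_at A p \<Longrightarrow> TC c \<in> charts_at TA (p, X p)"
  by (rule TC_charts_at[OF X_tangent])

abbreviation DX where "DX c x \<equiv> frechet_derivative (vector_rep c X) (at x)"

lemma has_derivative_X:
  assumes "c \<in> charts_at A p"
  shows "(vector_rep c X has_derivative DX c (snd c p)) (at (snd c p))"
  using assms smooth_on_has_derivative[OF vector_fieldsD(2)[OF X]] by (auto simp: charts_at_iff)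

lemma vertical_part_apply:
  assumes "c \<in> charts_at A p"
  shows "vertical_part X p c h = snd h - DX c (snd c p) (fst h)"
proof -
  have "bounded_linear (\<lambda>h. snd h - DX c (snd c p) (fst h))"
    by (intro bounded_linear_sub bounded_linear_snd
        bounded_linear_compose[OF has_derivative_bounded_linear[OF has_derivative_X[OF assms]] bounded_linear_fst])
  then show ?thesis unfolding vertical_part_def by (simp add: bounded_linear_Blinfun_apply)
qed

lemma vector_rep_X: "c \<in> A \<Longrightarrow> p \<in> fst c \<Longrightarrow> vector_rep c X (snd c p) = X p c"
  by (simp add: vector_rep_def)

text \<open>Two ways to differentiate the transformation law of \<open>X\<close> along a transition
  map: as \<open>X\<close> in the chart \<open>d\<close> after the transition, and as the Jacobian
  applied to \<open>X\<close> in the chart \<open>c\<close>.\<close>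

lemma DX_transform:
  assumes c: "c \<in> charts_at A p" and d: "d \<in> charts_at A p"
  shows "DX d (snd d p) (jac c d (snd c p) y) =
    hess c d (snd c p) (X p c) y + jac c d (snd c p) (DX c (snd c p) y)"
proof -
  have A: "c \<in> A" "d \<in> A" "p \<in> fst c" "p \<in> fst d" using c d by (auto simp: charts_at_iff)
  let ?S = "snd c ` (fst c \<inter> fst d)"
  have x: "snd c p \<in> ?S" using A by auto
  have "((\<lambda>z. frechet_derivative (trans_map c d) (at (fst z)) (snd z)) has_derivative
     (\<lambda>h. hess c d (snd c p) (X p c) (fst h) + jac c d (snd c p) (snd h))) (at (snd c p, X p c))"
    unfolding hess_def jac_apply[OF A(1,2) x]
    by (rule has_derivative_frechet_pair[OF smooth_trans[OF A(1,2)] open_overlap[OF A(1,2)] x])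
  then have "((\<lambda>z. frechet_derivative (trans_map c d) (at (fst z)) (snd z)) has_derivative
     (\<lambda>h. hess c d (snd c p) (X p c) (fst h) + jac c d (snd c p) (snd h))) (at (snd c p, vector_rep c X (snd c p)))"
    using A by (simp add: vector_rep_X)
  from has_derivative_compose[OF has_derivative_Pair[OF has_derivative_ident has_derivative_X[OF c]] this]
  have "((\<lambda>x. frechet_derivative (trans_map c d) (at x) (vector_rep c X x)) has_derivative
     (\<lambda>y. hess c d (snd c p) (X p c) y + jac c d (snd c p) (DX c (snd c p) y))) (at (snd c p))"
    by simp
  then have "((\<lambda>x. vector_rep d X (trans_map c d x)) has_derivative
     (\<lambda>y. hess c d (snd c p) (X p c) y + jac c d (snd c p) (DX c (snd c p) y))) (at (snd c p))"
  proof (rule has_derivative_transform_within_open[OF _ open_overlap[OF A(1,2)] x])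
    fix x assume "x \<in> ?S"
    then obtain q where q: "q \<in> fst c" "q \<in> fst d" "x = snd c q" by auto
    then have "X q d = jac c d (snd c q) (X q c)"
      using A by (intro tangent_spaceD[OF X_tangent]) (auto simp: charts_at_iff)
    then show "frechet_derivative (trans_map c d) (at x) (vector_rep c X x) = vector_rep d X (trans_map c d x)"
      using q A jac_apply[OF A(1,2), of x] by (simp add: vector_rep_X)
  qed
  moreover have "((\<lambda>x. vector_rep d X (trans_map c d x)) has_derivative
     (\<lambda>y. DX d (snd d p) (jac c d (snd c p) y))) (at (snd c p))"
    by (rule has_derivative_compose[OF has_derivative_trans[OF A(1,2) x]])
      (use has_derivative_X[OF d] A in simp)
  ultimately have "(\<lambda>y. DX d (snd d p) (jac c d (snd c p) y)) =
     (\<lambda>y. hess c d (snd c p) (X p c) y + jac c d (snd c p) (DX c (snd c p) y))"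
    by (intro has_derivative_unique)
  from fun_cong[OF this] show ?thesis .
qed

text \<open>The Hessian at \<open>X p c\<close> occurs in the vertical component of the transition
  map of \<open>TM\<close> and again in the derivative of \<open>X\<close>; the difference removes
  it.\<close>

lemma vertical_part_transform:
  assumes c: "c \<in> charts_at A p" and d: "d \<in> charts_at A p"
  shows "vertical_part X p d o\<^sub>L jac (TC c) (TC d) (snd c p, X p c) = jac c d (snd c p) o\<^sub>L vertical_part X p c"
  by (intro blinfun_eqI)
    (simp add: vertical_part_apply[OF c] vertical_part_apply[OF d] jac_TC[OF c d X_tangent] DX_transform[OF c d]
      blinfun.diff_right)

lemma pull_mv_mvf:
  assumes w: "w \<in> multivector_fields TA"
  shows "pull_mv X w \<in> multivector_fields A"
proof (rule mvfI)
  fix p c d assume c: "c \<in> charts_at A p" and d: "d \<in> charts_at A p"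
  have "w (p, X p) (TC d) = push (jac (TC c) (TC d) (snd c p, X p c)) (w (p, X p) (TC c))"
    using T.mvfD(3)[OF w X_TC[OF c] X_TC[OF d]] by (simp only: snd_TC)
  then show "pull_mv X w p d = push (jac c d (snd c p)) (pull_mv X w p c)"
    using c d by (simp add: pull_mv_def push_push vertical_part_transform)
next
  fix c and xs :: "('e \<Rightarrow>\<^sub>L real) list" assume c: "c \<in> A"
  let ?S = "snd c ` fst c"
  have o: "open ?S" and o2: "open (?S \<times> (UNIV :: 'e set))"
    using open_chart[OF c] by (simp_all add: open_Times)
  have TCc: "TC c \<in> TA" using c by (simp add: tangent_bundle_def)
  note sX = vector_fieldsD(2)[OF X c]
  let ?w = "\<lambda>x. w (chart_inv (TC c) (x, vector_rep c X x)) (TC c)"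
  let ?V = "\<lambda>x. vertical_part X (chart_inv c x) c"
  have "smooth_on ?S (\<lambda>x. ?w x (map (\<lambda>\<xi>. \<xi> o\<^sub>L ?V x) xs))"
  proof (rule smooth_on_exterior[OF o T.mvfD(1)[OF w]])
    show "smooth_on ?S (\<lambda>x. ?w x ys)" for ys
      by (rule smooth_on_compose[OF T.mvfD(4)[OF w TCc, unfolded TC_image_self[OF c]]
            smooth_on_Pair[OF o smooth_on_ident[OF o] sX] o o2]) auto
    fix \<xi> :: "'e \<Rightarrow>\<^sub>L real" and y
    have "smooth_on ?S (\<lambda>x. \<xi> (snd y - DX c x (fst y)))"
      by (intro smooth_on_bounded_linear[OF blinfun.bounded_linear_right] o smooth_on_diff smooth_on_const
          smooth_on_derivative_dir sX)
    then show "smooth_on ?S (\<lambda>x. (\<xi> o\<^sub>L ?V x) y)"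
      by (rule smooth_on_cong[OF o])
        (simp add: vertical_part_apply[OF chart_at_chart_inv[OF c]] chart_chart_inv)
  qed
  then show "smooth_on ?S (\<lambda>x. pull_mv X w (chart_inv c x) c xs)"
  proof (rule smooth_on_cong[OF o])
    fix x assume x: "x \<in> ?S"
    have "chart_inv (TC c) (x, vector_rep c X x) = (chart_inv c x, X (chart_inv c x))"
      using chart_inv_TC[OF c x] extend_tvec_tangent_space[OF X_tangent chart_at_chart_inv[OF c x]]
      by (simp add: vector_rep_def)
    then show "?w x (map (\<lambda>\<xi>. \<xi> o\<^sub>L ?V x) xs) = pull_mv X w (chart_inv c x) c xs"
      by (simp add: pull_mv_def chart_at_chart_inv[OF c x] push_def)
  qed
qed (simp_all add: pull_mv_def exterior_push T.mvfD(1)[OF w])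

lemma pull_mv_lincomb: "pull_mv X (mv_lincomb a v b w) = mv_lincomb a (pull_mv X v) b (pull_mv X w)"
  by (intro ext) (simp add: pull_mv_def mv_lincomb_def push_def)

lemma pull_mv_wedge: "pull_mv X (mv_wedge v w) = mv_wedge (pull_mv X v) (pull_mv X w)"
  by (intro ext) (simp add: pull_mv_def mv_wedge_def push_wedge)

lemma pull_mv_of_function: "pull_mv X (of_function TA f) = of_function A (\<lambda>p. f (p, X p))"
  by (intro ext) (simp add: pull_mv_def of_function_scalar T.of_function_scalar push_scalar X_TC)

text \<open>A vector \<open>(0, u)\<close> has vertical part \<open>u\<close>, so
  \<open>vertical_part\<close> is a left inverse of \<open>lift_map 0\<close>.\<close>

lemma pull_mv_vertical_mv:
  assumes w: "w \<in> multivector_fields A"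
  shows "pull_mv X (vertical_mv w) = w"
proof (intro ext)
  fix p c xs
  show "pull_mv X (vertical_mv w) p c xs = w p c xs"
  proof (cases "c \<in> charts_at A p")
    case True
    have "push (vertical_part X p c o\<^sub>L lift_map 0) (w p c) = w p c"
      by (rule push_id)
        (simp add: vertical_part_apply[OF True] linear_0[OF has_derivative_linear[OF has_derivative_X[OF True]]])
    with True show ?thesis
      by (simp add: pull_mv_def vertical_mv_TC[OF X_tangent] push_push)
  qed (simp add: pull_mv_def mvfD(2)[OF w])
qed

lemma graded_algebra_hom_pull: "graded_algebra_hom TA A (restrict (pull_mv X) (multivector_fields TA))"
proof (rule T.graded_algebra_hom_restrict[OF pull_mv_mvf pull_mv_lincomb pull_mv_wedge])
  show "pull_mv X (of_function TA (\<lambda>_. 1)) = of_function A (\<lambda>_. 1)"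
    by (simp add: pull_mv_of_function)
  fix r q c and w :: "('a \<times> ('a, 'e) tvec, 'e \<times> 'e) mvfield" and xs :: "('e \<Rightarrow>\<^sub>L real) list"
  assume "\<And>p C ys. length ys \<noteq> r \<Longrightarrow> w p C ys = 0" "length xs \<noteq> r"
  then show "pull_mv X w q c xs = 0"
    by (simp add: pull_mv_def push_def)
qed

subsection \<open>The vertical projection\<close>

lemma tangent_TA_fst:
  assumes "w \<in> tangent_space TA (p, v)" "c \<in> charts_at A p" "d \<in> charts_at A p" "v \<in> tangent_space A p"
  shows "fst (w (TC d)) = jac c d (snd c p) (fst (w (TC c)))"
  using T.tangent_spaceD[OF assms(1) TC_charts_at[OF assms(4,2)] TC_charts_at[OF assms(4,3)]]
  by (simp add: snd_TC jac_TC[OF assms(2,3,4)])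

text \<open>In induced charts the projection is the first coordinate, so its tangent map is the
  horizontal component followed by a Jacobian. Only the chart selected by \<open>some_chart\<close>
  occurs in \<open>tangent_map\<close>; the transformation law extends the condition to all
  charts.\<close>

lemma vertical_space_iff:
  assumes p: "p \<in> carrier_of A" and v: "v \<in> tangent_space A p"
  shows "w \<in> vertical_space A (p, v) \<longleftrightarrow>
    w \<in> tangent_space TA (p, v) \<and> (\<forall>c\<in>charts_at A p. fst (w (TC c)) = 0)"
proof -
  have "(p, v) \<in> carrier_of TA" using p v by (simp add: carrier_TA)
  from T.some_chart[OF this] obtain c where c: "c \<in> charts_at A p" "some_chart TA (p, v) = TC c"
    by (auto simp: charts_at_TA)
  then have A: "c \<in> A" "p \<in> fst c" by (auto simp: charts_at_iff)
  have fd: "frechet_derivative (snd d \<circ> fst \<circ> chart_inv (TC c)) (at (snd c p, v c)) h = jac c d (snd c p) (fst h)"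
    if d: "d \<in> charts_at A p" for d h
  proof -
    have D: "d \<in> A" "p \<in> fst d" using d by (auto simp: charts_at_iff)
    have x: "snd c p \<in> snd c ` (fst c \<inter> fst d)" using A D by auto
    have "((\<lambda>z. trans_map c d (fst z)) has_derivative (\<lambda>h. jac c d (snd c p) (fst h))) (at (snd c p, v c))"
      using has_derivative_compose[OF bounded_linear_imp_has_derivative[OF bounded_linear_fst],
          where g="trans_map c d" and x="(snd c p, v c)"] has_derivative_trans[OF A(1) D(1) x] by simp
    then have "((snd d \<circ> fst \<circ> chart_inv (TC c)) has_derivative (\<lambda>h. jac c d (snd c p) (fst h))) (at (snd c p, v c))"
    proof (rule has_derivative_transform_within_open)
      show "open (snd c ` fst c \<times> (UNIV :: 'e set))" using open_chart[OF A(1)] by (simp add: open_Times)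
      show "(snd c p, v c) \<in> snd c ` fst c \<times> UNIV" using A by auto
      fix z :: "'e \<times> 'e" assume "z \<in> snd c ` fst c \<times> UNIV"
      then show "trans_map c d (fst z) = (snd d \<circ> fst \<circ> chart_inv (TC c)) z"
        by (cases z) (auto simp: trans_map_def chart_inv_TC[OF A(1)])
    qed
    from frechet_derivative_eqI[OF this] show ?thesis by simp
  qed
  have map: "tangent_map TA A fst (p, v) w = (\<lambda>d. if d \<in> charts_at A p then jac c d (snd c p) (fst (w (TC c))) else 0)"
    by (rule ext) (simp add: tangent_map_def c(2) Let_def snd_TC fd)
  show ?thesis
  proof
    assume w: "w \<in> vertical_space A (p, v)"
    then have t: "w \<in> tangent_space TA (p, v)" and 0: "tangent_map TA A fst (p, v) w = (\<lambda>_. 0)"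
      by (simp_all add: vertical_space_def)
    have "fst (w (TC d)) = 0" if d: "d \<in> charts_at A p" for d
      using fun_cong[OF 0, of d] d unfolding map by (simp add: tangent_TA_fst[OF t c(1) d v])
    with t show "w \<in> tangent_space TA (p, v) \<and> (\<forall>c\<in>charts_at A p. fst (w (TC c)) = 0)" by blast
  next
    assume "w \<in> tangent_space TA (p, v) \<and> (\<forall>c\<in>charts_at A p. fst (w (TC c)) = 0)"
    then show "w \<in> vertical_space A (p, v)"
      using c(1) by (auto simp: vertical_space_def map blinfun.zero_right)
  qed
qed

text \<open>In coordinates the section is \<open>x \<mapsto> (x, X x)\<close>, with derivative
  \<open>y \<mapsto> (y, DX y)\<close>. The condition outside the charts fixes the remaining values
  of the family, so that equality of functions can be concluded.\<close>

lemma horizontal_space_iff: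
  assumes p: "p \<in> carrier_of A"
  shows "w \<in> horizontal_space A X p \<longleftrightarrow> (\<exists>y\<in>tangent_space A p.
     (\<forall>c\<in>charts_at A p. w (TC c) = (y c, DX c (snd c p) (y c))) \<and> (\<forall>C. C \<notin> charts_at TA (p, X p) \<longrightarrow> w C = 0))"
proof -
  define c where "c = some_chart A p"
  have c: "c \<in> charts_at A p" using some_chart[OF p] by (simp add: c_def)
  have A: "c \<in> A" "p \<in> fst c" using c by (auto simp: charts_at_iff)
  let ?L = "tangent_map A TA (\<lambda>p'. (p', X p')) p"
  have out: "?L y C = 0" if "C \<notin> charts_at TA (p, X p)" for y C
    using that by (simp add: tangent_map_def)
  have inn: "?L y (TC d) = (y d, DX d (snd d p) (y d))" if y: "y \<in> tangent_space A p" and d: "d \<in> charts_at A p" for y d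
  proof -
    have D: "d \<in> A" "p \<in> fst d" using d by (auto simp: charts_at_iff)
    let ?S = "snd c ` (fst c \<inter> fst d)"
    have x: "snd c p \<in> ?S" using A D by auto
    have t: "(trans_map c d has_derivative jac c d (snd c p)) (at (snd c p))"
      by (rule has_derivative_trans[OF A(1) D(1) x])
    have "((\<lambda>x. vector_rep d X (trans_map c d x)) has_derivative (\<lambda>y. DX d (snd d p) (jac c d (snd c p) y))) (at (snd c p))"
      by (rule has_derivative_compose[OF t]) (use has_derivative_X[OF d] A in simp)
    from has_derivative_Pair[OF t this]
    have "((snd (TC d) \<circ> (\<lambda>p'. (p', X p')) \<circ> chart_inv c) has_derivative
        (\<lambda>y. (jac c d (snd c p) y, DX d (snd d p) (jac c d (snd c p) y)))) (at (snd c p))"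
      by (rule has_derivative_transform_within_open[OF _ open_overlap[OF A(1) D(1)] x])
        (use A D in \<open>auto simp: snd_TC vector_rep_X\<close>)
    from frechet_derivative_eqI[OF this] show ?thesis
      using X_TC[OF d] tangent_spaceD[OF y c d] by (simp add: tangent_map_def c_def[symmetric])
  qed
  show ?thesis
  proof
    assume "w \<in> horizontal_space A X p"
    then obtain y where "y \<in> tangent_space A p" "w = ?L y" by (auto simp: horizontal_space_def)
    with out inn show "\<exists>y\<in>tangent_space A p. (\<forall>c\<in>charts_at A p. w (TC c) = (y c, DX c (snd c p) (y c))) \<and>
       (\<forall>C. C \<notin> charts_at TA (p, X p) \<longrightarrow> w C = 0)" by blast
  next
    assume "\<exists>y\<in>tangent_space A p. (\<forall>c\<in>charts_at A p. w (TC c) = (y c, DX c (snd c p) (y c))) \<and>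
       (\<forall>C. C \<notin> charts_at TA (p, X p) \<longrightarrow> w C = 0)"
    then obtain y where y: "y \<in> tangent_space A p" "\<And>c. c \<in> charts_at A p \<Longrightarrow> w (TC c) = (y c, DX c (snd c p) (y c))"
      "\<And>C. C \<notin> charts_at TA (p, X p) \<Longrightarrow> w C = 0" by blast
    have "w = ?L y"
    proof
      fix C
      show "w C = ?L y C"
      proof (cases "C \<in> charts_at TA (p, X p)")
        case True
        then obtain d where d: "d \<in> charts_at A p" "C = TC d" unfolding charts_at_TA by blast
        show ?thesis unfolding d(2) using y(2)[OF d(1)] inn[OF y(1) d(1)] by simp
      next
        case False
        then show ?thesis using y(3) out by simp
      qed
    qed
    then show "w \<in> horizontal_space A X p" using y(1) by (simp add: horizontal_space_def)
  qed
qed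

definition pull_vector where
  "pull_vector Y p c = (if c \<in> charts_at A p then vertical_part X p c (Y (p, X p) (TC c)) else 0)"

lemma pull_mv_of_vector_field: "pull_mv X (of_vector_field Y) = of_vector_field (pull_vector Y)"
  by (intro ext) (simp add: pull_mv_def of_vector_field_vec1 push_vec1 pull_vector_def vec1_zero)

lemma pull_vector_vector_fields: "Y \<in> vector_fields TA \<Longrightarrow> pull_vector Y \<in> vector_fields A"
  using pull_mv_mvf[OF T.of_vector_field_mvf] unfolding pull_mv_of_vector_field by (rule vector_fields_if_mvf)

text \<open>Here \<open>(y, z) = (y, DX y) + (0, z - DX y)\<close> is the only decomposition into a
  horizontal and a vertical vector: the first component determines the horizontal summand.\<close>

lemma vertical_projection_eq:
  assumes Y: "Y \<in> vector_fields TA" and p: "p \<in> carrier_of A"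
  shows "vertical_projection A X p (Y (p, X p)) = vertical_lift A (pull_vector Y) (p, X p)"
  unfolding vertical_projection_def
proof (rule the_equality)
  let ?w = "Y (p, X p)" and ?u = "vertical_lift A (pull_vector Y) (p, X p)"
  have w: "?w \<in> tangent_space TA (p, X p)" by (rule T.vector_fieldsD(1)[OF Y])
  have "vertical_lift A (pull_vector Y) \<in> vector_fields TA"
    using vertical_mv_mvf[OF of_vector_field_mvf[OF pull_vector_vector_fields[OF Y]]]
    unfolding vertical_mv_of_vector_field by (rule T.vector_fields_if_mvf)
  from T.vector_fieldsD(1)[OF this] have u: "?u \<in> tangent_space TA (p, X p)" .
  have uc: "?u (TC c) = (0, vertical_part X p c (?w (TC c)))" if "c \<in> charts_at A p" for c
    using that X_TC by (simp add: vertical_lift_def base_chart_charts_at pull_vector_def)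
  \<comment> \<open>The base tangent vector of the horizontal summand has to be the projection of
    \<open>?w\<close>.\<close>
  define y where "y c = (if c \<in> charts_at A p then fst (?w (TC c)) else 0)" for c
  have y: "y \<in> tangent_space A p"
    unfolding tangent_space_iff
  proof (intro conjI ballI allI impI)
    fix c d assume c: "c \<in> charts_at A p" and d: "d \<in> charts_at A p"
    from tangent_TA_fst[OF w c d X_tangent] show "y d = jac c d (snd c p) (y c)"
      using c d by (simp add: y_def)
  qed (simp add: y_def)
  show "?u \<in> vertical_space A (p, X p) \<and> (\<lambda>C. ?w C - ?u C) \<in> horizontal_space A X p"
  proof
    show "?u \<in> vertical_space A (p, X p)"
      unfolding vertical_space_iff[OF p X_tangent] using u uc by simp
    have "?w (TC c) - ?u (TC c) = (y c, DX c (snd c p) (y c))" if c: "c \<in> charts_at A p" for c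
      using c by (simp add: uc[OF c] vertical_part_apply[OF c] y_def prod_eq_iff)
    moreover have "?w C - ?u C = 0" if "C \<notin> charts_at TA (p, X p)" for C
      using T.tangent_space_outside[OF w that] T.tangent_space_outside[OF u that] by (simp only: diff_self)
    ultimately show "(\<lambda>C. ?w C - ?u C) \<in> horizontal_space A X p"
      unfolding horizontal_space_iff[OF p] using y by blast
  qed
  fix u' assume u': "u' \<in> vertical_space A (p, X p) \<and> (\<lambda>C. ?w C - u' C) \<in> horizontal_space A X p"
  then have t: "u' \<in> tangent_space TA (p, X p)" and f0: "\<And>c. c \<in> charts_at A p \<Longrightarrow> fst (u' (TC c)) = 0"
    unfolding vertical_space_iff[OF p X_tangent] by blast+
  from u' obtain y where y: "\<And>c. c \<in> charts_at A p \<Longrightarrow> ?w (TC c) - u' (TC c) = (y c, DX c (snd c p) (y c))"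
    unfolding horizontal_space_iff[OF p] by blast
  show "u' = ?u"
  proof
    fix C
    show "u' C = ?u C"
    proof (cases "C \<in> charts_at TA (p, X p)")
      case True
      then obtain c where c: "c \<in> charts_at A p" "C = TC c" unfolding charts_at_TA by blast
      have "fst (?w (TC c)) = y c" "snd (?w (TC c)) - snd (u' (TC c)) = DX c (snd c p) (y c)"
        using y[OF c(1)] f0[OF c(1)] by (simp_all add: prod_eq_iff)
      then have "u' (TC c) = (0, vertical_part X p c (?w (TC c)))"
        using f0[OF c(1)] by (simp add: prod_eq_iff vertical_part_apply[OF c(1)] algebra_simps)
      then show ?thesis using uc[OF c(1)] c(2) by simp
    next
      case False
      from T.tangent_space_outside[OF t this] T.tangent_space_outside[OF u this] show ?thesis
        by (simp only:)
    qed
  qed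
qed

text \<open>A vector field is determined by its vertical lift along \<open>X\<close> on the carrier,
  and all its components in charts not containing the point are zero.\<close>

lemma pullback_vector_field_eq:
  assumes Y: "Y \<in> vector_fields TA"
  shows "pullback_vector_field A X Y = pull_vector Y"
  unfolding pullback_vector_field_def
proof (rule the_equality)
  show "pull_vector Y \<in> vector_fields A \<and> (\<forall>p\<in>carrier_of A.
     vertical_lift A (pull_vector Y) (p, X p) = vertical_projection A X p (Y (p, X p)))"
    using pull_vector_vector_fields[OF Y] vertical_projection_eq[OF Y] by simp
  fix Z assume Z: "Z \<in> vector_fields A \<and> (\<forall>p\<in>carrier_of A.
     vertical_lift A Z (p, X p) = vertical_projection A X p (Y (p, X p)))"
  show "Z = pull_vector Y"
  proof (intro ext)
    fix p c
    show "Z p c = pull_vector Y p c"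
    proof (cases "c \<in> charts_at A p")
      case True
      then have "p \<in> carrier_of A" using mem_carrier by blast
      then have "vertical_lift A Z (p, X p) (TC c) = vertical_lift A (pull_vector Y) (p, X p) (TC c)"
        using Z vertical_projection_eq[OF Y] by simp
      then show ?thesis
        using X_TC[OF True] by (simp add: vertical_lift_def base_chart_charts_at[OF True])
    next
      case False
      then show ?thesis
        using tangent_space_outside[OF vector_fieldsD(1)] Z by (simp add: pull_vector_def)
    qed
  qed
qed

text \<open>Uniqueness is applied with \<open>TM\<close> as the source and \<open>X\<close> as the
  underlying map of points, which is where the bump functions on \<open>TM\<close> are used.\<close>

lemma pullback_eq: "pullback A X = restrict (pull_mv X) (multivector_fields TA)"
  unfolding pullback_def
proof (rule the_equality, intro conjI ballI)
  let ?F = "restrict (pull_mv X) (multivector_fields TA)"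
  show 1: "graded_algebra_hom TA A ?F" by (rule graded_algebra_hom_pull)
  show 2: "?F (of_function TA f) = of_function A (\<lambda>p. f (p, X p))" if "f \<in> smooth_functions TA" for f
    using T.of_function_mvf[OF that] by (simp add: pull_mv_of_function)
  show 3: "?F (of_vector_field Y) = of_vector_field (pullback_vector_field A X Y)" if "Y \<in> vector_fields TA" for Y
    using T.of_vector_field_mvf[OF that] by (simp add: pull_mv_of_vector_field pullback_vector_field_eq[OF that])
  fix F assume F: "graded_algebra_hom TA A F \<and>
    (\<forall>f\<in>smooth_functions TA. F (of_function TA f) = of_function A (\<lambda>p. f (p, X p))) \<and>
    (\<forall>Y\<in>vector_fields TA. F (of_vector_field Y) = of_vector_field (pullback_vector_field A X Y))"
  show "F = ?F"
  proof (rule T.graded_algebra_hom_unique[OF atlas_axioms _ 1, where \<phi>="\<lambda>p. (p, X p)"])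
    show "(p, X p) \<in> carrier_of TA" if "p \<in> carrier_of A" for p
      using that X_tangent by (simp add: carrier_TA)
  qed (use F 2 3 in simp_all)
qed

section \<open>The Lie derivative\<close>

lemma pull_vector_complete_lift: "of_vector_field (pull_vector (complete_lift A Y)) = of_vector_field (lie_bracket A X Y)"
proof -
  have "pull_vector (complete_lift A Y) p c = lie_bracket A X Y p c" for p c
    using X_TC[of c p] by (simp add: pull_vector_def lie_bracket_def complete_lift_def base_chart_charts_at vertical_part_apply)
  then show ?thesis by (metis ext)
qed

text \<open>Composing with the pullback turns the vertical lifts in the Leibniz rule back into the
  original factors, so uniqueness applies with identities for both \<open>\<phi>\<close> and
  \<open>G\<close>.\<close>

lemma lie_derivative_eq: "lie_derivative A X = restrict (\<lambda>w. pull_mv X (complete_mv w)) (multivector_fields A)"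
  unfolding lie_derivative_def
proof (rule the_equality, intro conjI ballI)
  let ?F = "restrict (\<lambda>w. pull_mv X (complete_mv w)) (multivector_fields A)"
  show 1: "mv_linear A A ?F"
    by (rule mv_linear_restrict) (simp_all add: pull_mv_mvf complete_mv_mvf complete_mv_lincomb pull_mv_lincomb)
  show 2: "?F (of_function A f) = of_function A (\<lambda>p. differential A f p (X p))" if "f \<in> smooth_functions A" for f
    using of_function_mvf[OF that] by (simp add: complete_mv_of_function[OF that] pull_mv_of_function)
  show 3: "?F (of_vector_field Y) = of_vector_field (lie_bracket A X Y)" if "Y \<in> vector_fields A" for Y
    using of_vector_field_mvf[OF that]
    by (simp add: complete_mv_of_vector_field[OF that] pull_mv_of_vector_field pull_vector_complete_lift)
  show 4: "?F (mv_wedge v w) = mv_lincomb 1 (mv_wedge (?F v) w) 1 (mv_wedge v (?F w))"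
    if "v \<in> multivector_fields A" "w \<in> multivector_fields A" for v w
    using that mv_wedge_mvf[OF that]
    by (simp add: complete_mv_wedge[OF that] pull_mv_lincomb pull_mv_wedge pull_mv_vertical_mv)
  fix F assume F: "mv_linear A A F \<and>
    (\<forall>f\<in>smooth_functions A. F (of_function A f) = of_function A (\<lambda>p. differential A f p (X p))) \<and>
    (\<forall>Y\<in>vector_fields A. F (of_vector_field Y) = of_vector_field (lie_bracket A X Y)) \<and>
    (\<forall>v\<in>multivector_fields A. \<forall>w\<in>multivector_fields A. F (mv_wedge v w) =
        mv_lincomb 1 (mv_wedge (F v) w) 1 (mv_wedge v (F w)))"
  show "F = ?F"
    by (rule derivation_unique[OF atlas_axioms _ 1, where \<phi>="\<lambda>p. p" and G="\<lambda>w. w"])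
      (use F 2 3 4 in simp_all)
qed

end

end

theorem theorem3p2:
  fixes A :: "('a, 'e::{real_inner, heine_borel}) chart set"
    and X :: "'a \<Rightarrow> ('a, 'e) tvec"
    and L :: "('a, 'e) mvfield"
  assumes "smooth_manifold A"
    and "X \<in> vector_fields A"
    and "L \<in> multivector_fields A"
  shows "lie_derivative A X L = pullback A X (dT A L) \<and> L = pullback A X (vT A L)"
proof -
  interpret bump_atlas A by (rule bump_atlas_smooth_manifold[OF assms(1)])
  show ?thesis
    using complete_mv_mvf[OF assms(3)] vertical_mv_mvf[OF assms(3)] assms(3)
    by (simp add: lie_derivative_eq[OF assms(2)] pullback_eq[OF assms(2)] dT_eq vT_eq
        pull_mv_vertical_mv[OF assms(2,3)])
qed

end
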